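(* Let $f:\mathbb{R}^d\to\mathbb{R}$ be continuous with a unique $x^*\in\mathbb{R}^d$ such that $f(x^* )=\min f=:\underline f$; assume there is $L_f>0$ with $|f(x)-f(y)|\le L_f(1+|x|+|y|)|x-y|$ for all $x,y\in\mathbb{R}^d$, and there are $c_\ell,c_u,M>0$ with $f(x)-\underline f\le c_u(|x|^2+1)$ for all $x\in\mathbb{R}^d$ and $c_\ell|x|^2\le f(x)-\underline f$ for $|x|\ge M$. Let $\lambda,\delta,s>0$ and any $\Delta t>0$. Let $\varrho_t^{\alpha,s,\Delta t}$ be the unique solution (law) of the Consensus Freezing dynamics with initial data $X_0\sim\varrho_0\in\mathcal P_4(\mathbb{R}^d)$ (not necessarily Gaussian). Let $r=2S$, where $S>0$ is a constant such that, for all sufficiently large $\alpha$ and all $t\ge0$, $\mathbb E_{\varrho_t^{\alpha,s,\Delta t}}[|x|^q]\le S$ for $q\in\mathbb N$, $q\le4$, and $|X^\alpha(\varrho_t^{\alpha,s,\Delta t})|\le S$, and such that $x^*\in B_S(0)$ and $\mathbb E_{\varrho_0}[x]\in B_S(0)$. Let $\boldsymbol\rho_\infty^\alpha=\mathcal N(\boldsymbol\mu_\infty^\alpha,\tfrac{\delta^2}{2\lambda}I_d)$ be the invariant measure of the dynamics with $\boldsymbol\mu_\infty^\alpha\in B_r(x^* )$. Then, for any $\gamma$ with $e^{-s\lambda\Delta t}<\gamma<1$ and for $\alpha>0$ sufficiently large, $$W_2(\varrho_t^{\alpha,s,\Delta t},\boldsymbol\rho_\infty^\alpha)\le C_\alpha\gamma^i\quad\text{for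 }t\in[t_i,t_{i+1}),\ i\in\mathbb N_0,$$ for some $C_\alpha>0$. Furthermore, for any $s^\star>0$, one may choose $C_\alpha$ and $\gamma$ uniformly over all $s\in[s^\star,+\infty)$.
   Context: For a probability measure $\rho$ on $\mathbb{R}^d$ and $\alpha>0$, the consensus point is $X^\alpha(\rho)=\frac{\int x e^{-\alpha f(x)}d\rho(x)}{\int e^{-\alpha f(x)}d\rho(x)}$. $W_2$ is the 2-Wasserstein distance; $\mathcal P_4(\mathbb{R}^d)$ is the set of probability measures with finite fourth moment; balls are closed. Consensus Freezing dynamics: $dX_t=-s\lambda\big(X_t-X^\alpha(\varrho^{\alpha,s,\Delta t}_{t_i})\big)dt+\sqrt s\,\delta\,dB_t$ for $t\in[t_i,t_{i+1})$, $t_i=i\Delta t$, $\varrho^{\alpha,s,\Delta t}_t=\mathrm{Law}(X_t)$. Invariant measure: for every $r>0$ and $\alpha$ sufficiently large, the map $\mathcal T^\alpha(\mu)=X^\alpha(\mathcal N(\mu,\tfrac{\delta^2}{2\lambda}I_d))$ is a contraction of $B_r(x^* )$ into itself; $\boldsymbol\mu_\infty^\alpha$ is its unique fixed point in $B_r(x^* )$, and $\boldsymbol\rho_\infty^\alpha=\mathcal N(\boldsymbol\mu_\infty^\alpha,\tfrac{\delta^2}{2\lambda}I_d)$ is the unique invariant measure of the Consensus Freezing dynamics with mean in $B_r(x^* )$. A constant $S$ as in the claim exists under the stated assumptions on $f$. *)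

theory Defs
  imports "HOL-Probability.Probability"
begin

text \<open>The normal distribution with mean \<open>\<mu>\<close> and covariance matrix \<open>v I\<close>, for \<open>v > 0\<close>:
  its coordinates are independent with variance \<open>v\<close>
  (the second argument of \<^const>\<open>normal_density\<close> is the standard deviation).\<close>

definition gaussian :: "'a::euclidean_space \<Rightarrow> real \<Rightarrow> 'a measure" where
  "gaussian \<mu> v =
     density lborel (\<lambda>x. ennreal (\<Prod>b\<in>Basis. normal_density (\<mu> \<bullet> b) (sqrt v) (x \<bullet> b)))"

definition couplings ::
    "'a::euclidean_space measure \<Rightarrow> 'a measure \<Rightarrow> ('a \<times> 'a) measure set" where
  "couplings \<mu> \<nu> = {\<pi>. sets \<pi> = sets (borel \<Otimes>\<^sub>M borel) \<and> prob_space \<pi> \<and>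
     distr \<pi> borel fst = \<mu> \<and> distr \<pi> borel snd = \<nu>}"

definition W2 :: "'a::euclidean_space measure \<Rightarrow> 'a measure \<Rightarrow> ennreal" where
  "W2 \<mu> \<nu> =
     (let c = (INF \<pi>\<in>couplings \<mu> \<nu>. \<integral>\<^sup>+ z. ennreal ((dist (fst z) (snd z))\<^sup>2) \<partial>\<pi>)
      in if c = \<infinity> then \<infinity> else ennreal (sqrt (enn2real c)))"

definition moment :: "nat \<Rightarrow> 'a::euclidean_space measure \<Rightarrow> ennreal" where
  "moment q \<rho> = (\<integral>\<^sup>+ x. ennreal (norm x ^ q) \<partial>\<rho>)"

definition P4 :: "'a::euclidean_space measure set" where
  "P4 = {\<rho>. sets \<rho> = sets borel \<and> prob_space \<rho> \<and> moment 4 \<rho> < \<infinity>}"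

definition consensus_point ::
    "('a::euclidean_space \<Rightarrow> real) \<Rightarrow> real \<Rightarrow> 'a measure \<Rightarrow> 'a" where
  "consensus_point f \<alpha> \<rho> =
     (\<integral>x. exp (- \<alpha> * f x) *\<^sub>R x \<partial>\<rho>) /\<^sub>R (\<integral>x. exp (- \<alpha> * f x) \<partial>\<rho>)"

text \<open>\<open>B\<close> is a standard Brownian motion relative to the filtration \<open>(F t)\<close>, \<open>t \<ge> 0\<close>,
  with \<open>B 0 = 0\<close>. Values at negative times are irrelevant.\<close>

definition brownian_motion ::
    "'w measure \<Rightarrow> (real \<Rightarrow> 'w measure) \<Rightarrow> (real \<Rightarrow> 'w \<Rightarrow> 'a::euclidean_space) \<Rightarrow> bool" where
  "brownian_motion M F B \<longleftrightarrow>
     prob_space M \<and>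
     (\<forall>t\<ge>0. subalgebra M (F t)) \<and>
     (\<forall>u t. 0 \<le> u \<and> u \<le> t \<longrightarrow> subalgebra (F t) (F u)) \<and>
     (\<forall>t\<ge>0. B t \<in> borel_measurable (F t)) \<and>
     (AE \<omega> in M. B 0 \<omega> = 0) \<and>
     (AE \<omega> in M. continuous_on {0..} (\<lambda>t. B t \<omega>)) \<and>
     (\<forall>u t. 0 \<le> u \<and> u < t \<longrightarrow>
        distr M borel (\<lambda>\<omega>. B t \<omega> - B u \<omega>) = gaussian 0 (t - u) \<and>
        prob_space.indep_set M (sets (F u))
          (sets (vimage_algebra (space M) (\<lambda>\<omega>. B t \<omega> - B u \<omega>) borel)))"

text \<open>\<open>X\<close> is a strong solution, driven by \<open>B\<close>, of the Consensus Freezing dynamics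
  with initial law \<open>\<rho>\<^sub>0\<close>. Since the diffusion coefficient is constant, its stochastic integral
  over \<open>[t\<^sub>i, t]\<close> is \<open>sqrt s \<delta> (B t - B t\<^sub>i)\<close>, and the integrand of the drift has continuous paths.
  The initial value is independent of \<open>B\<close> because it is measurable with respect to \<open>F 0\<close>.\<close>

definition CF_solution ::
    "('a::euclidean_space \<Rightarrow> real) \<Rightarrow> real \<Rightarrow> real \<Rightarrow> real \<Rightarrow> real \<Rightarrow> real \<Rightarrow> 'a measure \<Rightarrow>
     'w measure \<Rightarrow> (real \<Rightarrow> 'w measure) \<Rightarrow> (real \<Rightarrow> 'w \<Rightarrow> 'a) \<Rightarrow> (real \<Rightarrow> 'w \<Rightarrow> 'a) \<Rightarrow> bool" where
  "CF_solution f \<alpha> lam \<delta> s \<Delta>t \<rho>\<^sub>0 M F B X \<longleftrightarrow>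
     brownian_motion M F B \<and>
     (\<forall>t\<ge>0. X t \<in> borel_measurable (F t)) \<and>
     distr M borel (X 0) = \<rho>\<^sub>0 \<and>
     (AE \<omega> in M. continuous_on {0..} (\<lambda>t. X t \<omega>)) \<and>
     (AE \<omega> in M. \<forall>i::nat. \<forall>t\<in>{real i * \<Delta>t ..< real (Suc i) * \<Delta>t}.
        X t \<omega> = X (real i * \<Delta>t) \<omega>
          + integral {real i * \<Delta>t .. t} (\<lambda>u. (- s * lam) *\<^sub>R
              (X u \<omega> - consensus_point f \<alpha> (distr M borel (X (real i * \<Delta>t)))))
          + (sqrt s * \<delta>) *\<^sub>R (B t \<omega> - B (real i * \<Delta>t) \<omega>))"

text \<open>Invariance of \<open>\<nu>\<close> for the Consensus Freezing dynamics: solutions started from \<open>\<nu>\<close> keep the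
  law \<open>\<nu>\<close>. The type argument fixes the type of the underlying sample spaces.\<close>

definition CF_invariant ::
    "'w itself \<Rightarrow> ('a::euclidean_space \<Rightarrow> real) \<Rightarrow> real \<Rightarrow> real \<Rightarrow> real \<Rightarrow> real \<Rightarrow> real \<Rightarrow>
     'a measure \<Rightarrow> bool" where
  "CF_invariant W f \<alpha> lam \<delta> s \<Delta>t \<nu> \<longleftrightarrow>
     (\<forall>(M :: 'w measure) F B X. CF_solution f \<alpha> lam \<delta> s \<Delta>t \<nu> M F B X \<longrightarrow>
        (\<forall>t\<ge>0. distr M borel (X t) = \<nu>))"

definition consensus_map ::
    "('a::euclidean_space \<Rightarrow> real) \<Rightarrow> real \<Rightarrow> real \<Rightarrow> real \<Rightarrow> 'a \<Rightarrow> 'a" where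
  "consensus_map f \<alpha> lam \<delta> \<mu> = consensus_point f \<alpha> (gaussian \<mu> (\<delta>\<^sup>2 / (2 * lam)))"

text \<open>For \<open>\<alpha>\<close> large (depending on \<open>r\<close>) the fixed point exists and is unique, as \<^const>\<open>consensus_map\<close>
  is then a contraction of the ball into itself; for other \<open>\<alpha>\<close> the value is unspecified.\<close>

definition mu_inf ::
    "('a::euclidean_space \<Rightarrow> real) \<Rightarrow> real \<Rightarrow> real \<Rightarrow> real \<Rightarrow> 'a \<Rightarrow> real \<Rightarrow> 'a" where
  "mu_inf f \<alpha> lam \<delta> xs r = (THE \<mu>. \<mu> \<in> cball xs r \<and> consensus_map f \<alpha> lam \<delta> \<mu> = \<mu>)"

definition rho_inf ::
    "('a::euclidean_space \<Rightarrow> real) \<Rightarrow> real \<Rightarrow> real \<Rightarrow> real \<Rightarrow> 'a \<Rightarrow> real \<Rightarrow> 'a measure" where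
  "rho_inf f \<alpha> lam \<delta> xs r = gaussian (mu_inf f \<alpha> lam \<delta> xs r) (\<delta>\<^sup>2 / (2 * lam))"

text \<open>The bounds on a family of flows of laws \<open>\<rho> \<alpha> t\<close> that define the constant \<open>S\<close>.\<close>

definition S_bounds ::
    "('a::euclidean_space \<Rightarrow> real) \<Rightarrow> (real \<Rightarrow> real \<Rightarrow> 'a measure) \<Rightarrow> real \<Rightarrow> bool" where
  "S_bounds f \<rho> S \<longleftrightarrow>
     (\<forall>\<^sub>F \<alpha> in at_top. \<forall>t\<ge>0.
        (\<forall>q\<in>{1..4}. moment q (\<rho> \<alpha> t) \<le> ennreal S) \<and>
        norm (consensus_point f \<alpha> (\<rho> \<alpha> t)) \<le> S)"

end

theory Submission
  imports Defs
begin

text \<open>Between two update times the dynamics is an Ornstein--Uhlenbeck process towards a fixed point \<open>m\<^sub>i\<close>. Hence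
  the law at time \<open>t\<close> is that of \<open>b + p (x - \<integral>x d\<rho>\<^sub>0) + sqrt (v (1 - p\<^sup>2)) \<xi>\<close> with \<open>p = exp (- s \<lambda> t)\<close>,
  \<open>v = \<delta>\<^sup>2 / (2 \<lambda>)\<close>, \<open>x\<close> distributed as \<open>\<rho>\<^sub>0\<close>, and an independent standard normal \<open>\<xi>\<close>. Driving the invariant law by
  the same \<open>\<xi>\<close> bounds \<open>W\<^sub>2\<close> by the distance of the means plus \<open>O(p)\<close>. The means satisfy
  \<open>b\<^sub>i\<^sub>+\<^sub>1 = q b\<^sub>i + (1 - q) m\<^sub>i\<close> with \<open>q = exp (- s \<lambda> \<Delta>t)\<close>, and \<open>m\<^sub>i\<close> is \<open>O(q\<^sup>i)\<close>-close to the consensus point of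
  \<open>N(b\<^sub>i, v I)\<close>, because \<open>e\<^sup>-\<^sup>\<alpha>\<^sup>f\<close> and \<open>x e\<^sup>-\<^sup>\<alpha>\<^sup>f\<close> are globally Lipschitz. For large \<open>\<alpha>\<close> the latter depends on \<open>b\<^sub>i\<close>
  with an arbitrarily small Lipschitz constant, by Laplace's principle.

  From the first update on the laws carry Gaussian noise of variance at least \<open>v (1 - q\<^sup>2)\<close>, so Laplace's principle
  applies with a threshold for \<open>\<alpha>\<close> that is uniform in \<open>s \<ge> s\<^sup>\<star>\<close> and confines the means to a fixed ball.\<close>


subsection \<open>Isotropic Gaussian measures\<close>

text \<open>The rate \<open>\<gamma>\<close> may lie arbitrarily close to \<open>q\<close>, so
  contractivity of the consensus map alone is not enough: its Lipschitz constant must fit into the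
  gap between \<open>q\<close> and \<open>\<gamma>\<close>. Gaussians of equal variance are
  exponential tilts of each other, and the exponent can be centred at \<open>xs\<close>, where the
  weight concentrates; this makes the constant small. The error between the true law and
  \<open>N(b_i, v I)\<close> calls for no such smallness: it carries the factor
  \<open>q ^ i\<close>, so its constant may grow with \<alpha>, and crude Lipschitz bounds for the
  weight suffice.

  The initial law is an obstacle, as it may put no mass near \<open>xs\<close>: its consensus point
  is only bounded, not close to \<open>xs\<close>.

  Neither \<open>v\<close> nor the initial law depends on \<open>s\<close>, which enters only
  through \<open>q\<close>. All estimates are therefore made for every \<open>q\<close> below some
  \<open>q' < \<gamma>\<close>, and the claim for a single \<open>s\<close> is a special case of the
  uniform one.

  No stochastic calculus enters: the noise is additive, so the Euler scheme converges along almost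
  every path, and its law is explicit.\<close>

definition gauss_pdf :: "'a::euclidean_space \<Rightarrow> real \<Rightarrow> 'a \<Rightarrow> real" where
  "gauss_pdf \<mu> v x = (1 / sqrt (2 * pi * v)) ^ DIM('a) * exp (- (norm (x - \<mu>))\<^sup>2 / (2 * v))"

lemma gauss_pdf_prod:
  fixes \<mu> x :: "'a::euclidean_space"
  assumes "v > 0"
  shows "(\<Prod>b\<in>Basis. normal_density (\<mu> \<bullet> b) (sqrt v) (x \<bullet> b)) = gauss_pdf \<mu> v x"
proof -
  have "(norm (x - \<mu>))\<^sup>2 = (\<Sum>b\<in>Basis. ((x \<bullet> b) - (\<mu> \<bullet> b))\<^sup>2)"
    unfolding power2_norm_eq_inner by (subst euclidean_inner) (simp add: inner_diff_left power2_eq_square)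
  then show ?thesis
    using assms
    by (simp add: normal_density_def gauss_pdf_def prod.distrib exp_sum[symmetric]
        sum_negf sum_divide_distrib power_divide prod_dividef)
qed

lemma gauss_pdf_pos: "v > 0 \<Longrightarrow> gauss_pdf \<mu> v x > 0"
  by (simp add: gauss_pdf_def)

lemma gauss_pdf_measurable [measurable]: "gauss_pdf \<mu> v \<in> borel_measurable borel"
  unfolding gauss_pdf_def by measurable

lemma gaussian_eq_density:
  "v > 0 \<Longrightarrow> gaussian \<mu> v = density lborel (\<lambda>x. ennreal (gauss_pdf \<mu> v x))"
  by (simp add: gaussian_def gauss_pdf_prod)

lemma sets_gaussian [simp, measurable_cong]: "sets (gaussian \<mu> v) = sets borel"
  by (simp add: gaussian_def)

lemma space_gaussian [simp]: "space (gaussian \<mu> v) = UNIV"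
  by (simp add: gaussian_def)

lemma nn_integral_gauss_pdf:
  fixes \<mu> :: "'a::euclidean_space"
  assumes "v > 0" shows "(\<integral>\<^sup>+x. ennreal (gauss_pdf \<mu> v x) \<partial>lborel) = 1"
proof -
  have 1: "(\<integral>\<^sup>+x. ennreal (normal_density m (sqrt v) x) \<partial>lborel) = 1" for m
    using assms by (subst nn_integral_eq_integral) auto
  have "(\<integral>\<^sup>+x. ennreal (gauss_pdf \<mu> v x) \<partial>lborel)
      = (\<integral>\<^sup>+x. (\<Prod>b\<in>Basis. ennreal (normal_density (\<mu> \<bullet> b) (sqrt v) (x \<bullet> b))) \<partial>lborel)"
    using assms by (simp add: gauss_pdf_prod[symmetric] prod_ennreal)
  also have "\<dots> = 1"
    by (subst nn_integral_lborel_prod[of "\<lambda>b x. ennreal (normal_density (\<mu> \<bullet> b) (sqrt v) x)"])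
       (auto simp: 1)
  finally show ?thesis .
qed

lemma prob_space_gaussian: "v > 0 \<Longrightarrow> prob_space (gaussian \<mu> v)"
  by (intro prob_spaceI) (simp add: gaussian_eq_density emeasure_density nn_integral_gauss_pdf)

lemma nn_integral_gaussian:
  assumes "v > 0" and [measurable]: "h \<in> borel_measurable borel"
  shows "(\<integral>\<^sup>+x. h x \<partial>gaussian \<mu> v) = (\<integral>\<^sup>+x. ennreal (gauss_pdf \<mu> v x) * h x \<partial>lborel)"
  using assms(1) by (simp add: gaussian_eq_density nn_integral_density)

lemma nn_integral_lborel_affine:
  fixes t :: "'a::euclidean_space"
  assumes "c \<noteq> 0" and [measurable]: "h \<in> borel_measurable borel"
  shows "(\<integral>\<^sup>+x. h x \<partial>lborel) = ennreal (\<bar>c\<bar> ^ DIM('a)) * (\<integral>\<^sup>+x. h (t + c *\<^sub>R x) \<partial>lborel)"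
  by (subst lborel_affine[OF assms(1), of t])
     (simp add: nn_integral_density nn_integral_distr nn_integral_cmult)

lemma gauss_pdf_affine:
  fixes t :: "'a::euclidean_space"
  assumes "c \<noteq> 0" "v > 0"
  shows "\<bar>c\<bar> ^ DIM('a) * gauss_pdf (t + c *\<^sub>R \<mu>) (c\<^sup>2 * v) (t + c *\<^sub>R x) = gauss_pdf \<mu> v x"
proof -
  have "norm (t + c *\<^sub>R x - (t + c *\<^sub>R \<mu>)) = \<bar>c\<bar> * norm (x - \<mu>)"
    by (metis add_diff_cancel_left norm_scaleR scaleR_diff_right)
  moreover have "\<bar>c\<bar> ^ DIM('a) * (1 / sqrt (2 * pi * (c\<^sup>2 * v))) ^ DIM('a) = (1 / sqrt (2 * pi * v)) ^ DIM('a)"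
    using assms by (simp add: power_mult_distrib[symmetric] real_sqrt_mult mult.assoc)
  moreover have "(\<bar>c\<bar> * norm (x - \<mu>))\<^sup>2 / (2 * (c\<^sup>2 * v)) = (norm (x - \<mu>))\<^sup>2 / (2 * v)"
    using assms by (simp add: power_mult_distrib field_simps)
  ultimately show ?thesis
    unfolding gauss_pdf_def by (metis minus_divide_left mult.assoc)
qed

lemma distr_gaussian_affine:
  fixes t \<mu> :: "'a::euclidean_space"
  assumes c: "c \<noteq> 0" and v: "v > 0"
  shows "distr (gaussian \<mu> v) borel (\<lambda>x. t + c *\<^sub>R x) = gaussian (t + c *\<^sub>R \<mu>) (c\<^sup>2 * v)"
proof (rule measure_eqI)
  fix A assume "A \<in> sets (distr (gaussian \<mu> v) borel (\<lambda>x. t + c *\<^sub>R x))"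
  then have A[measurable]: "A \<in> sets borel" by simp
  have v': "c\<^sup>2 * v > 0" using c v by simp
  have "emeasure (gaussian (t + c *\<^sub>R \<mu>) (c\<^sup>2 * v)) A
      = (\<integral>\<^sup>+x. indicator A x \<partial>gaussian (t + c *\<^sub>R \<mu>) (c\<^sup>2 * v))" by simp
  also have "\<dots> = (\<integral>\<^sup>+x. ennreal (gauss_pdf (t + c *\<^sub>R \<mu>) (c\<^sup>2 * v) x) * indicator A x \<partial>lborel)"
    by (rule nn_integral_gaussian[OF v']) simp
  also have "\<dots> = (\<integral>\<^sup>+x. ennreal (\<bar>c\<bar> ^ DIM('a)) * (ennreal (gauss_pdf (t + c *\<^sub>R \<mu>) (c\<^sup>2 * v) (t + c *\<^sub>R x)) * indicator A (t + c *\<^sub>R x)) \<partial>lborel)"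
    by (subst nn_integral_lborel_affine[OF c, of _ t]) (auto simp: nn_integral_cmult)
  also have "\<dots> = (\<integral>\<^sup>+x. ennreal (gauss_pdf \<mu> v x) * indicator A (t + c *\<^sub>R x) \<partial>lborel)"
    using gauss_pdf_affine[OF c v, of t \<mu>]
    by (simp add: mult.assoc[symmetric] ennreal_mult'[symmetric])
  also have "\<dots> = (\<integral>\<^sup>+x. indicator A (t + c *\<^sub>R x) \<partial>gaussian \<mu> v)"
    by (rule nn_integral_gaussian[OF v, symmetric]) simp
  also have "\<dots> = (\<integral>\<^sup>+x. indicator A x \<partial>distr (gaussian \<mu> v) borel (\<lambda>x. t + c *\<^sub>R x))"
    by (subst nn_integral_distr) auto
  also have "\<dots> = emeasure (distr (gaussian \<mu> v) borel (\<lambda>x. t + c *\<^sub>R x)) A" by simp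
  finally show "emeasure (distr (gaussian \<mu> v) borel (\<lambda>x. t + c *\<^sub>R x)) A
      = emeasure (gaussian (t + c *\<^sub>R \<mu>) (c\<^sup>2 * v)) A" by simp
qed simp

lemma gaussian_eq_distr_std:
  "v > 0 \<Longrightarrow> gaussian \<mu> v = distr (gaussian 0 1) borel (\<lambda>x. \<mu> + sqrt v *\<^sub>R x)"
  by (subst distr_gaussian_affine) auto

text \<open>Completing the square: for independent standard normal \<open>z\<close> and \<open>\<xi>\<close>, the joint density of \<open>z\<close> and
  \<open>y = a z + b \<xi>\<close> is symmetric.\<close>

lemma gauss_pdf_rotate:
  fixes y z :: "'a::euclidean_space"
  assumes ab: "a\<^sup>2 + b\<^sup>2 = 1" and b: "b \<noteq> 0"
  shows "gauss_pdf 0 1 z * gauss_pdf (a *\<^sub>R z) (b\<^sup>2) y = gauss_pdf 0 1 y * gauss_pdf (a *\<^sub>R y) (b\<^sup>2) z"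
proof -
  have *: "(norm z)\<^sup>2 / 2 + (norm (y - a *\<^sub>R z))\<^sup>2 / (2 * b\<^sup>2)
      = ((norm y)\<^sup>2 + (norm z)\<^sup>2 - 2 * a * (y \<bullet> z)) / (2 * b\<^sup>2)" for y z :: 'a
  proof -
    have "(norm (y - a *\<^sub>R z))\<^sup>2 = (norm y)\<^sup>2 - 2 * a * (y \<bullet> z) + a\<^sup>2 * (norm z)\<^sup>2"
      unfolding power2_norm_eq_inner
      by (simp add: inner_diff_left inner_diff_right inner_commute power2_eq_square algebra_simps)
    moreover have "b\<^sup>2 * (norm z)\<^sup>2 + a\<^sup>2 * (norm z)\<^sup>2 = (norm z)\<^sup>2"
      by (metis ab add.commute distrib_right mult_1)
    ultimately show ?thesis
      using b by (simp add: field_simps)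
  qed
  have "(norm z)\<^sup>2 / 2 + (norm (y - a *\<^sub>R z))\<^sup>2 / (2 * b\<^sup>2)
      = (norm y)\<^sup>2 / 2 + (norm (z - a *\<^sub>R y))\<^sup>2 / (2 * b\<^sup>2)"
    unfolding * by (simp add: inner_commute algebra_simps)
  then have "exp (- (norm z)\<^sup>2 / 2) * exp (- (norm (y - a *\<^sub>R z))\<^sup>2 / (2 * b\<^sup>2))
      = exp (- (norm y)\<^sup>2 / 2) * exp (- (norm (z - a *\<^sub>R y))\<^sup>2 / (2 * b\<^sup>2))"
    by (simp add: exp_add[symmetric])
  then show ?thesis
    by (simp add: gauss_pdf_def)
qed

text \<open>For \<open>b \<noteq> 0\<close>, conditioning on the first vector gives the combination
  a Gaussian density. By the symmetry in \<open>gauss_pdf_rotate\<close> the first vector can then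
  be integrated out, which contributes the factor 1. For \<open>b = 0\<close> there is no such
  density, but \<open>a\<close> is 1 or -1 and the standard normal law is symmetric.\<close>

lemma gaussian_rotate:
  assumes ab: "a\<^sup>2 + b\<^sup>2 = 1"
  shows "distr (gaussian (0::'a::euclidean_space) 1 \<Otimes>\<^sub>M gaussian 0 1) borel (\<lambda>(x, y). a *\<^sub>R x + b *\<^sub>R y)
    = gaussian 0 1"
proof -
  interpret g: prob_space "gaussian (0::'a) 1" by (rule prob_space_gaussian) simp
  interpret gg: pair_prob_space "gaussian (0::'a) 1" "gaussian (0::'a) 1" ..
  show ?thesis
  proof (cases "b = 0")
    case True
    have a: "a \<noteq> 0" "a\<^sup>2 = 1" using ab True by auto
    have "distr (gaussian (0::'a) 1 \<Otimes>\<^sub>M gaussian 0 1) borel (\<lambda>(x, y). a *\<^sub>R x + b *\<^sub>R y)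
      = distr (distr (gaussian (0::'a) 1 \<Otimes>\<^sub>M gaussian (0::'a) 1) (gaussian 0 1) fst) borel (\<lambda>x. 0 + a *\<^sub>R x)"
      by (subst distr_distr) (auto simp: True comp_def split_beta')
    also have "distr (gaussian (0::'a) 1 \<Otimes>\<^sub>M gaussian (0::'a) 1) (gaussian 0 1) fst = gaussian 0 1"
      by (rule g.distr_pair_fst)
    also have "distr (gaussian (0::'a) 1) borel (\<lambda>x. 0 + a *\<^sub>R x) = gaussian 0 1"
      by (subst distr_gaussian_affine) (use a in auto)
    finally show ?thesis .
  next
    case b: False
    then have b2: "b\<^sup>2 > 0" by simp
    have bb: "gaussian (a *\<^sub>R z) (b\<^sup>2) = distr (gaussian 0 1) borel (\<lambda>y. a *\<^sub>R z + b *\<^sub>R y)" for z :: 'a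
      by (subst distr_gaussian_affine) (use b in auto)
    show ?thesis
    proof (rule measure_eqI)
      fix A assume "A \<in> sets (distr (gaussian (0::'a) 1 \<Otimes>\<^sub>M gaussian 0 1) borel (\<lambda>(x, y). a *\<^sub>R x + b *\<^sub>R y))"
      then have A[measurable]: "A \<in> sets borel" by simp
      have m[measurable]: "(\<lambda>(z, y). gauss_pdf (a *\<^sub>R z) (b\<^sup>2) y) \<in> borel_measurable (borel \<Otimes>\<^sub>M (borel :: 'a measure))"
        unfolding gauss_pdf_def by measurable
      have "emeasure (distr (gaussian (0::'a) 1 \<Otimes>\<^sub>M gaussian 0 1) borel (\<lambda>(x, y). a *\<^sub>R x + b *\<^sub>R y)) A
        = (\<integral>\<^sup>+x. indicator A x \<partial>distr (gaussian (0::'a) 1 \<Otimes>\<^sub>M gaussian 0 1) borel (\<lambda>(x, y). a *\<^sub>R x + b *\<^sub>R y))"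
        by simp
      also have "\<dots> = (\<integral>\<^sup>+z. \<integral>\<^sup>+y. indicator A (a *\<^sub>R z + b *\<^sub>R y) \<partial>gaussian 0 1 \<partial>gaussian 0 1)"
        by (subst nn_integral_distr) (auto simp: g.nn_integral_fst[symmetric])
      also have "\<dots> = (\<integral>\<^sup>+z. \<integral>\<^sup>+y. indicator A y \<partial>gaussian (a *\<^sub>R z) (b\<^sup>2) \<partial>gaussian 0 1)"
        unfolding bb by (subst nn_integral_distr) auto
      also have "\<dots> = (\<integral>\<^sup>+z. \<integral>\<^sup>+y. ennreal (gauss_pdf (a *\<^sub>R z) (b\<^sup>2) y) * indicator A y \<partial>lborel \<partial>gaussian 0 1)"
        by (subst nn_integral_gaussian[OF b2]) simp_all
      also have "\<dots> = (\<integral>\<^sup>+z. ennreal (gauss_pdf 0 1 z) * (\<integral>\<^sup>+y. ennreal (gauss_pdf (a *\<^sub>R z) (b\<^sup>2) y) * indicator A y \<partial>lborel) \<partial>lborel)"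
        by (subst nn_integral_gaussian) simp_all
      also have "\<dots> = (\<integral>\<^sup>+z. \<integral>\<^sup>+y. ennreal (gauss_pdf 0 1 z) * (ennreal (gauss_pdf (a *\<^sub>R z) (b\<^sup>2) y) * indicator A y) \<partial>lborel \<partial>lborel)"
        by (subst nn_integral_cmult) simp_all
      also have "\<dots> = (\<integral>\<^sup>+z. \<integral>\<^sup>+y. ennreal (gauss_pdf 0 1 y) * indicator A y * ennreal (gauss_pdf (a *\<^sub>R y) (b\<^sup>2) z) \<partial>lborel \<partial>lborel)"
      proof (intro nn_integral_cong)
        fix z y :: 'a
        have "ennreal (gauss_pdf 0 1 z) * ennreal (gauss_pdf (a *\<^sub>R z) (b\<^sup>2) y)
          = ennreal (gauss_pdf 0 1 y) * ennreal (gauss_pdf (a *\<^sub>R y) (b\<^sup>2) z)"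
          using gauss_pdf_rotate[OF ab b, of z y] b2
          by (simp add: ennreal_mult[symmetric] gauss_pdf_pos less_imp_le)
        then show "ennreal (gauss_pdf 0 1 z) * (ennreal (gauss_pdf (a *\<^sub>R z) (b\<^sup>2) y) * indicator A y)
          = ennreal (gauss_pdf 0 1 y) * indicator A y * ennreal (gauss_pdf (a *\<^sub>R y) (b\<^sup>2) z)"
          by (metis mult.assoc mult.commute)
      qed
      also have "\<dots> = (\<integral>\<^sup>+y. \<integral>\<^sup>+z. ennreal (gauss_pdf 0 1 y) * indicator A y * ennreal (gauss_pdf (a *\<^sub>R y) (b\<^sup>2) z) \<partial>lborel \<partial>lborel)"
        by (rule lborel_pair.Fubini') simp
      also have "\<dots> = (\<integral>\<^sup>+y. ennreal (gauss_pdf 0 1 y) * indicator A y \<partial>lborel)"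
        by (subst nn_integral_cmult) (simp_all add: nn_integral_gauss_pdf[OF b2])
      also have "\<dots> = (\<integral>\<^sup>+y. indicator A y \<partial>gaussian 0 1)"
        by (subst nn_integral_gaussian) simp_all
      also have "\<dots> = emeasure (gaussian 0 1) A" by simp
      finally show "emeasure (distr (gaussian (0::'a) 1 \<Otimes>\<^sub>M gaussian 0 1) borel (\<lambda>(x, y). a *\<^sub>R x + b *\<^sub>R y)) A
        = emeasure (gaussian 0 1) A" .
    qed simp
  qed
qed

text \<open>Rescaling to the unit circle reduces this to \<open>gaussian_rotate\<close>. The right
  side is an image measure instead of a \<open>gaussian\<close> so that the degenerate case
  \<open>a = b = 0\<close> is included.\<close>

lemma gaussian_convolution:
  "distr (gaussian (0::'a::euclidean_space) 1 \<Otimes>\<^sub>M gaussian 0 1) borel (\<lambda>(x, y). a *\<^sub>R x + b *\<^sub>R y)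
    = distr (gaussian 0 1) borel (\<lambda>x. sqrt (a\<^sup>2 + b\<^sup>2) *\<^sub>R x)"
proof (cases "a\<^sup>2 + b\<^sup>2 = 0")
  case True
  then have ab: "a = 0" "b = 0"
    by (auto simp: sum_power2_eq_zero_iff)
  interpret g: prob_space "gaussian (0::'a) 1" by (rule prob_space_gaussian) simp
  have "distr (gaussian (0::'a) 1) borel (\<lambda>x. 0::'a)
      = distr (distr (gaussian (0::'a) 1 \<Otimes>\<^sub>M gaussian (0::'a) 1) (gaussian 0 1) fst) borel (\<lambda>x. 0)"
    by (subst g.distr_pair_fst) simp
  also have "\<dots> = distr (gaussian (0::'a) 1 \<Otimes>\<^sub>M gaussian (0::'a) 1) borel (\<lambda>x. 0)"
    by (subst distr_distr) (auto simp: comp_def)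
  finally show ?thesis by (simp add: ab split_beta')
next
  case False
  define r where "r = sqrt (a\<^sup>2 + b\<^sup>2)"
  have r: "r > 0" "r\<^sup>2 = a\<^sup>2 + b\<^sup>2"
    using False by (auto simp: r_def sum_power2_gt_zero_iff sum_power2_eq_zero_iff)
  have "(a / r)\<^sup>2 + (b / r)\<^sup>2 = 1"
    using False by (simp add: power_divide r(2) add_divide_distrib[symmetric])
  from gaussian_rotate[OF this, where 'a = 'a]
  have "distr (gaussian (0::'a) 1) borel (\<lambda>x. r *\<^sub>R x)
    = distr (distr (gaussian (0::'a) 1 \<Otimes>\<^sub>M gaussian 0 1) borel (\<lambda>(x, y). (a / r) *\<^sub>R x + (b / r) *\<^sub>R y)) borel (\<lambda>x. r *\<^sub>R x)"
    by simp
  also have "\<dots> = distr (gaussian (0::'a) 1 \<Otimes>\<^sub>M gaussian 0 1) borel (\<lambda>(x, y). a *\<^sub>R x + b *\<^sub>R y)"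
    using r(1) by (subst distr_distr) (auto simp: comp_def split_beta' scaleR_add_right)
  finally show ?thesis by (simp add: r_def)
qed

text \<open>The law of \<open>b + p x + c \<xi>\<close>, where \<open>x\<close> has law \<open>\<nu>\<close> and \<open>\<xi>\<close> is an independent standard normal
  vector. Unlike \<^const>\<open>gaussian\<close>, this is meaningful in the noiseless case \<open>c = 0\<close>.\<close>

definition noised :: "'a::euclidean_space measure \<Rightarrow> 'a \<Rightarrow> real \<Rightarrow> real \<Rightarrow> 'a measure" where
  "noised \<nu> b p c = distr (\<nu> \<Otimes>\<^sub>M gaussian 0 1) borel (\<lambda>(x, \<xi>). b + p *\<^sub>R x + c *\<^sub>R \<xi>)"

lemma sets_noised [simp, measurable_cong]: "sets (noised \<nu> b p c) = sets borel"
  by (simp add: noised_def)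

lemma space_noised [simp]: "space (noised \<nu> b p c) = UNIV"
  by (simp add: noised_def)

lemma noised_map_measurable:
  assumes [measurable_cong]: "sets \<nu> = sets borel"
  shows "(\<lambda>(x, \<xi>). b + p *\<^sub>R x + c *\<^sub>R \<xi>) \<in> borel_measurable (\<nu> \<Otimes>\<^sub>M gaussian (0::'a::euclidean_space) 1)"
  by measurable

lemma prob_space_pair_std:
  assumes "prob_space \<nu>"
  shows "prob_space (\<nu> \<Otimes>\<^sub>M gaussian (0::'a::euclidean_space) 1)"
proof -
  interpret n: prob_space \<nu> by fact
  interpret g: prob_space "gaussian (0::'a) 1" by (rule prob_space_gaussian) simp
  interpret pair_prob_space \<nu> "gaussian (0::'a) 1" ..
  show ?thesis by unfold_locales
qed

lemma prob_space_noised: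
  assumes "prob_space \<nu>" "sets \<nu> = sets borel"
  shows "prob_space (noised \<nu> b p c)"
  unfolding noised_def
  by (rule prob_space.prob_space_distr[OF prob_space_pair_std[OF assms(1)] noised_map_measurable[OF assms(2)]])

lemma nn_integral_noised:
  fixes \<nu> :: "'a::euclidean_space measure"
  assumes [measurable_cong]: "sets \<nu> = sets borel" and [measurable]: "h \<in> borel_measurable borel"
  shows "(\<integral>\<^sup>+x. h x \<partial>noised \<nu> b p c)
    = (\<integral>\<^sup>+x. \<integral>\<^sup>+\<xi>. h (b + p *\<^sub>R x + c *\<^sub>R \<xi>) \<partial>gaussian 0 1 \<partial>\<nu>)"
proof -
  interpret g: prob_space "gaussian (0::'a) 1" by (rule prob_space_gaussian) simp
  show ?thesis
    unfolding noised_def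
    by (subst nn_integral_distr) (auto simp: g.nn_integral_fst[symmetric])
qed

lemma integral_noised:
  fixes h :: "'a::euclidean_space \<Rightarrow> 'b::{banach, second_countable_topology}"
  assumes [measurable_cong]: "sets \<nu> = sets borel" and [measurable]: "h \<in> borel_measurable borel"
  shows "(\<integral>x. h x \<partial>noised \<nu> b p c)
    = (\<integral>z. h (b + p *\<^sub>R fst z + c *\<^sub>R snd z) \<partial>(\<nu> \<Otimes>\<^sub>M gaussian 0 1))"
  unfolding noised_def by (subst integral_distr) (auto simp: split_beta')

text \<open>Given the initial point, the result is affine in two independent noises, which
  \<open>gaussian_convolution\<close> merges into one. This is the composition rule behind the
  Markov property of the dynamics, for the Euler scheme and for the exact flow alike.\<close>

lemma noised_noised:
  fixes \<nu> :: "'a::euclidean_space measure"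
  assumes nu [measurable_cong]: "sets \<nu> = sets borel"
  shows "noised (noised \<nu> b p c) b' p' c'
    = noised \<nu> (b' + p' *\<^sub>R b) (p' * p) (sqrt ((p' * c)\<^sup>2 + c'\<^sup>2))"
proof (rule measure_eqI)
  fix A assume "A \<in> sets (noised (noised \<nu> b p c) b' p' c')"
  then have A [measurable]: "A \<in> sets borel" by simp
  interpret g: prob_space "gaussian (0::'a) 1" by (rule prob_space_gaussian) simp
  define g where "g x z = (indicator A (b' + p' *\<^sub>R b + (p' * p) *\<^sub>R x + z) :: ennreal)" for x z :: 'a
  have [measurable]: "g x \<in> borel_measurable borel" for x
    unfolding g_def by measurable
  have inner: "(\<integral>\<^sup>+\<xi>. \<integral>\<^sup>+\<eta>. g x ((p' * c) *\<^sub>R \<xi> + c' *\<^sub>R \<eta>) \<partial>gaussian 0 1 \<partial>gaussian 0 1)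
      = (\<integral>\<^sup>+\<xi>. g x (sqrt ((p' * c)\<^sup>2 + c'\<^sup>2) *\<^sub>R \<xi>) \<partial>gaussian 0 1)" for x
  proof -
    have "(\<integral>\<^sup>+\<xi>. \<integral>\<^sup>+\<eta>. g x ((p' * c) *\<^sub>R \<xi> + c' *\<^sub>R \<eta>) \<partial>gaussian 0 1 \<partial>gaussian 0 1)
      = (\<integral>\<^sup>+z. g x z \<partial>distr (gaussian 0 1 \<Otimes>\<^sub>M gaussian 0 1) borel (\<lambda>(\<xi>, \<eta>). (p' * c) *\<^sub>R \<xi> + c' *\<^sub>R \<eta>))"
      by (subst nn_integral_distr) (auto simp: g.nn_integral_fst[symmetric])
    also have "\<dots> = (\<integral>\<^sup>+\<xi>. g x (sqrt ((p' * c)\<^sup>2 + c'\<^sup>2) *\<^sub>R \<xi>) \<partial>gaussian 0 1)"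
      unfolding gaussian_convolution by (subst nn_integral_distr) auto
    finally show ?thesis .
  qed
  have "emeasure (noised (noised \<nu> b p c) b' p' c') A
      = (\<integral>\<^sup>+x. indicator A x \<partial>noised (noised \<nu> b p c) b' p' c')" by simp
  also have "\<dots> = (\<integral>\<^sup>+y. \<integral>\<^sup>+\<eta>. indicator A (b' + p' *\<^sub>R y + c' *\<^sub>R \<eta>) \<partial>gaussian 0 1 \<partial>noised \<nu> b p c)"
    by (rule nn_integral_noised) simp_all
  also have "\<dots> = (\<integral>\<^sup>+x. \<integral>\<^sup>+\<xi>. \<integral>\<^sup>+\<eta>. indicator A (b' + p' *\<^sub>R (b + p *\<^sub>R x + c *\<^sub>R \<xi>) + c' *\<^sub>R \<eta>)
      \<partial>gaussian 0 1 \<partial>gaussian 0 1 \<partial>\<nu>)"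
    by (rule nn_integral_noised[OF nu]) simp_all
  also have "\<dots> = (\<integral>\<^sup>+x. \<integral>\<^sup>+\<xi>. \<integral>\<^sup>+\<eta>. g x ((p' * c) *\<^sub>R \<xi> + c' *\<^sub>R \<eta>) \<partial>gaussian 0 1 \<partial>gaussian 0 1 \<partial>\<nu>)"
    by (simp add: g_def algebra_simps)
  also have "\<dots> = (\<integral>\<^sup>+x. indicator A x \<partial>noised \<nu> (b' + p' *\<^sub>R b) (p' * p) (sqrt ((p' * c)\<^sup>2 + c'\<^sup>2)))"
    unfolding inner by (subst nn_integral_noised[OF nu]) (simp_all add: g_def)
  also have "\<dots> = emeasure (noised \<nu> (b' + p' *\<^sub>R b) (p' * p) (sqrt ((p' * c)\<^sup>2 + c'\<^sup>2))) A"
    by simp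
  finally show "emeasure (noised (noised \<nu> b p c) b' p' c') A
      = emeasure (noised \<nu> (b' + p' *\<^sub>R b) (p' * p) (sqrt ((p' * c)\<^sup>2 + c'\<^sup>2))) A" .
qed simp

lemma noised_trivial:
  fixes \<nu> :: "'a::euclidean_space measure"
  assumes [measurable_cong]: "sets \<nu> = sets borel"
  shows "noised \<nu> 0 1 0 = \<nu>"
proof -
  interpret g: prob_space "gaussian (0::'a) 1" by (rule prob_space_gaussian) simp
  show ?thesis
  proof (rule measure_eqI)
    fix A assume "A \<in> sets (noised \<nu> 0 1 0)"
    then have [measurable]: "A \<in> sets borel" by simp
    have "emeasure (noised \<nu> 0 1 0) A = (\<integral>\<^sup>+x. indicator A x \<partial>noised \<nu> 0 1 0)" by simp
    also have "\<dots> = emeasure \<nu> A"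
      by (subst nn_integral_noised) (simp_all add: assms g.emeasure_space_1[simplified])
    finally show "emeasure (noised \<nu> 0 1 0) A = emeasure \<nu> A" .
  qed (simp add: assms)
qed

text \<open>The factor 0 makes the initial law irrelevant, so \<open>\<nu>\<close> is arbitrary.
  Gaussians thereby belong to the same family as the laws of the dynamics, and bounds that are
  uniform over the family cover both.\<close>

lemma gaussian_eq_noised:
  fixes \<nu> :: "'a::euclidean_space measure"
  assumes "v > 0" and nu: "prob_space \<nu>" "sets \<nu> = sets borel"
  shows "gaussian \<mu> v = noised \<nu> \<mu> 0 (sqrt v)"
proof (rule measure_eqI)
  interpret n: prob_space \<nu> by fact
  fix A assume "A \<in> sets (gaussian \<mu> v)"
  then have [measurable]: "A \<in> sets borel" by simp
  have "emeasure (gaussian \<mu> v) A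
      = (\<integral>\<^sup>+x. indicator A x \<partial>distr (gaussian 0 1) borel (\<lambda>x. \<mu> + sqrt v *\<^sub>R x))"
    using assms(1) by (simp add: gaussian_eq_distr_std[symmetric])
  also have "\<dots> = (\<integral>\<^sup>+\<xi>. indicator A (\<mu> + sqrt v *\<^sub>R \<xi>) \<partial>gaussian 0 1)"
    by (subst nn_integral_distr) auto
  also have "\<dots> = (\<integral>\<^sup>+x. indicator A x \<partial>noised \<nu> \<mu> 0 (sqrt v))"
    by (subst nn_integral_noised[OF nu(2)]) (simp_all add: n.emeasure_space_1)
  finally show "emeasure (gaussian \<mu> v) A = emeasure (noised \<nu> \<mu> 0 (sqrt v)) A" by simp
qed simp

lemma noised_gaussian:
  fixes \<mu> :: "'a::euclidean_space"
  assumes v: "v > 0" and pos: "p\<^sup>2 * v + c\<^sup>2 > 0"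
  shows "noised (gaussian \<mu> v) b p c = gaussian (b + p *\<^sub>R \<mu>) (p\<^sup>2 * v + c\<^sup>2)"
proof -
  have g: "prob_space (gaussian (0::'a) 1)" by (rule prob_space_gaussian) simp
  have "noised (gaussian \<mu> v) b p c = noised (noised (gaussian 0 1) \<mu> 0 (sqrt v)) b p c"
    by (subst gaussian_eq_noised[OF v g]) simp_all
  also have "\<dots> = noised (gaussian 0 1) (b + p *\<^sub>R \<mu>) 0 (sqrt (p\<^sup>2 * v + c\<^sup>2))"
    using v by (subst noised_noised) (simp_all add: power_mult_distrib)
  also have "\<dots> = gaussian (b + p *\<^sub>R \<mu>) (p\<^sup>2 * v + c\<^sup>2)"
    by (rule gaussian_eq_noised[OF pos g, symmetric]) simp
  finally show ?thesis .
qed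

subsection \<open>The law of the dynamics\<close>

text \<open>Closed sets generate the Borel sets and are stable under intersection, and the indicator
  of a closed set is the pointwise limit of continuous cutoffs of the distance to it. In this form
  the law of an almost sure limit can be identified by dominated convergence.\<close>

lemma prob_measure_eqI_continuous:
  fixes \<mu> \<nu> :: "'a::metric_space measure"
  assumes "prob_space \<mu>" "prob_space \<nu>" and sets: "sets \<mu> = sets borel" "sets \<nu> = sets borel"
    and eq: "\<And>h :: 'a \<Rightarrow> real. continuous_on UNIV h \<Longrightarrow> (\<And>x. 0 \<le> h x) \<Longrightarrow> (\<And>x. h x \<le> 1)
      \<Longrightarrow> (\<integral>x. h x \<partial>\<mu>) = (\<integral>x. h x \<partial>\<nu>)"
  shows "\<mu> = \<nu>"
proof (rule measure_eqI_generator_eq[where \<Omega> = UNIV and E = "Collect closed" and A = "\<lambda>_. UNIV"])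
  interpret m: prob_space \<mu> by fact
  interpret n: prob_space \<nu> by fact
  show "sets \<mu> = sigma_sets UNIV (Collect closed)" "sets \<nu> = sigma_sets UNIV (Collect closed)"
    using sets by (simp_all add: borel_eq_closed)
  show "emeasure \<mu> UNIV \<noteq> \<infinity>" for i :: nat by simp
  fix A :: "'a set" assume "A \<in> Collect closed"
  then have A: "closed A" by simp
  show "emeasure \<mu> A = emeasure \<nu> A"
  proof (cases "A = {}")
    case False
    define h where "h n x = max 0 (1 - real n * infdist x A)" for n x
    have lim: "(\<lambda>n. h n x) \<longlonglongrightarrow> indicator A x" for x
    proof (cases "x \<in> A")
      case True
      then show ?thesis by (simp add: h_def)
    next
      case xA: False
      then have d: "infdist x A > 0"
        using A False by (simp add: infdist_pos_not_in_closed)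
      obtain N :: nat where N: "1 / infdist x A < real N" using reals_Archimedean2 by blast
      have "h n x = 0" if "n \<ge> N" for n
      proof -
        have "1 / infdist x A < real n" using N that by linarith
        then have "1 < real n * infdist x A" using d by (simp add: field_simps)
        then show ?thesis by (simp add: h_def)
      qed
      then have "\<forall>\<^sub>F n in sequentially. h n x = 0"
        by (auto simp: eventually_sequentially)
      then show ?thesis using xA by (simp add: tendsto_eventually)
    qed
    have cont: "continuous_on UNIV (h n)" for n
      unfolding h_def by (intro continuous_intros)
    have bd: "0 \<le> h n x" "h n x \<le> 1" for n x
      by (auto simp: h_def infdist_nonneg)
    have conv: "(\<lambda>n. \<integral>x. h n x \<partial>\<kappa>) \<longlonglongrightarrow> measure \<kappa> A"
      if "prob_space \<kappa>" and s[measurable_cong]: "sets \<kappa> = sets borel" for \<kappa> :: "'a measure"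
    proof -
      interpret k: prob_space \<kappa> by fact
      have [measurable]: "h n \<in> borel_measurable borel" for n
        by (rule borel_measurable_continuous_onI[OF cont])
      have [measurable]: "A \<in> sets borel" using A by simp
      have sp: "space \<kappa> = UNIV" using s by (metis sets_eq_imp_space_eq space_borel)
      have "(\<lambda>n. \<integral>x. h n x \<partial>\<kappa>) \<longlonglongrightarrow> (\<integral>x. indicator A x \<partial>\<kappa>)"
        by (rule integral_dominated_convergence[where w = "\<lambda>_. 1"]) (use lim bd in auto)
      then show ?thesis by (simp add: sp)
    qed
    have "(\<lambda>n. \<integral>x. h n x \<partial>\<mu>) = (\<lambda>n. \<integral>x. h n x \<partial>\<nu>)"
      using eq[OF cont bd] by simp
    then have "measure \<mu> A = measure \<nu> A"
      using conv[OF assms(1) sets(1)] conv[OF assms(2) sets(2)] by (metis LIMSEQ_unique)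
    then show ?thesis by (simp add: m.emeasure_eq_measure n.emeasure_eq_measure)
  qed simp
qed (auto simp: Int_stable_def)

text \<open>Both sides are integrals over fixed probability spaces of a bounded continuous function
  whose argument converges pointwise, so dominated convergence applies to each; a vanishing noise
  level \<open>c'\<close> causes no trouble. The condition on \<open>Y n\<close> is only eventual
  because the Euler scheme is controlled only once its step is small enough.\<close>

lemma noised_limit:
  fixes Y :: "nat \<Rightarrow> 'w \<Rightarrow> 'a::euclidean_space"
  assumes M: "prob_space M" and nu: "prob_space \<nu>" "sets \<nu> = sets borel"
    and Yn: "\<forall>\<^sub>F n in sequentially. Y n \<in> borel_measurable M \<and> distr M borel (Y n) = noised \<nu> (b n) (p n) (c n)"
    and Z [measurable]: "Z \<in> borel_measurable M"
    and lim: "AE \<omega> in M. (\<lambda>n. Y n \<omega>) \<longlonglongrightarrow> Z \<omega>"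
    and bl: "b \<longlonglongrightarrow> b'" and pl: "p \<longlonglongrightarrow> p'" and cl: "c \<longlonglongrightarrow> c'"
  shows "distr M borel Z = noised \<nu> b' p' c'"
proof (rule prob_measure_eqI_continuous)
  interpret M: prob_space M by fact
  interpret pg: prob_space "\<nu> \<Otimes>\<^sub>M gaussian (0::'a) 1" by (rule prob_space_pair_std[OF nu(1)])
  show "prob_space (distr M borel Z)" by (rule M.prob_space_distr) simp
  show "prob_space (noised \<nu> b' p' c')" by (rule prob_space_noised[OF nu])
  note nu(2)[measurable_cong]
  fix h :: "'a \<Rightarrow> real"
  assume h: "continuous_on UNIV h" "\<And>x. 0 \<le> h x" "\<And>x. h x \<le> 1"
  have [measurable]: "h \<in> borel_measurable borel" by (rule borel_measurable_continuous_onI[OF h(1)])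
  have hc: "(\<lambda>n. h (g n)) \<longlonglongrightarrow> h l" if "g \<longlonglongrightarrow> l" for g l
    by (rule continuous_on_tendsto_compose[OF h(1) that]) auto
  obtain N where N: "\<And>n. n \<ge> N \<Longrightarrow> Y n \<in> borel_measurable M"
      "\<And>n. n \<ge> N \<Longrightarrow> distr M borel (Y n) = noised \<nu> (b n) (p n) (c n)"
    using Yn by (auto simp: eventually_sequentially)
  have [measurable]: "Y (n + N) \<in> borel_measurable M" for n by (rule N) simp
  have "(\<lambda>n. \<integral>\<omega>. h (Y (n + N) \<omega>) \<partial>M) \<longlonglongrightarrow> (\<integral>\<omega>. h (Z \<omega>) \<partial>M)"
  proof (rule integral_dominated_convergence[where w = "\<lambda>_. 1"])
    show "AE \<omega> in M. (\<lambda>n. h (Y (n + N) \<omega>)) \<longlonglongrightarrow> h (Z \<omega>)"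
      using lim by eventually_elim (rule hc, rule LIMSEQ_ignore_initial_segment)
  qed (use h in auto)
  moreover have "(\<integral>\<omega>. h (Y (n + N) \<omega>) \<partial>M)
      = (\<integral>z. h (b (n + N) + p (n + N) *\<^sub>R fst z + c (n + N) *\<^sub>R snd z) \<partial>(\<nu> \<Otimes>\<^sub>M gaussian 0 1))" for n
  proof -
    have "(\<integral>\<omega>. h (Y (n + N) \<omega>) \<partial>M) = (\<integral>x. h x \<partial>distr M borel (Y (n + N)))"
      by (subst integral_distr) auto
    then show ?thesis
      by (simp add: N(2) integral_noised[OF nu(2)])
  qed
  moreover have "(\<lambda>n. \<integral>z. h (b (n + N) + p (n + N) *\<^sub>R fst z + c (n + N) *\<^sub>R snd z) \<partial>(\<nu> \<Otimes>\<^sub>M gaussian 0 1))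
      \<longlonglongrightarrow> (\<integral>z. h (b' + p' *\<^sub>R fst z + c' *\<^sub>R snd z) \<partial>(\<nu> \<Otimes>\<^sub>M gaussian 0 1))"
  proof (rule integral_dominated_convergence[where w = "\<lambda>_. 1"])
    show "AE z in \<nu> \<Otimes>\<^sub>M gaussian 0 1. (\<lambda>n. h (b (n + N) + p (n + N) *\<^sub>R fst z + c (n + N) *\<^sub>R snd z))
        \<longlonglongrightarrow> h (b' + p' *\<^sub>R fst z + c' *\<^sub>R snd z)"
      by (intro AE_I2 hc tendsto_intros LIMSEQ_ignore_initial_segment bl pl cl)
  qed (use h in auto)
  ultimately have "(\<integral>\<omega>. h (Z \<omega>) \<partial>M) = (\<integral>z. h (b' + p' *\<^sub>R fst z + c' *\<^sub>R snd z) \<partial>(\<nu> \<Otimes>\<^sub>M gaussian 0 1))"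
    by (simp add: LIMSEQ_unique)
  then show "(\<integral>x. h x \<partial>distr M borel Z) = (\<integral>x. h x \<partial>noised \<nu> b' p' c')"
    by (simp add: integral_distr integral_noised[OF nu(2)])
qed simp_all

text \<open>One step of the Euler scheme, seen in law. Measurability of \<open>Y\<close> with
  respect to \<open>G\<close> turns the independence of the increment from \<open>G\<close> into
  independence from \<open>Y\<close>, so the joint law is a product; the factor
  \<open>sqrt h\<close> standardizes the increment.\<close>

lemma (in prob_space) distr_add_indep_gaussian:
  fixes Y D :: "'a \<Rightarrow> 'b::euclidean_space"
  assumes G: "subalgebra M G" and Y: "Y \<in> borel_measurable G" and D [measurable]: "D \<in> borel_measurable M"
    and ind: "indep_set (sets G) (sets (vimage_algebra (space M) D borel))"
    and law: "distr M borel D = gaussian 0 h" and h: "h > 0"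
  shows "distr M borel (\<lambda>\<omega>. b + q *\<^sub>R Y \<omega> + \<sigma> *\<^sub>R D \<omega>) = noised (distr M borel Y) b q (\<sigma> * sqrt h)"
proof -
  have YM [measurable]: "Y \<in> borel_measurable M"
    by (rule measurable_from_subalg[OF G Y])
  have sp: "space G = space M" using G by (simp add: subalgebra_def)
  have "indep_var borel Y borel D"
    unfolding indep_var_eq
  proof (intro conjI)
    show "indep_set (sigma_sets (space M) {Y -` A \<inter> space M |A. A \<in> sets borel})
        (sigma_sets (space M) {D -` A \<inter> space M |A. A \<in> sets borel})"
      unfolding indep_set_def
    proof (rule indep_sets_mono_sets[OF ind[unfolded indep_set_def]])
      fix i :: bool
      have "sigma_sets (space M) {Y -` A \<inter> space M |A. A \<in> sets borel} \<subseteq> sets G"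
        unfolding sp[symmetric] by (rule sets.sigma_sets_subset) (use Y in \<open>auto intro: measurable_sets\<close>)
      moreover have "sigma_sets (space M) {D -` A \<inter> space M |A. A \<in> sets borel}
          \<subseteq> sets (vimage_algebra (space M) D borel)"
        by (simp add: sets_vimage_algebra)
      ultimately show "(case i of True \<Rightarrow> sigma_sets (space M) {Y -` A \<inter> space M |A. A \<in> sets borel}
          | False \<Rightarrow> sigma_sets (space M) {D -` A \<inter> space M |A. A \<in> sets borel})
        \<subseteq> (case i of True \<Rightarrow> sets G | False \<Rightarrow> sets (vimage_algebra (space M) D borel))"
        by (cases i) auto
    qed
  qed simp_all
  then have joint: "distr M (borel \<Otimes>\<^sub>M borel) (\<lambda>\<omega>. (Y \<omega>, D \<omega>)) = distr M borel Y \<Otimes>\<^sub>M gaussian 0 h"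
    by (simp add: indep_var_distribution_eq law)
  interpret d: prob_space "gaussian (0::'b) h" by (rule prob_space_gaussian[OF h])
  show ?thesis
  proof (rule measure_eqI)
    fix A assume "A \<in> sets (distr M borel (\<lambda>\<omega>. b + q *\<^sub>R Y \<omega> + \<sigma> *\<^sub>R D \<omega>))"
    then have [measurable]: "A \<in> sets borel" by simp
    have "emeasure (distr M borel (\<lambda>\<omega>. b + q *\<^sub>R Y \<omega> + \<sigma> *\<^sub>R D \<omega>)) A
        = (\<integral>\<^sup>+x. indicator A x \<partial>distr M borel (\<lambda>\<omega>. b + q *\<^sub>R Y \<omega> + \<sigma> *\<^sub>R D \<omega>))" by simp
    also have "\<dots> = (\<integral>\<^sup>+\<omega>. indicator A (b + q *\<^sub>R Y \<omega> + \<sigma> *\<^sub>R D \<omega>) \<partial>M)"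
      by (subst nn_integral_distr) auto
    also have "\<dots> = (\<integral>\<^sup>+z. indicator A (b + q *\<^sub>R fst z + \<sigma> *\<^sub>R snd z) \<partial>(distr M (borel \<Otimes>\<^sub>M borel) (\<lambda>\<omega>. (Y \<omega>, D \<omega>))))"
      by (subst nn_integral_distr) auto
    also have "\<dots> = (\<integral>\<^sup>+y. \<integral>\<^sup>+d. indicator A (b + q *\<^sub>R y + \<sigma> *\<^sub>R d) \<partial>gaussian 0 h \<partial>distr M borel Y)"
      unfolding joint by (simp add: d.nn_integral_fst[symmetric])
    also have "\<dots> = (\<integral>\<^sup>+y. \<integral>\<^sup>+\<xi>. indicator A (b + q *\<^sub>R y + (\<sigma> * sqrt h) *\<^sub>R \<xi>) \<partial>gaussian 0 1 \<partial>distr M borel Y)"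
      unfolding gaussian_eq_distr_std[OF h, of 0] by (subst nn_integral_distr) simp_all
    also have "\<dots> = (\<integral>\<^sup>+x. indicator A x \<partial>noised (distr M borel Y) b q (\<sigma> * sqrt h))"
      by (subst nn_integral_noised) simp_all
    finally show "emeasure (distr M borel (\<lambda>\<omega>. b + q *\<^sub>R Y \<omega> + \<sigma> *\<^sub>R D \<omega>)) A
        = emeasure (noised (distr M borel Y) b q (\<sigma> * sqrt h)) A" by simp
  qed simp
qed

text \<open>The Euler scheme for \<open>dy = - a (y - m) dt + d\<beta>\<close> with step \<open>h\<close>, started at time \<open>u\<close>.\<close>

primrec euler :: "real \<Rightarrow> 'a::real_vector \<Rightarrow> (real \<Rightarrow> 'a) \<Rightarrow> real \<Rightarrow> real \<Rightarrow> 'a \<Rightarrow> nat \<Rightarrow> 'a" where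
  "euler a m \<beta> u h x 0 = x"
| "euler a m \<beta> u h x (Suc k) = (a * h) *\<^sub>R m + (1 - a * h) *\<^sub>R euler a m \<beta> u h x k
     + (\<beta> (u + real (Suc k) * h) - \<beta> (u + real k * h))"

text \<open>The factor \<open>1 - a * h\<close> lies between 0 and 1, so earlier errors are not
  amplified and local errors merely add up. A local error stems from freezing the drift during one
  step and is at most \<open>a * h * w\<close>, where \<open>w\<close> bounds the oscillation of the
  path over a step. The noise increments enter the scheme exactly, so continuity of the path is all
  that is asked of it.\<close>

lemma euler_error:
  fixes y \<beta> :: "real \<Rightarrow> 'a::euclidean_space"
  assumes a: "a > 0" and h: "h > 0" "a * h \<le> 1" and T: "u + real n * h \<le> T"
    and cont: "continuous_on {u..T} y"
    and sol: "\<And>t. t \<in> {u..T} \<Longrightarrow> y t = y u + integral {u..t} (\<lambda>r. - a *\<^sub>R (y r - m)) + (\<beta> t - \<beta> u)"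
    and mod: "\<And>r r'. r \<in> {u..T} \<Longrightarrow> r' \<in> {u..T} \<Longrightarrow> \<bar>r - r'\<bar> \<le> h \<Longrightarrow> norm (y r - y r') \<le> w"
    and k: "k \<le> n"
  shows "norm (euler a m \<beta> u h (y u) k - y (u + real k * h)) \<le> real k * (a * h * w)"
  using k
proof (induction k)
  case (Suc k)
  let ?s = "u + real k * h" and ?t = "u + real (Suc k) * h"
  have st: "u \<le> ?s" "?s \<le> ?t" "?t = ?s + h" "?t \<le> T"
  proof -
    have "real (Suc k) * h \<le> real n * h" using Suc.prems h by (intro mult_right_mono) auto
    then show "?t \<le> T" using T by linarith
  qed (use h in \<open>auto simp: algebra_simps\<close>)
  have int: "(\<lambda>r. - a *\<^sub>R (y r - m)) integrable_on {p..q}" if "u \<le> p" "q \<le> T" for p q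
    by (intro integrable_continuous_real continuous_intros continuous_on_subset[OF cont]) (use that in auto)
  have inty: "y integrable_on {?s..?t}"
    by (intro integrable_continuous_real continuous_on_subset[OF cont]) (use st in auto)
  have w0: "w \<ge> 0"
    using mod[of u u] st h by force
  have split: "integral {u..?t} (\<lambda>r. - a *\<^sub>R (y r - m))
      = integral {u..?s} (\<lambda>r. - a *\<^sub>R (y r - m)) + integral {?s..?t} (\<lambda>r. - a *\<^sub>R (y r - m))"
    by (rule Henstock_Kurzweil_Integration.integral_combine[symmetric]) (use st int in auto)
  have "y ?t = y ?s + integral {?s..?t} (\<lambda>r. - a *\<^sub>R (y r - m)) + (\<beta> ?t - \<beta> ?s)"
  proof -
    have "y ?t = y u + integral {u..?t} (\<lambda>r. - a *\<^sub>R (y r - m)) + (\<beta> ?t - \<beta> u)"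
      by (rule sol) (use st in auto)
    moreover have "y ?s = y u + integral {u..?s} (\<lambda>r. - a *\<^sub>R (y r - m)) + (\<beta> ?s - \<beta> u)"
      by (rule sol) (use st in auto)
    moreover have "p = q + i' + (b\<^sub>t - b\<^sub>s)" if "p = x + (i + i') + (b\<^sub>t - b\<^sub>u)" "q = x + i + (b\<^sub>s - b\<^sub>u)"
      for p q x i i' b\<^sub>s b\<^sub>t b\<^sub>u :: 'a
      using that by simp
    ultimately show ?thesis unfolding split by blast
  qed
  moreover have hi: "((\<lambda>r. - a *\<^sub>R (y r - m)) has_integral integral {?s..?t} (\<lambda>r. - a *\<^sub>R (y r - m))) {?s..?t}"
    by (rule integrable_integral[OF int]) (use st in auto)
  moreover have hc: "((\<lambda>r. - a *\<^sub>R (y ?s - m)) has_integral h *\<^sub>R (- a *\<^sub>R (y ?s - m))) {?s..?t}"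
    using has_integral_const_real[of "- a *\<^sub>R (y ?s - m)" ?s ?t] st h by simp
  ultimately have eq: "euler a m \<beta> u h (y u) (Suc k) - y ?t
      = (1 - a * h) *\<^sub>R (euler a m \<beta> u h (y u) k - y ?s)
        + (h *\<^sub>R (- a *\<^sub>R (y ?s - m)) - integral {?s..?t} (\<lambda>r. - a *\<^sub>R (y r - m)))"
    by (simp add: algebra_simps)
  have "norm (h *\<^sub>R (- a *\<^sub>R (y ?s - m)) - integral {?s..?t} (\<lambda>r. - a *\<^sub>R (y r - m))) \<le> (a * w) * measure lborel {?s..?t}"
  proof (rule has_integral_bound_real[OF _ finite.emptyI has_integral_diff[OF hc hi]])
    show "0 \<le> a * w" using a w0 by simp
    show "norm (- a *\<^sub>R (y ?s - m) - - a *\<^sub>R (y r - m)) \<le> a * w" if "r \<in> {?s..?t} - {}" for r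
    proof -
      have "- a *\<^sub>R (y ?s - m) - - a *\<^sub>R (y r - m) = a *\<^sub>R (y r - y ?s)"
        by (simp add: algebra_simps)
      moreover have "norm (y r - y ?s) \<le> w"
      proof (rule mod)
        have "?s \<le> r" "r \<le> ?t" using that by auto
        with st show "r \<in> {u..T}" "?s \<in> {u..T}"
          unfolding atLeastAtMost_iff by (intro conjI; linarith)+
        show "\<bar>r - ?s\<bar> \<le> h" using \<open>?s \<le> r\<close> \<open>r \<le> ?t\<close> st by linarith
      qed
      ultimately show ?thesis using a by simp
    qed
  qed
  then have loc: "norm (h *\<^sub>R (- a *\<^sub>R (y ?s - m)) - integral {?s..?t} (\<lambda>r. - a *\<^sub>R (y r - m))) \<le> a * h * w"
    using st h by (simp add: mult.commute mult.left_commute)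
  have "norm ((1 - a * h) *\<^sub>R (euler a m \<beta> u h (y u) k - y ?s)) \<le> 1 * (real k * (a * h * w))"
    unfolding norm_scaleR by (intro mult_mono) (use Suc a h in auto)
  then show ?case
    unfolding eq using loc by (intro order_trans[OF norm_triangle_ineq]) (simp add: algebra_simps)
qed simp

lemma euler_converges:
  fixes y \<beta> :: "real \<Rightarrow> 'a::euclidean_space"
  assumes a: "a > 0" and T: "u < T"
    and cont: "continuous_on {u..T} y"
    and sol: "\<And>t. t \<in> {u..T} \<Longrightarrow> y t = y u + integral {u..t} (\<lambda>r. - a *\<^sub>R (y r - m)) + (\<beta> t - \<beta> u)"
  shows "(\<lambda>n. euler a m \<beta> u ((T - u) / real n) (y u) n) \<longlonglongrightarrow> y T"
proof (rule LIMSEQ_I)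
  fix e :: real assume e: "e > 0"
  \<comment> \<open>Makes the accumulated error \<open>a * (T - u) * w\<close> equal to
    \<open>e / 2\<close>.\<close>
  define w where "w = e / (2 * a * (T - u))"
  have w: "w > 0" using e a T by (simp add: w_def)
  have "uniformly_continuous_on {u..T} y" by (rule compact_uniformly_continuous[OF cont]) simp
  then obtain d where d: "d > 0" "\<And>r r'. r \<in> {u..T} \<Longrightarrow> r' \<in> {u..T} \<Longrightarrow> dist r' r < d \<Longrightarrow> dist (y r') (y r) < w"
    using w unfolding uniformly_continuous_on_def by metis
  \<comment> \<open>The first bound brings the step below \<open>d\<close>, the second ensures
    \<open>a * h \<le> 1\<close>.\<close>
  obtain N :: nat where N: "max ((T - u) / d) (a * (T - u)) < real N" using reals_Archimedean2 by blast
  show "\<exists>N. \<forall>n\<ge>N. norm (euler a m \<beta> u ((T - u) / real n) (y u) n - y T) < e"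
  proof (intro exI allI impI)
    fix n assume "n \<ge> N"
    then have n: "(T - u) / d < real n" "a * (T - u) < real n" using N by auto
    have n0: "real n > 0" using n(1) d(1) T by (smt (verit) divide_pos_pos)
    let ?h = "(T - u) / real n"
    have "norm (euler a m \<beta> u ?h (y u) n - y (u + real n * ?h)) \<le> real n * (a * ?h * w)"
    proof (rule euler_error[OF a _ _ _ cont sol _ order_refl])
      show "?h > 0" using n0 T by simp
      show "a * ?h \<le> 1" using n n0 by (simp add: field_simps)
      show "u + real n * ?h \<le> T" using n0 by simp
      have "?h < d" using n n0 d(1) by (simp add: field_simps)
      then show "norm (y r - y r') \<le> w" if "r \<in> {u..T}" "r' \<in> {u..T}" "\<bar>r - r'\<bar> \<le> ?h" for r r'
        using d(2)[OF that(2,1)] that(3) by (simp add: dist_norm)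
    qed auto
    then have "norm (euler a m \<beta> u ?h (y u) n - y T) \<le> a * (T - u) * w"
      using n0 by (simp add: mult.commute mult.left_commute)
    also have "\<dots> = e / 2" using a T by (simp add: w_def field_simps)
    also have "\<dots> < e" using e by simp
    finally show "norm (euler a m \<beta> u ?h (y u) n - y T) < e" .
  qed
qed

text \<open>After \<open>k\<close> steps the variance is the geometric sum of the terms
  \<open>\<sigma>\<^sup>2 * h * r ^ (2 * j)\<close> with \<open>j < k\<close>; the closed form uses
  \<open>1 - r\<^sup>2 = a * h * (2 - a * h)\<close>.\<close>

lemma euler_law:
  fixes Y :: "'w \<Rightarrow> 'a::euclidean_space"
  assumes bm: "brownian_motion M F B" and u: "u \<ge> 0" and Y: "Y \<in> borel_measurable (F u)"
    and a: "a > 0" and h: "h > 0" "a * h \<le> 1"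
  defines "r \<equiv> 1 - a * h"
  shows "(\<lambda>\<omega>. euler a m (\<lambda>t. \<sigma> *\<^sub>R B t \<omega>) u h (Y \<omega>) k) \<in> borel_measurable (F (u + real k * h)) \<and>
    distr M borel (\<lambda>\<omega>. euler a m (\<lambda>t. \<sigma> *\<^sub>R B t \<omega>) u h (Y \<omega>) k)
      = noised (distr M borel Y) ((1 - r ^ k) *\<^sub>R m) (r ^ k) (sqrt (\<sigma>\<^sup>2 * (1 - (r ^ k)\<^sup>2) / (a * (2 - a * h))))"
proof (induction k)
  case 0
  then show ?case using Y by (simp add: noised_trivial)
next
  case (Suc k)
  let ?s = "u + real k * h" and ?t = "u + real (Suc k) * h"
  let ?E = "\<lambda>\<omega>. euler a m (\<lambda>t. \<sigma> *\<^sub>R B t \<omega>) u h (Y \<omega>) k"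
  have st: "0 \<le> ?s" "?s < ?t" "?t - ?s = h"
    using u h by (auto simp: algebra_simps add_nonneg_nonneg)
  interpret M: prob_space M using bm by (simp add: brownian_motion_def)
  have sub: "subalgebra M (F ?s)" "subalgebra (F ?t) (F ?s)" "subalgebra M (F ?t)"
    using bm st unfolding brownian_motion_def by (auto simp del: of_nat_Suc)
  have B: "B ?s \<in> borel_measurable (F ?s)" "B ?t \<in> borel_measurable (F ?t)"
    using bm st unfolding brownian_motion_def by (auto simp del: of_nat_Suc)
  have inc: "distr M borel (\<lambda>\<omega>. B ?t \<omega> - B ?s \<omega>) = gaussian 0 h"
      "M.indep_set (sets (F ?s)) (sets (vimage_algebra (space M) (\<lambda>\<omega>. B ?t \<omega> - B ?s \<omega>) borel))"
    using bm st unfolding brownian_motion_def by (metis, metis)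
  have [measurable]: "B ?s \<in> borel_measurable (F ?t)" "?E \<in> borel_measurable (F ?t)"
    using measurable_from_subalg[OF sub(2)] B Suc.IH by blast+
  note B(2)[measurable]
  have BM [measurable]: "B ?s \<in> borel_measurable M" "B ?t \<in> borel_measurable M"
    using measurable_from_subalg[OF sub(1)] measurable_from_subalg[OF sub(3)] B by blast+
  have step: "euler a m (\<lambda>t. \<sigma> *\<^sub>R B t \<omega>) u h (Y \<omega>) (Suc k)
      = (a * h) *\<^sub>R m + r *\<^sub>R ?E \<omega> + \<sigma> *\<^sub>R (B ?t \<omega> - B ?s \<omega>)" for \<omega>
    by (simp add: r_def scaleR_diff_right)
  have "distr M borel (\<lambda>\<omega>. euler a m (\<lambda>t. \<sigma> *\<^sub>R B t \<omega>) u h (Y \<omega>) (Suc k))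
      = noised (distr M borel ?E) ((a * h) *\<^sub>R m) r (\<sigma> * sqrt h)"
    unfolding step
    by (rule M.distr_add_indep_gaussian[OF sub(1) _ _ inc(2) inc(1) h(1)]) (use Suc.IH in blast, measurable)
  also have "\<dots> = noised (distr M borel Y) ((a * h) *\<^sub>R m + r *\<^sub>R ((1 - r ^ k) *\<^sub>R m)) (r * r ^ k)
      (sqrt ((r * sqrt (\<sigma>\<^sup>2 * (1 - (r ^ k)\<^sup>2) / (a * (2 - a * h))))\<^sup>2 + (\<sigma> * sqrt h)\<^sup>2))"
    by (simp add: Suc.IH noised_noised)
  also have "(a * h) *\<^sub>R m + r *\<^sub>R ((1 - r ^ k) *\<^sub>R m) = (1 - r ^ Suc k) *\<^sub>R m"
    by (simp add: r_def algebra_simps)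
  also have "(r * sqrt (\<sigma>\<^sup>2 * (1 - (r ^ k)\<^sup>2) / (a * (2 - a * h))))\<^sup>2 + (\<sigma> * sqrt h)\<^sup>2
      = \<sigma>\<^sup>2 * (1 - (r ^ Suc k)\<^sup>2) / (a * (2 - a * h))"
  proof -
    have "0 \<le> r" "r \<le> 1" using a h by (auto simp: r_def)
    then have "(r ^ k)\<^sup>2 \<le> 1" by (simp add: power_le_one)
    then have "0 \<le> \<sigma>\<^sup>2 * (1 - (r ^ k)\<^sup>2) / (a * (2 - a * h))"
      using a h by (intro divide_nonneg_nonneg mult_nonneg_nonneg) auto
    then have "(r * sqrt (\<sigma>\<^sup>2 * (1 - (r ^ k)\<^sup>2) / (a * (2 - a * h))))\<^sup>2 + (\<sigma> * sqrt h)\<^sup>2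
        = r\<^sup>2 * (\<sigma>\<^sup>2 * (1 - (r ^ k)\<^sup>2) / (a * (2 - a * h))) + \<sigma>\<^sup>2 * h"
      using h by (simp add: power_mult_distrib)
    also have "\<dots> = \<sigma>\<^sup>2 * (r\<^sup>2 * (1 - (r ^ k)\<^sup>2) + h * (a * (2 - a * h))) / (a * (2 - a * h))"
    proof -
      have "a * (2 - a * h) \<noteq> 0" using a h by auto
      then show ?thesis by (simp add: field_simps)
    qed
    also have "r\<^sup>2 * (1 - (r ^ k)\<^sup>2) + h * (a * (2 - a * h)) = 1 - (r ^ Suc k)\<^sup>2"
      by (simp add: r_def power_mult_distrib power2_eq_square algebra_simps)
    finally show ?thesis .
  qed
  finally have "distr M borel (\<lambda>\<omega>. euler a m (\<lambda>t. \<sigma> *\<^sub>R B t \<omega>) u h (Y \<omega>) (Suc k))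
    = noised (distr M borel Y) ((1 - r ^ Suc k) *\<^sub>R m) (r ^ Suc k)
      (sqrt (\<sigma>\<^sup>2 * (1 - (r ^ Suc k)\<^sup>2) / (a * (2 - a * h))))" by simp
  moreover have "(\<lambda>\<omega>. euler a m (\<lambda>t. \<sigma> *\<^sub>R B t \<omega>) u h (Y \<omega>) (Suc k)) \<in> borel_measurable (F ?t)"
    unfolding step by measurable
  ultimately show ?case by blast
qed

text \<open>This takes the place of the variation of constants formula and its stochastic integral.
  With \<open>n\<close> Euler steps the contraction factor is
  \<open>(1 - a * (t - u) / n) ^ n\<close>, which tends to \<open>p\<close>, and the variance tends
  to \<open>\<sigma>\<^sup>2 * (1 - p\<^sup>2) / (2 * a)\<close>, in which \<open>s\<close> cancels.
  The right end point is included so that consecutive intervals can be chained.\<close>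

lemma CF_law_step:
  fixes X :: "real \<Rightarrow> 'w \<Rightarrow> 'a::euclidean_space"
  assumes sol: "CF_solution f \<alpha> lam \<delta> s \<Delta>t \<rho>\<^sub>0 M F B X"
    and pos: "lam > 0" "s > 0" "\<Delta>t > 0"
    and t: "real i * \<Delta>t \<le> t" "t \<le> real (Suc i) * \<Delta>t"
  defines "p \<equiv> exp (- (s * lam) * (t - real i * \<Delta>t))"
    and "m \<equiv> consensus_point f \<alpha> (distr M borel (X (real i * \<Delta>t)))"
  shows "distr M borel (X t) = noised (distr M borel (X (real i * \<Delta>t))) ((1 - p) *\<^sub>R m) p
    (sqrt (\<delta>\<^sup>2 / (2 * lam) * (1 - p\<^sup>2)))"
proof (cases "t = real i * \<Delta>t")
  case True
  then show ?thesis by (simp add: p_def noised_trivial)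
next
  case False
  define u where "u = real i * \<Delta>t"
  define a where "a = s * lam"
  define \<sigma> where "\<sigma> = sqrt s * \<delta>"
  have ut: "u < t" "0 \<le> u" "a > 0" using False t pos by (auto simp: u_def a_def)
  have bm: "brownian_motion M F B" using sol by (simp add: CF_solution_def)
  interpret M: prob_space M using bm by (simp add: brownian_motion_def)
  have Xm: "X r \<in> borel_measurable (F r)" "subalgebra M (F r)" if "r \<ge> 0" for r
    using sol bm that by (auto simp: CF_solution_def brownian_motion_def)
  have XM [measurable]: "X r \<in> borel_measurable M" if "r \<ge> 0" for r
    using measurable_from_subalg[OF Xm(2)[OF that] Xm(1)[OF that]] .
  have "AE \<omega> in M. continuous_on {0..} (\<lambda>t. X t \<omega>)" using sol by (simp add: CF_solution_def)
  moreover have "AE \<omega> in M. continuous_on {0..} (\<lambda>t. B t \<omega>)" using bm by (simp add: brownian_motion_def)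
  moreover have "AE \<omega> in M. \<forall>i::nat. \<forall>t\<in>{real i * \<Delta>t ..< real (Suc i) * \<Delta>t}.
        X t \<omega> = X (real i * \<Delta>t) \<omega>
          + integral {real i * \<Delta>t .. t} (\<lambda>u. (- s * lam) *\<^sub>R
              (X u \<omega> - consensus_point f \<alpha> (distr M borel (X (real i * \<Delta>t)))))
          + (sqrt s * \<delta>) *\<^sub>R (B t \<omega> - B (real i * \<Delta>t) \<omega>)"
    using sol by (simp add: CF_solution_def)
  ultimately have lim: "AE \<omega> in M. (\<lambda>n. euler a m (\<lambda>t. \<sigma> *\<^sub>R B t \<omega>) u ((t - u) / real n) (X u \<omega>) n) \<longlonglongrightarrow> X t \<omega>"
  proof eventually_elim
    case (elim \<omega>)
    define v where "v = real (Suc i) * \<Delta>t"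
    have uv: "u < v" "t \<le> v" using t pos by (auto simp: u_def v_def)
    have cX: "continuous_on {u..v} (\<lambda>t. X t \<omega>)" and cB: "continuous_on {u..v} (\<lambda>t. B t \<omega>)"
      using elim(1,2) ut by (auto elim!: continuous_on_subset)
    \<comment> \<open>The integral equation is given on the half-open interval only. Its defect
      \<open>D\<close> is continuous and vanishes there, hence vanishes at the next update time as
      well.\<close>
    define D where "D r = X r \<omega> - X u \<omega> - integral {u..r} (\<lambda>r. - a *\<^sub>R (X r \<omega> - m)) - \<sigma> *\<^sub>R (B r \<omega> - B u \<omega>)" for r
    have "D r = 0" if "r \<in> {u..v}" for r
    proof (rule continuous_constant_on_closure[of "{u..<v}" D])
      have "(\<lambda>r. - a *\<^sub>R (X r \<omega> - m)) integrable_on {u..v}"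
        by (intro integrable_continuous_real continuous_intros cX)
      then show "continuous_on (closure {u..<v}) D"
        using uv unfolding D_def
        by (simp only: closure_atLeastLessThan)
           (intro continuous_intros cX cB indefinite_integral_continuous_1)
      show "D r = 0" if "r \<in> {u..<v}" for r
        using elim(3)[rule_format, of r i] that
        by (simp add: D_def u_def v_def a_def m_def \<sigma>_def)
      show "r \<in> closure {u..<v}" using uv that by simp
    qed
    then have "X r \<omega> = X u \<omega> + integral {u..r} (\<lambda>r. - a *\<^sub>R (X r \<omega> - m)) + (\<sigma> *\<^sub>R B r \<omega> - \<sigma> *\<^sub>R B u \<omega>)"
      if "r \<in> {u..t}" for r
      using that uv by (auto simp: D_def algebra_simps)
    moreover have "continuous_on {u..t} (\<lambda>t. X t \<omega>)"
      by (rule continuous_on_subset[OF cX]) (use uv in auto)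
    ultimately show ?case
      by (intro euler_converges[where y = "\<lambda>r. X r \<omega>" and \<beta> = "\<lambda>r. \<sigma> *\<^sub>R B r \<omega>"] ut)
  qed
  let ?h = "\<lambda>n. (t - u) / real n"
  have "\<forall>\<^sub>F n in sequentially. a * (t - u) < real n"
    using filterlim_real_sequentially unfolding filterlim_at_top_dense by blast
  then have ev: "\<forall>\<^sub>F n in sequentially. (\<lambda>\<omega>. euler a m (\<lambda>t. \<sigma> *\<^sub>R B t \<omega>) u (?h n) (X u \<omega>) n) \<in> borel_measurable M \<and>
    distr M borel (\<lambda>\<omega>. euler a m (\<lambda>t. \<sigma> *\<^sub>R B t \<omega>) u (?h n) (X u \<omega>) n)
      = noised (distr M borel (X u)) ((1 - (1 + (- a * (t - u)) / real n) ^ n) *\<^sub>R m) ((1 + (- a * (t - u)) / real n) ^ n)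
        (sqrt (\<sigma>\<^sup>2 * (1 - ((1 + (- a * (t - u)) / real n) ^ n)\<^sup>2) / (a * (2 - a * (t - u) / real n))))"
  proof eventually_elim
    case (elim n)
    have n0: "real n > 0" using elim ut by (smt (verit) mult_pos_pos)
    have h: "?h n > 0" "a * ?h n \<le> 1" using n0 elim ut by (auto simp: field_simps)
    have r: "1 - a * ?h n = 1 + (- a * (t - u)) / real n" by simp
    have tt: "u + real n * ?h n = t" using n0 by simp
    show ?case
      using euler_law[OF bm ut(2) Xm(1)[OF ut(2)] ut(3) h, of m \<sigma> n]
        measurable_from_subalg[OF Xm(2)[of t]] ut
      unfolding r tt by auto
  qed
  have el: "(\<lambda>n. (1 + (- a * (t - u)) / real n) ^ n) \<longlonglongrightarrow> p"
    using tendsto_exp_limit_sequentially[of "- a * (t - u)"] by (simp add: p_def a_def u_def)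
  have "distr M borel (X t) = noised (distr M borel (X u)) ((1 - p) *\<^sub>R m) p (sqrt (\<sigma>\<^sup>2 * (1 - p\<^sup>2) / (a * (2 - 0))))"
  proof (rule noised_limit[OF M.prob_space_axioms _ _ ev _ lim])
    have "(\<lambda>n. a * (t - u) / real n) \<longlonglongrightarrow> 0" by (rule lim_const_over_n)
    then show "(\<lambda>n. sqrt (\<sigma>\<^sup>2 * (1 - ((1 + (- a * (t - u)) / real n) ^ n)\<^sup>2) / (a * (2 - a * (t - u) / real n))))
        \<longlonglongrightarrow> sqrt (\<sigma>\<^sup>2 * (1 - p\<^sup>2) / (a * (2 - 0)))"
      by (intro tendsto_intros el) (use ut in simp_all)
    show "(\<lambda>n. (1 - (1 + (- a * (t - u)) / real n) ^ n) *\<^sub>R m) \<longlonglongrightarrow> (1 - p) *\<^sub>R m"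
      by (intro tendsto_intros el)
    show "(\<lambda>n. (1 + (- a * (t - u)) / real n) ^ n) \<longlonglongrightarrow> p" by (rule el)
  qed (use ut in \<open>auto intro!: M.prob_space_distr XM\<close>)
  also have "\<sigma>\<^sup>2 * (1 - p\<^sup>2) / (a * (2 - 0)) = \<delta>\<^sup>2 / (2 * lam) * (1 - p\<^sup>2)"
    using pos by (simp add: \<sigma>_def a_def power_mult_distrib)
  finally show ?thesis unfolding u_def .
qed

text \<open>The mean of the law at time \<open>t\<^sub>i\<close> if \<open>m j\<close> is the consensus point at time \<open>t\<^sub>j\<close> and
  \<open>q = exp (- s \<lambda> \<Delta>t)\<close>.\<close>

primrec mean_seq :: "(nat \<Rightarrow> 'a::real_vector) \<Rightarrow> real \<Rightarrow> 'a \<Rightarrow> nat \<Rightarrow> 'a" where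
  "mean_seq m q x 0 = x"
| "mean_seq m q x (Suc i) = q *\<^sub>R mean_seq m q x i + (1 - q) *\<^sub>R m i"

text \<open>The law with mean \<open>b\<close> reached from \<open>\<nu>\<close> when the drift has contracted distances by the factor \<open>p\<close>.\<close>

definition ou_law :: "'a::euclidean_space measure \<Rightarrow> real \<Rightarrow> 'a \<Rightarrow> real \<Rightarrow> 'a measure" where
  "ou_law \<nu> v b p = noised \<nu> (b - p *\<^sub>R (\<integral>x. x \<partial>\<nu>)) p (sqrt (v * (1 - p\<^sup>2)))"

text \<open>The variances add up correctly because \<open>q\<^sup>2 * (1 - p\<^sup>2) + (1 -
  q\<^sup>2) = 1 - (q * p)\<^sup>2\<close>. Since \<open>ou_law\<close> is parametrized by its mean,
  the drift acts on that parameter by a convex combination.\<close>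

lemma noised_ou_law:
  fixes \<nu> :: "'a::euclidean_space measure"
  assumes "sets \<nu> = sets borel" and "v > 0" "0 \<le> p" "p \<le> 1" "0 \<le> q" "q \<le> 1"
  shows "noised (ou_law \<nu> v b p) ((1 - q) *\<^sub>R m) q (sqrt (v * (1 - q\<^sup>2)))
    = ou_law \<nu> v (q *\<^sub>R b + (1 - q) *\<^sub>R m) (q * p)"
proof -
  have "0 \<le> v * (1 - p\<^sup>2)" "0 \<le> v * (1 - q\<^sup>2)"
    using assms by (auto simp: power_le_one)
  then have "(q * sqrt (v * (1 - p\<^sup>2)))\<^sup>2 + (sqrt (v * (1 - q\<^sup>2)))\<^sup>2 = v * (1 - (q * p)\<^sup>2)"
    by (simp add: power_mult_distrib algebra_simps)
  then show ?thesis
    unfolding ou_law_def by (simp only: noised_noised[OF assms(1)]) (simp add: algebra_simps)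
qed

text \<open>Between updates only the range of \<open>p\<close> is recorded, not its value
  \<open>exp (- (s * lam) * (t - real i * \<Delta>t))\<close>: the later estimates are uniform over
  \<open>p\<close> between 0 and 1.\<close>

lemma CF_law:
  fixes X :: "real \<Rightarrow> 'w \<Rightarrow> 'a::euclidean_space"
  assumes sol: "CF_solution f \<alpha> lam \<delta> s \<Delta>t \<rho>\<^sub>0 M F B X"
    and pos: "lam > 0" "\<delta> > 0" "s > 0" "\<Delta>t > 0" and sets: "sets \<rho>\<^sub>0 = sets borel"
  defines "m \<equiv> \<lambda>i. consensus_point f \<alpha> (distr M borel (X (real i * \<Delta>t)))"
    and "q \<equiv> exp (- (s * lam * \<Delta>t))" and "v \<equiv> \<delta>\<^sup>2 / (2 * lam)"
  defines "b \<equiv> mean_seq m q (\<integral>x. x \<partial>\<rho>\<^sub>0)"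
  shows "distr M borel (X (real i * \<Delta>t)) = ou_law \<rho>\<^sub>0 v (b i) (q ^ i)"
    and "\<lbrakk>real i * \<Delta>t \<le> t; t \<le> real (Suc i) * \<Delta>t\<rbrakk> \<Longrightarrow> \<exists>p\<ge>0. p \<le> 1 \<and>
      distr M borel (X t) = ou_law \<rho>\<^sub>0 v (p *\<^sub>R b i + (1 - p) *\<^sub>R m i) (p * q ^ i)"
proof -
  have v: "v > 0" using pos by (simp add: v_def)
  have q: "0 \<le> q" "q \<le> 1" using pos by (auto simp: q_def)
  then have qi: "0 \<le> q ^ i" "q ^ i \<le> 1" for i by (auto simp: power_le_one)
  have step: "distr M borel (X t) = ou_law \<rho>\<^sub>0 v (p *\<^sub>R b i + (1 - p) *\<^sub>R m i) (p * q ^ i)"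
    if "distr M borel (X (real i * \<Delta>t)) = ou_law \<rho>\<^sub>0 v (b i) (q ^ i)"
      and t: "real i * \<Delta>t \<le> t" "t \<le> real (Suc i) * \<Delta>t" and p: "p = exp (- (s * lam) * (t - real i * \<Delta>t))"
    for i t p
  proof -
    have "0 \<le> p" "p \<le> 1" using pos t by (auto simp: p)
    have "distr M borel (X t) = noised (distr M borel (X (real i * \<Delta>t))) ((1 - p) *\<^sub>R m i) p (sqrt (v * (1 - p\<^sup>2)))"
      using CF_law_step[OF sol pos(1,3,4) t] unfolding p[symmetric] m_def v_def .
    also have "\<dots> = ou_law \<rho>\<^sub>0 v (p *\<^sub>R b i + (1 - p) *\<^sub>R m i) (p * q ^ i)"
      unfolding that(1) by (rule noised_ou_law[OF sets v qi]) fact+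
    finally show ?thesis .
  qed
  show law: "distr M borel (X (real i * \<Delta>t)) = ou_law \<rho>\<^sub>0 v (b i) (q ^ i)" for i
  proof (induction i)
    case 0
    have "distr M borel (X 0) = \<rho>\<^sub>0" using sol by (simp add: CF_solution_def)
    then show ?case by (simp add: ou_law_def b_def noised_trivial[OF sets])
  next
    case (Suc i)
    show ?case
      using step[OF Suc, of "real (Suc i) * \<Delta>t" q] pos
      by (simp add: q_def b_def algebra_simps)
  qed
  show "\<exists>p\<ge>0. p \<le> 1 \<and> distr M borel (X t) = ou_law \<rho>\<^sub>0 v (p *\<^sub>R b i + (1 - p) *\<^sub>R m i) (p * q ^ i)"
    if t: "real i * \<Delta>t \<le> t" "t \<le> real (Suc i) * \<Delta>t"
    using step[OF law t refl] pos t by (intro exI[of _ "exp (- (s * lam) * (t - real i * \<Delta>t))"]) auto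
qed

text \<open>At a fixed point of the consensus map the drift pulls towards the mean of the law
  itself, and \<open>p\<^sup>2 * v + v * (1 - p\<^sup>2) = v\<close> keeps the variance. The law is
  thus unchanged at each update, so the same drift acts on the next interval.\<close>

lemma gaussian_invariant:
  fixes f :: "'a::euclidean_space \<Rightarrow> real"
  assumes pos: "lam > 0" "\<delta> > 0" "s > 0" "\<Delta>t > 0" and fixpoint: "consensus_map f \<alpha> lam \<delta> \<mu> = \<mu>"
  shows "CF_invariant TYPE('w) f \<alpha> lam \<delta> s \<Delta>t (gaussian \<mu> (\<delta>\<^sup>2 / (2 * lam)))"
  unfolding CF_invariant_def
proof (intro allI impI)
  fix M :: "'w measure" and F B and X :: "real \<Rightarrow> 'w \<Rightarrow> 'a" and t :: real
  assume sol: "CF_solution f \<alpha> lam \<delta> s \<Delta>t (gaussian \<mu> (\<delta>\<^sup>2 / (2 * lam))) M F B X" and t: "t \<ge> 0"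
  let ?v = "\<delta>\<^sup>2 / (2 * lam)"
  have v: "?v > 0" using pos by simp
  have step: "distr M borel (X t) = gaussian \<mu> ?v"
    if "distr M borel (X (real i * \<Delta>t)) = gaussian \<mu> ?v" "real i * \<Delta>t \<le> t" "t \<le> real (Suc i) * \<Delta>t" for i t
  proof -
    define p where "p = exp (- (s * lam) * (t - real i * \<Delta>t))"
    have "0 \<le> p" "p \<le> 1" using pos that by (auto simp: p_def)
    then have c: "(sqrt (?v * (1 - p\<^sup>2)))\<^sup>2 = ?v * (1 - p\<^sup>2)"
      using pos by (simp add: power_le_one)
    have "consensus_point f \<alpha> (gaussian \<mu> ?v) = \<mu>" using fixpoint by (simp add: consensus_map_def)
    then have "distr M borel (X t) = noised (gaussian \<mu> ?v) ((1 - p) *\<^sub>R \<mu>) p (sqrt (?v * (1 - p\<^sup>2)))"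
      using CF_law_step[OF sol pos(1,3,4) that(2,3)] by (simp add: that(1) p_def)
    have sum: "p\<^sup>2 * ?v + (sqrt (?v * (1 - p\<^sup>2)))\<^sup>2 = ?v"
      unfolding c by (simp only: right_diff_distrib mult_1_right mult.commute[of "p\<^sup>2"])
    note \<open>distr M borel (X t) = _\<close>
    also have "noised (gaussian \<mu> ?v) ((1 - p) *\<^sub>R \<mu>) p (sqrt (?v * (1 - p\<^sup>2)))
        = gaussian ((1 - p) *\<^sub>R \<mu> + p *\<^sub>R \<mu>) ?v"
      using noised_gaussian[OF v, of p "sqrt (?v * (1 - p\<^sup>2))" \<mu> "(1 - p) *\<^sub>R \<mu>"] v
      unfolding sum by blast
    also have "\<dots> = gaussian \<mu> ?v" by (simp add: algebra_simps)
    finally show ?thesis .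
  qed
  have "distr M borel (X (real i * \<Delta>t)) = gaussian \<mu> ?v" for i
  proof (induction i)
    case 0 then show ?case using sol by (simp add: CF_solution_def)
  next
    case (Suc i) then show ?case using pos by (intro step[OF Suc]) auto
  qed
  moreover obtain i :: nat where "real i * \<Delta>t \<le> t" "t \<le> real (Suc i) * \<Delta>t"
  proof
    define i where "i = nat \<lfloor>t / \<Delta>t\<rfloor>"
    have "real i \<le> t / \<Delta>t" "t / \<Delta>t \<le> real (Suc i)"
      using t pos by (auto simp: i_def) linarith
    then show "real i * \<Delta>t \<le> t" "t \<le> real (Suc i) * \<Delta>t" using pos by (auto simp: field_simps)
  qed
  ultimately show "distr M borel (X t) = gaussian \<mu> ?v" using step by blast
qed

subsection \<open>Laplace's principle\<close>

text \<open>Completing the square gives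
  \<open>k * t - t\<^sup>2 / 2 \<le> k\<^sup>2 - t\<^sup>2 / 4\<close>, so the integrand is
  dominated by a multiple of the Gaussian density of variance 2; \<open>C\<close> collects the ratio
  of the two normalizations and \<open>exp (k\<^sup>2)\<close>.\<close>

lemma integrable_exp_norm_gaussian:
  "integrable (gaussian (0::'a::euclidean_space) 1) (\<lambda>x. exp (k * norm x))"
proof (rule integrableI_nonneg)
  define C where "C = (1 / sqrt (2 * pi)) ^ DIM('a) / (1 / sqrt (2 * pi * 2)) ^ DIM('a) * exp (k\<^sup>2)"
  have le: "gauss_pdf 0 1 x * exp (k * norm x) \<le> C * gauss_pdf 0 2 x" for x :: 'a
  proof -
    have "0 \<le> (k - norm x / 2)\<^sup>2" by simp
    then have "- (norm x)\<^sup>2 / 2 + k * norm x \<le> k\<^sup>2 - (norm x)\<^sup>2 / 4"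
      by (simp add: power2_eq_square algebra_simps)
    then have "exp (- (norm x)\<^sup>2 / 2) * exp (k * norm x) \<le> exp (k\<^sup>2) * exp (- (norm x)\<^sup>2 / 4)"
      unfolding exp_add[symmetric] by simp
    then have "(1 / sqrt (2 * pi)) ^ DIM('a) * (exp (- (norm x)\<^sup>2 / 2) * exp (k * norm x))
        \<le> (1 / sqrt (2 * pi)) ^ DIM('a) * (exp (k\<^sup>2) * exp (- (norm x)\<^sup>2 / 4))"
      by (rule mult_left_mono) simp
    then show ?thesis by (simp add: gauss_pdf_def C_def)
  qed
  have C: "C \<ge> 0" by (simp add: C_def)
  have "(\<integral>\<^sup>+x. ennreal (exp (k * norm x)) \<partial>gaussian (0::'a) 1)
      = (\<integral>\<^sup>+x. ennreal (gauss_pdf 0 1 (x::'a)) * ennreal (exp (k * norm x)) \<partial>lborel)"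
    by (rule nn_integral_gaussian) auto
  also have "\<dots> \<le> (\<integral>\<^sup>+x. ennreal C * ennreal (gauss_pdf 0 2 (x::'a)) \<partial>lborel)"
    by (intro nn_integral_mono)
       (use le C in \<open>auto simp: ennreal_mult[symmetric] gauss_pdf_pos less_imp_le intro!: ennreal_leI\<close>)
  also have "\<dots> = ennreal C"
    by (subst nn_integral_cmult) (auto simp: nn_integral_gauss_pdf)
  finally show "(\<integral>\<^sup>+x. ennreal (exp (k * norm x)) \<partial>gaussian (0::'a) 1) < \<infinity>"
    by (metis ennreal_less_top infinity_ennreal_def order_le_less_trans)
qed auto

lemma le_exp_self: "(x::real) \<le> exp x"
  using exp_ge_add_one_self[of x] by linarith

lemma integrable_norm_gaussian: "integrable (gaussian (0::'a::euclidean_space) 1) norm"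
  by (rule Bochner_Integration.integrable_bound[OF integrable_exp_norm_gaussian[of 1]])
     (auto intro: le_exp_self)

lemma integrable_norm2_gaussian: "integrable (gaussian (0::'a::euclidean_space) 1) (\<lambda>x. (norm x)\<^sup>2)"
proof (rule Bochner_Integration.integrable_bound[OF integrable_exp_norm_gaussian[of 2]])
  have "(norm x)\<^sup>2 \<le> exp (2 * norm x)" for x :: 'a
    using power_mono[OF le_exp_self[of "norm x"] norm_ge_zero, of 2] by (simp add: exp_double)
  then show "AE x in gaussian (0::'a) 1. norm ((norm x)\<^sup>2) \<le> norm (exp (2 * norm x))" by simp
qed auto

lemma cball_half_mass:
  fixes M :: "'a::euclidean_space measure"
  assumes "prob_space M" and sets [measurable_cong]: "sets M = sets borel"
  shows "\<exists>A>0. measure M (cball 0 A) \<ge> 1 / 2"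
proof -
  interpret prob_space M by fact
  have sp: "space M = UNIV" using sets_eq_imp_space_eq[OF sets] by simp
  have "(\<lambda>n. prob (cball 0 (real n))) \<longlonglongrightarrow> prob (\<Union>n. cball 0 (real n))"
    by (rule finite_Lim_measure_incseq) (auto simp: incseq_def intro: order_trans)
  moreover have "(\<Union>n. cball 0 (real n)) = (UNIV :: 'a set)"
    by (auto intro: real_arch_simple)
  ultimately have "(\<lambda>n. prob (cball 0 (real n))) \<longlonglongrightarrow> 1"
    using prob_space sp by simp
  then have "\<forall>\<^sub>F n in sequentially. prob (cball 0 (real n)) > 1 / 2"
    by (rule order_tendstoD) simp
  then have "\<forall>\<^sub>F n in sequentially. prob (cball 0 (real n)) > 1 / 2 \<and> n > 0"
    by (rule eventually_conj) (rule eventually_gt_at_top)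
  then obtain n :: nat where "prob (cball 0 (real n)) > 1 / 2" "n > 0"
    by (auto dest!: eventually_happens)
  then show ?thesis by (intro exI[of _ "real n"]) auto
qed

lemma gaussian_ball_mass:
  assumes "norm z \<le> Z" "r > 0"
  shows "measure (gaussian (0::'a::euclidean_space) 1) (cball z r)
    \<ge> (1 / sqrt (2 * pi)) ^ DIM('a) * exp (- (Z + r)\<^sup>2 / 2) * (unit_ball_vol (DIM('a)) * r ^ DIM('a))"
    (is "_ \<ge> ?k * ?V")
proof -
  interpret g: prob_space "gaussian (0::'a) 1" by (rule prob_space_gaussian) simp
  have V: "?V \<ge> 0" using assms by simp
  have "ennreal (?k * ?V) = (\<integral>\<^sup>+x. ennreal ?k * indicator (cball z r) x \<partial>lborel)"
    using assms V by (subst nn_integral_cmult_indicator)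
      (auto simp: emeasure_cball ennreal_mult[symmetric])
  also have "\<dots> \<le> (\<integral>\<^sup>+x. ennreal (gauss_pdf 0 1 x) * indicator (cball z r) x \<partial>lborel)"
  proof (intro nn_integral_mono)
    fix x :: 'a
    show "ennreal ?k * indicator (cball z r) x \<le> ennreal (gauss_pdf 0 1 x) * indicator (cball z r) x"
    proof (cases "x \<in> cball z r")
      case True
      then have "norm x \<le> Z + r"
        using assms(1) norm_triangle_sub[of x z] by (auto simp: dist_norm norm_minus_commute)
      then have "(norm x)\<^sup>2 \<le> (Z + r)\<^sup>2" by (rule power_mono) simp
      then have "?k \<le> gauss_pdf 0 1 x"
        by (auto simp: gauss_pdf_def intro!: divide_right_mono)
      then show ?thesis using True by (auto intro!: ennreal_leI)
    qed simp
  qed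
  also have "\<dots> = (\<integral>\<^sup>+x. indicator (cball z r) x \<partial>gaussian 0 1)"
    by (rule nn_integral_gaussian[symmetric]) (simp, rule borel_measurable_indicator, simp)
  also have "\<dots> = ennreal (measure (gaussian 0 1) (cball z r))"
    by (simp add: g.emeasure_eq_measure)
  finally show ?thesis by (simp add: ennreal_le_iff)
qed

text \<open>At least half of the mass of \<open>\<nu>\<close> lies in some \<open>cball 0 A\<close>.
  From a point there, every noise in a ball of radius \<open>\<epsilon> / c1\<close> around a
  suitable \<open>z\<close> leads into \<open>cball xs \<epsilon>\<close>. The lower bound
  \<open>c0\<close> on the noise level keeps \<open>z\<close> in a fixed ball, and the upper bound
  \<open>c1\<close> fixes the radius, so the Gaussian mass is bounded below uniformly.\<close>

lemma noised_ball_mass: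
  fixes \<nu> :: "'a::euclidean_space measure"
  assumes nu: "prob_space \<nu>" "sets \<nu> = sets borel" and c0: "c0 > 0" "c0 \<le> c1" and e: "\<epsilon> > 0"
  obtains p0 where "p0 > 0"
    "\<And>b p c. norm b \<le> \<beta> \<Longrightarrow> 0 \<le> p \<Longrightarrow> p \<le> 1 \<Longrightarrow> c0 \<le> c \<Longrightarrow> c \<le> c1
      \<Longrightarrow> p0 \<le> measure (noised \<nu> b p c) (cball xs \<epsilon>)"
proof -
  interpret n: prob_space \<nu> by fact
  interpret g: prob_space "gaussian (0::'a) 1" by (rule prob_space_gaussian) simp
  obtain A where A: "A > 0" "n.prob (cball 0 A) \<ge> 1 / 2" using cball_half_mass[OF nu] by blast
  define r where "r = \<epsilon> / c1"
  define Z where "Z = (norm xs + \<beta> + A) / c0"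
  define k where "k = (1 / sqrt (2 * pi)) ^ DIM('a) * exp (- (Z + r)\<^sup>2 / 2) * (unit_ball_vol (DIM('a)) * r ^ DIM('a))"
  have r: "r > 0" using c0 e by (simp add: r_def)
  have k: "k > 0" using r by (simp add: k_def)
  have "k / 2 \<le> measure (noised \<nu> b p c) (cball xs \<epsilon>)"
    if b: "norm b \<le> \<beta>" and p: "0 \<le> p" "p \<le> 1" and c: "c0 \<le> c" "c \<le> c1" for b p c
  proof -
    interpret m: prob_space "noised \<nu> b p c" by (rule prob_space_noised[OF nu])
    have cp: "c > 0" using c c0 by simp
    have inner: "ennreal k * indicator (cball 0 A) x
        \<le> (\<integral>\<^sup>+\<xi>. indicator (cball xs \<epsilon>) (b + p *\<^sub>R x + c *\<^sub>R \<xi>) \<partial>gaussian 0 1)" for x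
    proof (cases "x \<in> cball 0 A")
      case True
      define z where "z = (xs - b - p *\<^sub>R x) /\<^sub>R c"
      have "norm (p *\<^sub>R x) \<le> 1 * A" unfolding norm_scaleR by (intro mult_mono) (use True p A in auto)
      then have "norm (xs - b - p *\<^sub>R x) \<le> norm xs + \<beta> + A"
        using b norm_triangle_ineq4[of "xs - b" "p *\<^sub>R x"] norm_triangle_ineq4[of xs b] by simp
      then have "norm z \<le> Z"
        unfolding z_def Z_def using cp c c0
        by (auto simp: divide_inverse[symmetric] mult.commute[of "inverse _"] intro!: frac_le order_trans[OF norm_ge_zero])
      then have "ennreal k \<le> ennreal (measure (gaussian 0 1) (cball z r))"
        unfolding k_def by (intro ennreal_leI gaussian_ball_mass r)
      also have "\<dots> = (\<integral>\<^sup>+\<xi>. indicator (cball z r) \<xi> \<partial>gaussian 0 1)"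
        by (simp add: g.emeasure_eq_measure)
      also have "\<dots> \<le> (\<integral>\<^sup>+\<xi>. indicator (cball xs \<epsilon>) (b + p *\<^sub>R x + c *\<^sub>R \<xi>) \<partial>gaussian 0 1)"
      proof (intro nn_integral_mono)
        fix \<xi>
        have "xs - (b + p *\<^sub>R x + c *\<^sub>R \<xi>) = c *\<^sub>R (z - \<xi>)"
          using cp by (simp add: z_def algebra_simps)
        then have "dist xs (b + p *\<^sub>R x + c *\<^sub>R \<xi>) = c * dist z \<xi>"
          using cp by (simp add: dist_norm)
        moreover have "c * dist z \<xi> \<le> c1 * r" if "dist z \<xi> \<le> r"
          by (intro mult_mono) (use that c cp in auto)
        moreover have "c1 * r = \<epsilon>" using c0 by (simp add: r_def)
        ultimately show "indicator (cball z r) \<xi> \<le> (indicator (cball xs \<epsilon>) (b + p *\<^sub>R x + c *\<^sub>R \<xi>) :: ennreal)"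
          by (auto simp: indicator_def)
      qed
      finally show ?thesis using True by simp
    qed simp
    have "ennreal (k / 2) \<le> ennreal k * emeasure \<nu> (cball 0 A)"
      using A k by (simp add: n.emeasure_eq_measure ennreal_mult[symmetric])
    also have "\<dots> = (\<integral>\<^sup>+x. ennreal k * indicator (cball 0 A) x \<partial>\<nu>)"
      using nu by (simp add: nn_integral_cmult_indicator)
    also have "\<dots> \<le> (\<integral>\<^sup>+x. \<integral>\<^sup>+\<xi>. indicator (cball xs \<epsilon>) (b + p *\<^sub>R x + c *\<^sub>R \<xi>) \<partial>gaussian 0 1 \<partial>\<nu>)"
      by (intro nn_integral_mono inner)
    also have "\<dots> = (\<integral>\<^sup>+x. indicator (cball xs \<epsilon>) x \<partial>noised \<nu> b p c)"
      by (rule nn_integral_noised[OF nu(2), symmetric]) (rule borel_measurable_indicator, simp)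
    also have "\<dots> = ennreal (measure (noised \<nu> b p c) (cball xs \<epsilon>))"
      by (simp add: m.emeasure_eq_measure)
    finally show ?thesis by (simp add: ennreal_le_iff)
  qed
  then show ?thesis using k that[of "k / 2"] by simp
qed

section \<open>Concentration of the weighted measure near the minimizer\<close>

locale consensus_objective =
  fixes f :: "'a::euclidean_space \<Rightarrow> real" and xs :: 'a and L cl R :: real
  assumes f_cont: "continuous_on UNIV f"
    and xs_min: "\<And>x. f xs \<le> f x"
    and xs_unique: "\<And>x. f x = f xs \<Longrightarrow> x = xs"
    and L_pos: "L > 0" and cl_pos: "cl > 0" and R_pos: "R > 0"
    and f_lip: "\<And>x y. \<bar>f x - f y\<bar> \<le> L * (1 + norm x + norm y) * norm (x - y)"
    and f_lower: "\<And>x. norm x \<ge> R \<Longrightarrow> cl * (norm x)\<^sup>2 \<le> f x - f xs"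
begin

lemma f_measurable [measurable]: "f \<in> borel_measurable borel"
  by (rule borel_measurable_continuous_onI[OF f_cont])

definition wt :: "real \<Rightarrow> 'a \<Rightarrow> real" where
  "wt \<alpha> x = exp (- \<alpha> * f x)"

lemma wt_pos: "wt \<alpha> x > 0"
  by (simp add: wt_def)

lemma wt_measurable [measurable]: "wt \<alpha> \<in> borel_measurable borel"
  unfolding wt_def by measurable

lemma wt_le: "\<alpha> \<ge> 0 \<Longrightarrow> wt \<alpha> x \<le> wt \<alpha> xs"
  by (simp add: wt_def mult_left_mono xs_min)

lemma integrable_wt_times:
  fixes h :: "'a \<Rightarrow> 'b::{banach, second_countable_topology}"
  assumes "\<alpha> \<ge> 0" and s [measurable_cong]: "sets \<rho> = sets borel" and h: "integrable \<rho> h"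
  shows "integrable \<rho> (\<lambda>x. wt \<alpha> x *\<^sub>R h x)"
proof (rule Bochner_Integration.integrable_bound)
  show "integrable \<rho> (\<lambda>x. wt \<alpha> xs *\<^sub>R norm (h x))" using h by auto
  have [measurable]: "h \<in> borel_measurable \<rho>" using h by simp
  show "(\<lambda>x. wt \<alpha> x *\<^sub>R h x) \<in> borel_measurable \<rho>" by measurable
  have "norm (wt \<alpha> x *\<^sub>R h x) \<le> norm (wt \<alpha> xs *\<^sub>R norm (h x))" for x
    using mult_right_mono[OF wt_le[OF assms(1), of x] norm_ge_zero[of "h x"]] wt_pos
    by (simp add: abs_mult abs_of_pos)
  then show "AE x in \<rho>. norm (wt \<alpha> x *\<^sub>R h x) \<le> norm (wt \<alpha> xs *\<^sub>R norm (h x))" by simp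
qed

lemma integrable_wt:
  assumes "\<alpha> \<ge> 0" "sets \<rho> = sets borel" "prob_space \<rho>"
  shows "integrable \<rho> (wt \<alpha>)"
proof -
  interpret prob_space \<rho> by fact
  show ?thesis using integrable_wt_times[OF assms(1,2), of "\<lambda>_. 1 :: real"] by simp
qed

text \<open>The integral is split at the level \<open>l + \<eta>\<close>. Below it
  \<open>\<psi>\<close> is at most \<open>\<epsilon>\<close>; above it the weight is at most
  \<open>exp (- \<alpha> * (l + \<eta>))\<close>, whereas the points below \<open>l\<close> alone
  make the denominator at least \<open>p * exp (- \<alpha> * l)\<close>. The measure enters the
  bound only through \<open>p\<close> and \<open>m\<close>, which is what allows uniformity over
  families.\<close>

lemma laplace_bound:
  assumes rho: "prob_space \<rho>" and s [measurable_cong]: "sets \<rho> = sets borel" and alpha: "\<alpha> \<ge> 0"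
    and mass: "measure \<rho> {x. f x \<le> l} \<ge> p" "p > 0"
    and psi: "integrable \<rho> \<psi>" "(\<integral>x. \<psi> x \<partial>\<rho>) \<le> m" "\<And>x. \<psi> x \<ge> 0"
    and small: "\<And>x. f x \<le> l + \<eta> \<Longrightarrow> \<psi> x \<le> \<epsilon>" and eps: "\<epsilon> \<ge> 0"
  shows "p * exp (- \<alpha> * l) \<le> (\<integral>x. wt \<alpha> x \<partial>\<rho>)"
    and "(\<integral>x. wt \<alpha> x * \<psi> x \<partial>\<rho>) \<le> (\<epsilon> + exp (- \<alpha> * \<eta>) * m / p) * (\<integral>x. wt \<alpha> x \<partial>\<rho>)"
proof -
  interpret prob_space \<rho> by fact
  have sp: "space \<rho> = UNIV" using sets_eq_imp_space_eq[OF s] by simp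
  note iw = integrable_wt[OF alpha s rho]
  have "0 \<le> (\<integral>x. \<psi> x \<partial>\<rho>)" by (simp add: psi(3))
  then have m: "m \<ge> 0" using psi(2) by linarith
  have "p * exp (- \<alpha> * l) \<le> measure \<rho> {x. f x \<le> l} * exp (- \<alpha> * l)"
    using mass by (intro mult_right_mono) auto
  also have "\<dots> = (\<integral>x. indicator {x. f x \<le> l} x * exp (- \<alpha> * l) \<partial>\<rho>)"
    by (simp add: sp)
  also have "\<dots> \<le> (\<integral>x. wt \<alpha> x \<partial>\<rho>)"
  proof (rule integral_mono[OF _ iw])
    show "integrable \<rho> (\<lambda>x. indicator {x. f x \<le> l} x * exp (- \<alpha> * l))"
      by (intro integrable_mult_left integrable_real_indicator) (auto simp: emeasure_eq_measure)
    show "indicator {x. f x \<le> l} x * exp (- \<alpha> * l) \<le> wt \<alpha> x" for x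
      using alpha by (auto simp: wt_def indicator_def mult_left_mono)
  qed
  finally show D: "p * exp (- \<alpha> * l) \<le> (\<integral>x. wt \<alpha> x \<partial>\<rho>)" .
  have iwp: "integrable \<rho> (\<lambda>x. wt \<alpha> x * \<psi> x)"
    using integrable_wt_times[OF alpha s psi(1)] by simp
  have "(\<integral>x. wt \<alpha> x * \<psi> x \<partial>\<rho>) \<le> (\<integral>x. \<epsilon> * wt \<alpha> x + exp (- \<alpha> * (l + \<eta>)) * \<psi> x \<partial>\<rho>)"
  proof (rule integral_mono[OF iwp])
    show "integrable \<rho> (\<lambda>x. \<epsilon> * wt \<alpha> x + exp (- \<alpha> * (l + \<eta>)) * \<psi> x)"
      using iw psi(1) by simp
    fix x
    show "wt \<alpha> x * \<psi> x \<le> \<epsilon> * wt \<alpha> x + exp (- \<alpha> * (l + \<eta>)) * \<psi> x"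
    proof (cases "f x \<le> l + \<eta>")
      case True
      then have "wt \<alpha> x * \<psi> x \<le> wt \<alpha> x * \<epsilon>"
        by (intro mult_left_mono small) (auto simp: wt_pos less_imp_le)
      then show ?thesis using psi(3)[of x] by (simp add: mult.commute add_increasing2)
    next
      case False
      then have "wt \<alpha> x \<le> exp (- \<alpha> * (l + \<eta>))"
        unfolding wt_def using alpha by (simp add: mult_left_mono)
      then have "wt \<alpha> x * \<psi> x \<le> exp (- \<alpha> * (l + \<eta>)) * \<psi> x"
        by (intro mult_right_mono psi)
      then show ?thesis using eps wt_pos[of \<alpha> x] by (simp add: add_increasing)
    qed
  qed
  also have "\<dots> = \<epsilon> * (\<integral>x. wt \<alpha> x \<partial>\<rho>) + exp (- \<alpha> * (l + \<eta>)) * (\<integral>x. \<psi> x \<partial>\<rho>)"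
    using iw psi(1) by simp
  also have "exp (- \<alpha> * (l + \<eta>)) * (\<integral>x. \<psi> x \<partial>\<rho>) \<le> exp (- \<alpha> * (l + \<eta>)) * m"
    using psi by simp
  also have "exp (- \<alpha> * (l + \<eta>)) * m = exp (- \<alpha> * \<eta>) * m / p * (p * exp (- \<alpha> * l))"
    using mass by (simp add: exp_add[symmetric] algebra_simps)
  also have "\<dots> \<le> exp (- \<alpha> * \<eta>) * m / p * (\<integral>x. wt \<alpha> x \<partial>\<rho>)"
    using D m mass by (intro mult_left_mono) auto
  finally show "(\<integral>x. wt \<alpha> x * \<psi> x \<partial>\<rho>) \<le> (\<epsilon> + exp (- \<alpha> * \<eta>) * m / p) * (\<integral>x. wt \<alpha> x \<partial>\<rho>)"
    by (simp add: algebra_simps)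
qed

text \<open>Points of norm at most \<open>max R 1\<close> that are far from \<open>xs\<close> form a
  compact set on which \<open>f\<close> exceeds its minimum by a fixed amount. Outside that ball the
  quadratic growth gives at least \<open>cl\<close>, as the norm is at least 1.\<close>

lemma sublevel_small:
  assumes e: "\<epsilon> > 0"
  obtains \<eta> where "\<eta> > 0" "\<And>x. f x \<le> f xs + \<eta> \<Longrightarrow> dist x xs < \<epsilon>"
proof -
  define K where "K = cball 0 (max R 1) \<inter> {x. dist x xs \<ge> \<epsilon>}"
  have "closed {x. dist x xs \<ge> \<epsilon>}" by (intro closed_Collect_le continuous_intros)
  then have K: "compact K" unfolding K_def by (rule compact_Int_closed[OF compact_cball])
  have "\<exists>\<eta>>0. \<forall>x\<in>K. f x > f xs + \<eta>"
  proof (cases "K = {}")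
    case False
    obtain y where y: "y \<in> K" "\<And>x. x \<in> K \<Longrightarrow> f y \<le> f x"
      using continuous_attains_inf[OF K False continuous_on_subset[OF f_cont]] by auto
    have "f y \<noteq> f xs" using xs_unique[of y] y(1) e by (auto simp: K_def)
    then have "f xs < f y" using xs_min[of y] by simp
    then show ?thesis
      using y(2) by (intro exI[of _ "(f y - f xs) / 2"]) (auto simp: field_simps, smt (verit))
  qed (auto intro: exI[of _ 1])
  then obtain \<eta> where eta: "\<eta> > 0" "\<And>x. x \<in> K \<Longrightarrow> f x > f xs + \<eta>" by blast
  have out: "f x > f xs + cl / 2" if "norm x > max R 1" for x
  proof -
    have "cl * 1 \<le> cl * (norm x)\<^sup>2"
      using that cl_pos by (intro mult_left_mono) (auto simp: one_le_power)
    then show ?thesis using f_lower[of x] that cl_pos by linarith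
  qed
  show ?thesis
  proof
    show "min \<eta> (cl / 2) > 0" using eta cl_pos by simp
    fix x assume x: "f x \<le> f xs + min \<eta> (cl / 2)"
    show "dist x xs < \<epsilon>"
    proof (rule ccontr)
      assume "\<not> dist x xs < \<epsilon>"
      then have "x \<in> K \<or> norm x > max R 1" by (auto simp: K_def)
      then show False using x eta(2)[of x] out[of x] by auto
    qed
  qed
qed

lemma sublevel_contains_ball:
  assumes "\<eta> > 0"
  obtains \<epsilon> where "\<epsilon> > 0" "cball xs \<epsilon> \<subseteq> {x. f x \<le> f xs + \<eta>}"
proof -
  have "isCont f xs" using f_cont by (simp add: continuous_on_eq_continuous_at)
  then obtain d where d: "d > 0" "\<And>x. dist x xs < d \<Longrightarrow> dist (f x) (f xs) < \<eta>"
    using assms unfolding continuous_at_eps_delta by blast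
  show ?thesis
  proof
    show "d / 2 > 0" using d by simp
    show "cball xs (d / 2) \<subseteq> {x. f x \<le> f xs + \<eta>}"
    proof
      fix x assume "x \<in> cball xs (d / 2)"
      then have "dist (f x) (f xs) < \<eta>" using d by (intro d(2)) (auto simp: dist_commute)
      then show "x \<in> {x. f x \<le> f xs + \<eta>}" by (auto simp: dist_real_def)
    qed
  qed
qed

text \<open>The threshold for \<alpha> depends on the family only through the bound \<open>m\<close>
  and the least mass of a single small ball around \<open>xs\<close>. Half of
  \<open>\<theta>\<close> is spent on the values of \<open>\<psi>\<close> near \<open>xs\<close>,
  the other half on the exponentially small remainder.\<close>

lemma laplace_uniform:
  assumes fam: "\<And>\<rho>. \<rho> \<in> \<K> \<Longrightarrow> prob_space \<rho> \<and> sets \<rho> = sets borel"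
    and mass: "\<And>\<epsilon>. \<epsilon> > 0 \<Longrightarrow> \<exists>p>0. \<forall>\<rho>\<in>\<K>. p \<le> measure \<rho> (cball xs \<epsilon>)"
    and psi: "\<And>\<rho>. \<rho> \<in> \<K> \<Longrightarrow> integrable \<rho> \<psi> \<and> (\<integral>x. \<psi> x \<partial>\<rho>) \<le> m" "\<And>x. \<psi> x \<ge> 0"
    and lim: "(\<psi> \<longlongrightarrow> 0) (nhds xs)" and theta: "\<theta> > 0"
  shows "\<forall>\<^sub>F \<alpha> in at_top. \<forall>\<rho>\<in>\<K>. (\<integral>x. wt \<alpha> x * \<psi> x \<partial>\<rho>) \<le> \<theta> * (\<integral>x. wt \<alpha> x \<partial>\<rho>)"
proof -
  have "\<forall>\<^sub>F x in nhds xs. \<psi> x < \<theta> / 2"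
    using lim theta by (intro order_tendstoD) auto
  then obtain \<epsilon> where eps: "\<epsilon> > 0" "\<And>x. dist x xs < \<epsilon> \<Longrightarrow> \<psi> x < \<theta> / 2"
    by (auto simp: eventually_nhds_metric)
  obtain \<eta> where eta: "\<eta> > 0" "\<And>x. f x \<le> f xs + \<eta> \<Longrightarrow> dist x xs < \<epsilon>"
    using sublevel_small[OF eps(1)] by blast
  obtain e where e: "e > 0" "cball xs e \<subseteq> {x. f x \<le> f xs + \<eta> / 2}"
    using sublevel_contains_ball[of "\<eta> / 2"] eta by auto
  obtain p where p: "p > 0" "\<And>\<rho>. \<rho> \<in> \<K> \<Longrightarrow> p \<le> measure \<rho> (cball xs e)"
    using mass[OF e(1)] by blast
  have "((\<lambda>\<alpha>. exp (- \<alpha> * (\<eta> / 2)) * m / p) \<longlongrightarrow> 0 * m / p) at_top"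
  proof (intro tendsto_intros filterlim_compose[OF exp_at_bot])
    show "filterlim (\<lambda>\<alpha>. - \<alpha> * (\<eta> / 2)) at_bot at_top"
      using eta filterlim_tendsto_pos_mult_at_bot[OF tendsto_const[of "\<eta> / 2"] _ filterlim_uminus_at_bot_at_top]
      by (simp add: mult.commute)
  qed (use p in auto)
  then have "\<forall>\<^sub>F \<alpha> in at_top. exp (- \<alpha> * (\<eta> / 2)) * m / p < \<theta> / 2"
    using theta by (intro order_tendstoD) auto
  then show ?thesis
    using eventually_ge_at_top[of 0]
  proof eventually_elim
    case (elim \<alpha>)
    show ?case
    proof
      fix \<rho> assume r: "\<rho> \<in> \<K>"
      interpret prob_space \<rho> using fam[OF r] by simp
      have s[measurable_cong]: "sets \<rho> = sets borel" using fam[OF r] by simp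
      have iw: "integrable \<rho> (wt \<alpha>)" by (rule integrable_wt[OF elim(2) s prob_space_axioms])
      have "prob (cball xs e) \<le> prob {x. f x \<le> f xs + \<eta> / 2}"
        by (intro finite_measure_mono e) (simp add: s)
      then have "(\<integral>x. wt \<alpha> x * \<psi> x \<partial>\<rho>) \<le> (\<theta> / 2 + exp (- \<alpha> * (\<eta> / 2)) * m / p) * (\<integral>x. wt \<alpha> x \<partial>\<rho>)"
        using p(2)[OF r] psi(1)[OF r] theta eta eps
        by (intro laplace_bound(2)[where l = "f xs + \<eta> / 2"] prob_space_axioms s elim p psi less_imp_le[OF eps(2)]) auto
      also have "\<dots> \<le> \<theta> * (\<integral>x. wt \<alpha> x \<partial>\<rho>)"
      proof (rule mult_right_mono)
        show "\<theta> / 2 + exp (- \<alpha> * (\<eta> / 2)) * m / p \<le> \<theta>" using elim(1) by linarith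
      qed (intro integral_nonneg_AE AE_I2 less_imp_le wt_pos)
      finally show "(\<integral>x. wt \<alpha> x * \<psi> x \<partial>\<rho>) \<le> \<theta> * (\<integral>x. wt \<alpha> x \<partial>\<rho>)" .
    qed
  qed
qed

lemma integral_wt_pos:
  assumes "\<alpha> \<ge> 0" "sets \<rho> = sets borel" "prob_space \<rho>"
  shows "(\<integral>x. wt \<alpha> x \<partial>\<rho>) > 0"
proof -
  interpret prob_space \<rho> by fact
  have "(\<integral>x. wt \<alpha> x \<partial>\<rho>) \<noteq> 0"
  proof
    assume "(\<integral>x. wt \<alpha> x \<partial>\<rho>) = 0"
    then have "AE x in \<rho>. wt \<alpha> x = 0"
      using integrable_wt[OF assms] wt_pos
      by (subst (asm) integral_nonneg_eq_0_iff_AE) (auto intro: less_imp_le)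
    then have "AE x in \<rho>. False" by eventually_elim (metis wt_pos less_irrefl)
    then show False by simp
  qed
  moreover have "(\<integral>x. wt \<alpha> x \<partial>\<rho>) \<ge> 0" by (intro integral_nonneg_AE AE_I2 less_imp_le wt_pos)
  ultimately show ?thesis by simp
qed

lemma consensus_point_eq:
  "consensus_point f \<alpha> \<rho> = (\<integral>x. wt \<alpha> x *\<^sub>R x \<partial>\<rho>) /\<^sub>R (\<integral>x. wt \<alpha> x \<partial>\<rho>)"
  by (simp add: consensus_point_def wt_def)

text \<open>The centre \<open>z\<close> is free for two uses: at the consensus point itself the
  integral vanishes, and \<open>z = 0\<close> gives the quotient in cleared form.\<close>

lemma integral_wt_centered:
  assumes "\<alpha> \<ge> 0" "sets \<rho> = sets borel" "prob_space \<rho>" "integrable \<rho> (\<lambda>x. x)"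
  shows "(\<integral>x. wt \<alpha> x *\<^sub>R (x - z) \<partial>\<rho>) = (\<integral>x. wt \<alpha> x \<partial>\<rho>) *\<^sub>R (consensus_point f \<alpha> \<rho> - z)"
proof -
  have "(\<integral>x. wt \<alpha> x *\<^sub>R (x - z) \<partial>\<rho>) = (\<integral>x. wt \<alpha> x *\<^sub>R x \<partial>\<rho>) - (\<integral>x. wt \<alpha> x \<partial>\<rho>) *\<^sub>R z"
    using integrable_wt_times[OF assms(1,2,4)] integrable_wt[OF assms(1-3)]
    by (simp add: scaleR_diff_right)
  then show ?thesis
    using integral_wt_pos[OF assms(1-3)] by (simp add: consensus_point_eq scaleR_diff_right)
qed

lemma consensus_point_dist_le:
  assumes "\<alpha> \<ge> 0" "sets \<rho> = sets borel" "prob_space \<rho>" "integrable \<rho> (\<lambda>x. x)"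
    and "(\<integral>x. wt \<alpha> x * norm (x - z) \<partial>\<rho>) \<le> C * (\<integral>x. wt \<alpha> x \<partial>\<rho>)"
  shows "norm (consensus_point f \<alpha> \<rho> - z) \<le> C"
proof -
  let ?D = "\<integral>x. wt \<alpha> x \<partial>\<rho>"
  have "?D * norm (consensus_point f \<alpha> \<rho> - z) = norm (\<integral>x. wt \<alpha> x *\<^sub>R (x - z) \<partial>\<rho>)"
    using integral_wt_pos[OF assms(1-3)] by (simp add: integral_wt_centered[OF assms(1-4)])
  also have "\<dots> \<le> (\<integral>x. norm (wt \<alpha> x *\<^sub>R (x - z)) \<partial>\<rho>)" by (rule integral_norm_bound)
  also have "\<dots> = (\<integral>x. wt \<alpha> x * norm (x - z) \<partial>\<rho>)" using wt_pos by (simp add: abs_of_pos)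
  also have "\<dots> \<le> C * ?D" by fact
  finally show ?thesis using integral_wt_pos[OF assms(1-3)] by (simp add: mult.commute)
qed

text \<open>Meant for the initial law, which need not charge neighbourhoods of \<open>xs\<close>.
  The minimum is replaced by the level \<open>f y\<close> reached on a ball with half of the mass:
  coercivity confines the points below \<open>f y + 1\<close> to norm at most \<open>r\<close>, and
  the rest contributes at most \<open>m / (1 / 2)\<close>. The bound is the same for all
  \<open>\<alpha> \<ge> 0\<close>.\<close>

lemma consensus_point_bounded:
  assumes rho: "prob_space \<rho>" and s [measurable_cong]: "sets \<rho> = sets borel" and int: "integrable \<rho> (\<lambda>x. x)"
  obtains K where "\<forall>\<^sub>F \<alpha> in at_top. norm (consensus_point f \<alpha> \<rho>) \<le> K"
proof -
  interpret prob_space \<rho> by fact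
  obtain A where A: "A > 0" "prob (cball 0 A) \<ge> 1 / 2" using cball_half_mass[OF rho s] by blast
  have "cball (0::'a) A \<noteq> {}" using A by simp
  then have "\<exists>y\<in>cball 0 A. \<forall>x\<in>cball 0 A. f x \<le> f y"
    by (intro continuous_attains_sup continuous_on_subset[OF f_cont]) auto
  then obtain y where y: "\<And>x. x \<in> cball 0 A \<Longrightarrow> f x \<le> f y" by blast
  define r where "r = max (max R 1) ((f y + 1 - f xs) / cl)"
  define m where "m = (\<integral>x. norm x \<partial>\<rho>)"
  have small: "norm x \<le> r" if "f x \<le> f y + 1" for x
  proof (cases "norm x \<le> max R 1")
    case False
    then have n: "norm x \<ge> R" "norm x \<ge> 1" by auto
    have "norm x * 1 \<le> norm x * norm x" by (rule mult_left_mono) (use n in auto)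
    then have "cl * norm x \<le> cl * (norm x)\<^sup>2"
      using cl_pos by (simp add: power2_eq_square)
    also have "\<dots> \<le> f y + 1 - f xs" using f_lower[OF n(1)] that by simp
    finally have "norm x \<le> (f y + 1 - f xs) / cl"
      using cl_pos by (simp add: pos_le_divide_eq mult.commute)
    then show ?thesis unfolding r_def by (rule max.coboundedI2)
  qed (simp add: r_def)
  have r0: "r \<ge> 0" by (simp add: r_def le_max_iff_disj)
  have "norm (consensus_point f \<alpha> \<rho>) \<le> r + 2 * m" if a: "\<alpha> \<ge> 0" for \<alpha>
  proof -
    have "prob (cball 0 A) \<le> prob {x. f x \<le> f y}"
      using y by (intro finite_measure_mono) (auto simp: s)
    then have "(\<integral>x. wt \<alpha> x * norm x \<partial>\<rho>) \<le> (r + exp (- \<alpha> * 1) * m / (1 / 2)) * (\<integral>x. wt \<alpha> x \<partial>\<rho>)"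
      by (intro laplace_bound(2)[where l = "f y"] rho s a)
         (use A int small r0 in \<open>simp_all add: m_def\<close>)
    also have "\<dots> \<le> (r + 2 * m) * (\<integral>x. wt \<alpha> x \<partial>\<rho>)"
    proof (intro mult_right_mono add_left_mono)
      have "m \<ge> 0" by (simp add: m_def)
      then show "exp (- \<alpha> * 1) * m / (1 / 2) \<le> 2 * m"
        using a mult_left_le[of "exp (- \<alpha>)" m] by (simp add: mult.commute)
      show "0 \<le> (\<integral>x. wt \<alpha> x \<partial>\<rho>)" using integral_wt_pos[OF a s rho] by simp
    qed
    finally show ?thesis using consensus_point_dist_le[OF a s rho int, of 0] by simp
  qed
  then have "\<forall>\<^sub>F \<alpha> in at_top. norm (consensus_point f \<alpha> \<rho>) \<le> r + 2 * m"
    by (rule eventually_mono[OF eventually_ge_at_top[of 0]])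
  then show ?thesis by (rule that)
qed

end

section \<open>Marginals and first moments in the presence of independent noise\<close>

lemma distr_pair_snd:
  assumes "prob_space M" "sigma_finite_measure N"
  shows "distr (M \<Otimes>\<^sub>M N) N snd = N"
proof (rule measure_eqI)
  interpret M: prob_space M by fact
  interpret N: sigma_finite_measure N by fact
  fix A assume "A \<in> sets (distr (M \<Otimes>\<^sub>M N) N snd)"
  then have A: "A \<in> sets N" by simp
  then have "snd -` A \<inter> space (M \<Otimes>\<^sub>M N) = space M \<times> A"
    using sets.sets_into_space[OF A] by (auto simp: space_pair_measure)
  then show "emeasure (distr (M \<Otimes>\<^sub>M N) N snd) A = emeasure N A"
    using A by (simp add: emeasure_distr N.emeasure_pair_measure_Times M.emeasure_space_1)
qed simp

lemma integrable_pair_fst: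
  fixes g :: "'a \<Rightarrow> 'b::{banach, second_countable_topology}"
  assumes "prob_space N" "integrable M g"
  shows "integrable (M \<Otimes>\<^sub>M N) (\<lambda>z. g (fst z))"
  by (rule integrable_distr[OF measurable_fst])
     (simp add: prob_space.distr_pair_fst[OF assms(1)] assms(2))

lemma integrable_pair_snd:
  fixes g :: "'a \<Rightarrow> 'b::{banach, second_countable_topology}"
  assumes "prob_space M" "sigma_finite_measure N" "integrable N g"
  shows "integrable (M \<Otimes>\<^sub>M N) (\<lambda>z. g (snd z))"
  by (rule integrable_distr[OF measurable_snd]) (simp add: distr_pair_snd[OF assms(1,2)] assms(3))

lemma noised_first_moment:
  fixes \<nu> :: "'a::euclidean_space measure"
  assumes nu: "prob_space \<nu>" and s [measurable_cong]: "sets \<nu> = sets borel"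
    and int: "integrable \<nu> (\<lambda>x. x)"
    and b: "norm b \<le> \<beta>" and p: "0 \<le> p" "p \<le> 1" and c: "0 \<le> c" "c \<le> c1"
  shows "integrable (noised \<nu> b p c) (\<lambda>x. x)"
    and "(\<integral>x. norm (x - z) \<partial>noised \<nu> b p c)
      \<le> \<beta> + norm z + (\<integral>x. norm x \<partial>\<nu>) + c1 * (\<integral>\<xi>. norm \<xi> \<partial>gaussian (0::'a) 1)"
proof -
  interpret g: prob_space "gaussian (0::'a) 1" by (rule prob_space_gaussian) simp
  interpret pg: prob_space "\<nu> \<Otimes>\<^sub>M gaussian (0::'a) 1" by (rule prob_space_pair_std[OF nu])
  let ?P = "\<nu> \<Otimes>\<^sub>M gaussian (0::'a) 1"
  have ig: "integrable (gaussian (0::'a) 1) (\<lambda>x. x)"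
    using integrable_norm_gaussian by (subst integrable_norm_iff[symmetric]) auto
  have i1: "integrable ?P (\<lambda>z. fst z)" by (rule integrable_pair_fst[OF g.prob_space_axioms int])
  have i2: "integrable ?P (\<lambda>z. snd z)"
    by (rule integrable_pair_snd[OF nu g.sigma_finite_measure_axioms ig])
  have e1: "(\<integral>z. norm (fst z) \<partial>?P) = (\<integral>x. norm x \<partial>\<nu>)"
    by (subst (2) g.distr_pair_fst[of \<nu>, symmetric]) (simp add: integral_distr)
  have e2: "(\<integral>z. norm (snd z) \<partial>?P) = (\<integral>x. norm x \<partial>gaussian (0::'a) 1)"
    by (subst (2) distr_pair_snd[OF nu g.sigma_finite_measure_axioms, symmetric]) (simp add: integral_distr)
  have i: "integrable ?P (\<lambda>z. b + p *\<^sub>R fst z + c *\<^sub>R snd z)"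
    using i1 i2 by (intro Bochner_Integration.integrable_add integrable_scaleR_right) auto
  then show "integrable (noised \<nu> b p c) (\<lambda>x. x)"
    unfolding noised_def by (subst integrable_distr_eq) (auto simp: split_beta')
  have "(\<integral>x. norm (x - z) \<partial>noised \<nu> b p c) = (\<integral>y. norm (b + p *\<^sub>R fst y + c *\<^sub>R snd y - z) \<partial>?P)"
    by (rule integral_noised[OF s]) simp
  also have "\<dots> \<le> (\<integral>y. (\<beta> + norm z) + norm (fst y) + c1 * norm (snd y) \<partial>?P)"
  proof (rule integral_mono)
    show "integrable ?P (\<lambda>y. norm (b + p *\<^sub>R fst y + c *\<^sub>R snd y - z))"
      using i by auto
    show "integrable ?P (\<lambda>y. (\<beta> + norm z) + norm (fst y) + c1 * norm (snd y))"
      using i1 i2 by auto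
    fix y :: "'a \<times> 'a"
    have "norm (b + p *\<^sub>R fst y + c *\<^sub>R snd y - z) \<le> norm b + norm (p *\<^sub>R fst y) + norm (c *\<^sub>R snd y) + norm z"
      using norm_triangle_ineq4[of "b + p *\<^sub>R fst y + c *\<^sub>R snd y" z]
        norm_triangle_ineq[of "b + p *\<^sub>R fst y" "c *\<^sub>R snd y"] norm_triangle_ineq[of b "p *\<^sub>R fst y"]
      by linarith
    moreover have "norm (p *\<^sub>R fst y) \<le> norm (fst y)"
      using p by (simp add: mult_left_le_one_le)
    moreover have "norm (c *\<^sub>R snd y) \<le> c1 * norm (snd y)"
      using c by (simp add: mult_right_mono)
    ultimately show "norm (b + p *\<^sub>R fst y + c *\<^sub>R snd y - z) \<le> (\<beta> + norm z) + norm (fst y) + c1 * norm (snd y)"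
      using b by linarith
  qed
  also have "\<dots> = \<beta> + norm z + (\<integral>x. norm x \<partial>\<nu>) + c1 * (\<integral>\<xi>. norm \<xi> \<partial>gaussian (0::'a) 1)"
    using i1 i2 pg.prob_space by (simp add: e1 e2)
  finally show "(\<integral>x. norm (x - z) \<partial>noised \<nu> b p c)
      \<le> \<beta> + norm z + (\<integral>x. norm x \<partial>\<nu>) + c1 * (\<integral>\<xi>. norm \<xi> \<partial>gaussian (0::'a) 1)" .
qed

subsection \<open>Contractivity of the consensus map\<close>

text \<open>The integrand is the test function to which Laplace's principle will be applied. The
  factor in front of the exponential is absorbed by \<open>t \<le> exp t\<close>, which turns
  \<open>k\<close> into \<open>k + 1\<close>.\<close>

lemma gaussian_exp_moment:
  fixes z :: "'a::euclidean_space"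
  assumes v: "v > 0" and mu: "norm \<mu> \<le> \<beta>" and k: "k \<ge> 0"
  shows "integrable (gaussian \<mu> v) (\<lambda>x. norm (x - z) * exp (k * norm (x - z)))"
    and "(\<integral>x. norm (x - z) * exp (k * norm (x - z)) \<partial>gaussian \<mu> v)
      \<le> exp ((k + 1) * (\<beta> + norm z)) * (\<integral>\<xi>. exp (((k + 1) * sqrt v) * norm \<xi>) \<partial>gaussian (0::'a) 1)"
proof -
  let ?h = "\<lambda>x. norm (x - z) * exp (k * norm (x - z))"
  have [measurable]: "?h \<in> borel_measurable borel" by measurable
  have bd: "?h (\<mu> + sqrt v *\<^sub>R \<xi>) \<le> exp ((k + 1) * (\<beta> + norm z)) * exp (((k + 1) * sqrt v) * norm \<xi>)" for \<xi>
  proof -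
    let ?n = "norm (\<mu> + sqrt v *\<^sub>R \<xi> - z)"
    have "?n \<le> norm \<mu> + norm (sqrt v *\<^sub>R \<xi>) + norm z"
      using norm_triangle_ineq4[of "\<mu> + sqrt v *\<^sub>R \<xi>" z] norm_triangle_ineq[of \<mu> "sqrt v *\<^sub>R \<xi>"] by linarith
    then have "?n \<le> (\<beta> + norm z) + sqrt v * norm \<xi>" using mu v by simp
    then have "(k + 1) * ?n \<le> (k + 1) * ((\<beta> + norm z) + sqrt v * norm \<xi>)"
      using k by (intro mult_left_mono) auto
    have "?n * exp (k * ?n) \<le> exp ?n * exp (k * ?n)"
      by (intro mult_right_mono le_exp_self) auto
    also have "\<dots> = exp ((k + 1) * ?n)" by (simp add: exp_add[symmetric] algebra_simps)
    also have "\<dots> \<le> exp ((k + 1) * ((\<beta> + norm z) + sqrt v * norm \<xi>))"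
      using \<open>(k + 1) * ?n \<le> _\<close> by simp
    also have "\<dots> = exp ((k + 1) * (\<beta> + norm z)) * exp (((k + 1) * sqrt v) * norm \<xi>)"
      by (simp add: exp_add[symmetric] algebra_simps)
    finally show ?thesis .
  qed
  have ib: "integrable (gaussian (0::'a) 1)
      (\<lambda>\<xi>. exp ((k + 1) * (\<beta> + norm z)) * exp (((k + 1) * sqrt v) * norm \<xi>))"
    by (intro integrable_mult_right integrable_exp_norm_gaussian)
  have ih: "integrable (gaussian 0 1) (\<lambda>\<xi>. ?h (\<mu> + sqrt v *\<^sub>R \<xi>))"
    by (rule Bochner_Integration.integrable_bound[OF ib]) (use bd in \<open>auto simp: abs_mult\<close>)
  show "integrable (gaussian \<mu> v) ?h"
    unfolding gaussian_eq_distr_std[OF v, of \<mu>] by (subst integrable_distr_eq) (auto intro: ih)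
  have "(\<integral>x. ?h x \<partial>gaussian \<mu> v) = (\<integral>\<xi>. ?h (\<mu> + sqrt v *\<^sub>R \<xi>) \<partial>gaussian 0 1)"
    unfolding gaussian_eq_distr_std[OF v, of \<mu>] by (subst integral_distr) auto
  also have "\<dots> \<le> (\<integral>\<xi>. exp ((k + 1) * (\<beta> + norm z)) * exp (((k + 1) * sqrt v) * norm \<xi>) \<partial>gaussian (0::'a) 1)"
    by (rule integral_mono[OF ih ib bd])
  finally show "(\<integral>x. ?h x \<partial>gaussian \<mu> v)
      \<le> exp ((k + 1) * (\<beta> + norm z)) * (\<integral>\<xi>. exp (((k + 1) * sqrt v) * norm \<xi>) \<partial>gaussian (0::'a) 1)"
    by simp
qed

lemma integrable_gaussian_id:
  assumes "v > 0" shows "integrable (gaussian (\<mu>::'a::euclidean_space) v) (\<lambda>x. x)"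
proof -
  have "integrable (gaussian \<mu> v) (\<lambda>x. norm (x - 0) * exp (0 * norm (x - 0)))"
    by (rule gaussian_exp_moment(1)[OF assms order_refl order_refl])
  then show ?thesis by (subst integrable_norm_iff[symmetric]) auto
qed

text \<open>With equal covariances the quadratic terms cancel and the density ratio is the
  exponential of an affine function. Moving the origin \<open>z\<close> changes only the constant;
  the choice \<open>z = xs\<close> makes the exponent small exactly where the weight
  concentrates.\<close>

lemma gaussian_tilt:
  fixes \<mu>1 \<mu>2 z :: "'a::euclidean_space"
  assumes v: "v > 0"
  obtains C where "C > 0"
    "gaussian \<mu>2 v = density (gaussian \<mu>1 v) (\<lambda>x. ennreal (C * exp ((x - z) \<bullet> (\<mu>2 - \<mu>1) / v)))"
proof
  define C where "C = exp (((norm (\<mu>1 - z))\<^sup>2 - (norm (\<mu>2 - z))\<^sup>2) / (2 * v))"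
  show "C > 0" by (simp add: C_def)
  have "gauss_pdf \<mu>2 v x = gauss_pdf \<mu>1 v x * (C * exp ((x - z) \<bullet> (\<mu>2 - \<mu>1) / v))" for x
  proof -
    have "(norm ((x - z) - (\<mu>2 - z)))\<^sup>2 = (norm ((x - z) - (\<mu>1 - z)))\<^sup>2
        - 2 * ((x - z) \<bullet> ((\<mu>2 - z) - (\<mu>1 - z))) + (norm (\<mu>2 - z))\<^sup>2 - (norm (\<mu>1 - z))\<^sup>2"
      unfolding power2_norm_eq_inner
      by (simp only: inner_diff_left inner_diff_right inner_commute[of "\<mu>2 - z" "x - z"]
          inner_commute[of "\<mu>1 - z" "x - z"] inner_commute) simp
    then have "- (norm (x - \<mu>2))\<^sup>2 = - (norm (x - \<mu>1))\<^sup>2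
        + (((norm (\<mu>1 - z))\<^sup>2 - (norm (\<mu>2 - z))\<^sup>2) + 2 * ((x - z) \<bullet> (\<mu>2 - \<mu>1)))"
      by simp
    then have "- (norm (x - \<mu>2))\<^sup>2 / (2 * v) = - (norm (x - \<mu>1))\<^sup>2 / (2 * v)
        + (((norm (\<mu>1 - z))\<^sup>2 - (norm (\<mu>2 - z))\<^sup>2) / (2 * v) + 2 * ((x - z) \<bullet> (\<mu>2 - \<mu>1)) / (2 * v))"
      by (simp only: add_divide_distrib)
    then have "- (norm (x - \<mu>2))\<^sup>2 / (2 * v) = - (norm (x - \<mu>1))\<^sup>2 / (2 * v)
        + (((norm (\<mu>1 - z))\<^sup>2 - (norm (\<mu>2 - z))\<^sup>2) / (2 * v) + (x - z) \<bullet> (\<mu>2 - \<mu>1) / v)"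
      by simp
    then have "exp (- (norm (x - \<mu>2))\<^sup>2 / (2 * v)) = exp (- (norm (x - \<mu>1))\<^sup>2 / (2 * v))
        * (exp (((norm (\<mu>1 - z))\<^sup>2 - (norm (\<mu>2 - z))\<^sup>2) / (2 * v)) * exp ((x - z) \<bullet> (\<mu>2 - \<mu>1) / v))"
      by (simp only: exp_add)
    then show ?thesis
      unfolding gauss_pdf_def C_def by (simp only: mult.assoc)
  qed
  moreover have "density (gaussian \<mu>1 v) (\<lambda>x. ennreal (C * exp ((x - z) \<bullet> (\<mu>2 - \<mu>1) / v)))
      = density lborel (\<lambda>x. ennreal (gauss_pdf \<mu>1 v x) * ennreal (C * exp ((x - z) \<bullet> (\<mu>2 - \<mu>1) / v)))"
    unfolding gaussian_eq_density[OF v] by (rule density_density_eq) measurable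
  ultimately show "gaussian \<mu>2 v = density (gaussian \<mu>1 v) (\<lambda>x. ennreal (C * exp ((x - z) \<bullet> (\<mu>2 - \<mu>1) / v)))"
    using v by (simp add: gaussian_eq_density ennreal_mult C_def gauss_pdf_pos less_imp_le)
qed

lemma abs_exp_minus_one_le: "\<bar>exp y - 1\<bar> \<le> \<bar>y\<bar> * exp \<bar>y\<bar>" for y :: real
proof -
  have "1 - exp (- \<bar>y\<bar>) \<le> \<bar>y\<bar>" using exp_ge_add_one_self[of "- \<bar>y\<bar>"] by linarith
  then have "(1 - exp (- \<bar>y\<bar>)) * exp \<bar>y\<bar> \<le> \<bar>y\<bar> * exp \<bar>y\<bar>" by (rule mult_right_mono) simp
  then have *: "exp \<bar>y\<bar> - 1 \<le> \<bar>y\<bar> * exp \<bar>y\<bar>" by (simp add: left_diff_distrib exp_add[symmetric])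
  show ?thesis
  proof (cases "y \<ge> 0")
    case True then show ?thesis using * by simp
  next
    case False
    then have "1 - exp y \<le> \<bar>y\<bar>" using \<open>1 - exp (- \<bar>y\<bar>) \<le> \<bar>y\<bar>\<close> by simp
    also have "\<dots> \<le> \<bar>y\<bar> * exp \<bar>y\<bar>" by (simp add: mult_le_cancel_left1)
    finally show ?thesis using False by simp
  qed
qed

context consensus_objective
begin

lemma gaussian_laplace:
  assumes v: "v > 0" and k: "k \<ge> 0" and theta: "\<theta> > 0"
  shows "\<forall>\<^sub>F \<alpha> in at_top. \<forall>\<mu>\<in>cball 0 \<beta>. (\<integral>x. wt \<alpha> x * (norm (x - xs) * exp (k * norm (x - xs))) \<partial>gaussian \<mu> v)
    \<le> \<theta> * (\<integral>x. wt \<alpha> x \<partial>gaussian \<mu> v)"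
proof -
  have "\<forall>\<^sub>F \<alpha> in at_top. \<forall>\<rho>\<in>(\<lambda>\<mu>. gaussian \<mu> v) ` cball 0 \<beta>.
    (\<integral>x. wt \<alpha> x * (norm (x - xs) * exp (k * norm (x - xs))) \<partial>\<rho>) \<le> \<theta> * (\<integral>x. wt \<alpha> x \<partial>\<rho>)"
  proof (rule laplace_uniform[OF _ _ _ _ _ theta])
    fix \<epsilon> :: real assume e: "\<epsilon> > 0"
    have g: "prob_space (gaussian (0::'a) 1)" "sets (gaussian (0::'a) 1) = sets borel"
      by (auto intro: prob_space_gaussian)
    have "sqrt v > 0" using v by simp
    from noised_ball_mass[OF g this order_refl e, of \<beta> xs]
    obtain p where p: "p > 0" "\<And>b q c. norm b \<le> \<beta> \<Longrightarrow> 0 \<le> q \<Longrightarrow> q \<le> 1 \<Longrightarrow> sqrt v \<le> c \<Longrightarrow> c \<le> sqrt v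
        \<Longrightarrow> p \<le> measure (noised (gaussian 0 1) b q c) (cball xs \<epsilon>)" by blast
    have "p \<le> measure (gaussian \<mu> v) (cball xs \<epsilon>)" if "\<mu> \<in> cball 0 \<beta>" for \<mu>
      using p(2)[of \<mu> 0 "sqrt v"] that gaussian_eq_noised[OF v g, of \<mu>] by simp
    then show "\<exists>p>0. \<forall>\<rho>\<in>(\<lambda>\<mu>. gaussian \<mu> v) ` cball 0 \<beta>. p \<le> measure \<rho> (cball xs \<epsilon>)"
      using p(1) by auto
  next
    show "((\<lambda>x. norm (x - xs) * exp (k * norm (x - xs))) \<longlongrightarrow> 0) (nhds xs)"
    proof -
      have "((\<lambda>x. norm (x - xs) * exp (k * norm (x - xs))) \<longlongrightarrow> norm (xs - xs) * exp (k * norm (xs - xs))) (nhds xs)"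
        by (intro tendsto_intros filterlim_ident)
      then show ?thesis by simp
    qed
  qed (use v k in \<open>auto intro: prob_space_gaussian gaussian_exp_moment\<close>)
  then show ?thesis by simp
qed

text \<open>Both consensus points are written as integrals against the first Gaussian
  \<open>P\<close>, the second one with the tilt \<open>C * exp (y x)\<close>. Centring the
  numerator at \<open>T \<mu>1\<close> makes its untilted part vanish, so the tilt enters as
  \<open>exp (y x) - 1\<close>, which is of order \<open>norm h * norm (x - xs)\<close>. Laplace's
  principle makes the weighted integral of this small relative to \<open>D\<close>; the constant
  \<open>C\<close> cancels against the denominator.\<close>

lemma gaussian_consensus_contraction:
  assumes v: "v > 0" and beta: "\<beta> > 0" and kappa: "\<kappa> > 0"
  shows "\<forall>\<^sub>F \<alpha> in at_top. \<forall>\<mu>1\<in>cball 0 \<beta>. \<forall>\<mu>2\<in>cball 0 \<beta>.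
    norm (consensus_point f \<alpha> (gaussian \<mu>1 v) - xs) \<le> \<kappa> \<and>
    norm (consensus_point f \<alpha> (gaussian \<mu>2 v) - consensus_point f \<alpha> (gaussian \<mu>1 v)) \<le> \<kappa> * norm (\<mu>2 - \<mu>1)"
proof -
  \<comment> \<open>A bound for \<open>norm h / v\<close>, as two points of
    \<open>cball 0 \<beta>\<close> are at most \<open>2 * \<beta>\<close> apart.\<close>
  define k where "k = 2 * \<beta> / v"
  \<comment> \<open>The bounds serve, in this order, the final Lipschitz constant
    \<open>2 * \<theta> / v\<close>, the estimate \<open>norm (T \<mu>1 - xs) \<le> 1\<close> in the
    numerator, the first claim of the statement, and \<open>\<theta> * k \<le> 1 / 2\<close> in the
    denominator.\<close>
  define \<theta> where "\<theta> = min (min (\<kappa> * v / 2) (min 1 \<kappa>)) (v / (4 * \<beta>))"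
  have k: "k \<ge> 0" using beta v by (simp add: k_def)
  have th: "\<theta> > 0" "\<theta> \<le> \<kappa>" "\<theta> \<le> 1" "\<theta> * k \<le> 1 / 2" "2 * \<theta> / v \<le> \<kappa>"
  proof -
    show "\<theta> > 0" using v beta kappa by (simp add: \<theta>_def)
    show "\<theta> \<le> \<kappa>" "\<theta> \<le> 1" by (auto simp: \<theta>_def)
    have "\<theta> \<le> v / (4 * \<beta>)" "\<theta> \<le> \<kappa> * v / 2" by (auto simp: \<theta>_def)
    then show "\<theta> * k \<le> 1 / 2" "2 * \<theta> / v \<le> \<kappa>" using v beta by (auto simp: k_def field_simps)
  qed
  have k1: "k + 1 \<ge> 0" using k by simp
  show ?thesis
    using gaussian_laplace[OF v k1 th(1), of \<beta>] eventually_ge_at_top[of 0]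
  proof eventually_elim
    case (elim \<alpha>)
    show ?case
    proof (intro ballI)
      fix \<mu>1 \<mu>2 :: 'a assume mu: "\<mu>1 \<in> cball 0 \<beta>" "\<mu>2 \<in> cball 0 \<beta>"
      define T where "T \<mu> = consensus_point f \<alpha> (gaussian \<mu> v)" for \<mu> :: 'a
      define P where "P = gaussian \<mu>1 v"
      \<comment> \<open>In the exponent, \<open>k\<close> accounts for the tilt and the additional 1
        for the factor \<open>norm (x - T \<mu>1) \<le> exp (norm (x - xs))\<close>.\<close>
      define \<psi> where "\<psi> x = norm (x - xs) * exp ((k + 1) * norm (x - xs))" for x
      define h where "h = \<mu>2 - \<mu>1"
      define y where "y x = (x - xs) \<bullet> h / v" for x
      define D where "D = (\<integral>x. wt \<alpha> x \<partial>P)"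
      define D2 where "D2 = (\<integral>x. wt \<alpha> x \<partial>gaussian \<mu>2 v)"
      have ps: "prob_space P" "prob_space (gaussian \<mu>2 v)" using v by (auto simp: P_def prob_space_gaussian)
      interpret P: prob_space P by (rule ps(1))
      interpret P2: prob_space "gaussian \<mu>2 v" by (rule ps(2))
      have sP [measurable_cong]: "sets P = sets borel" by (simp add: P_def)
      have idP: "integrable P (\<lambda>x. x)" "integrable (gaussian \<mu>2 v) (\<lambda>x. x)"
        using v by (auto simp: P_def integrable_gaussian_id)
      have Dpos: "D > 0" "D2 > 0"
        unfolding D_def D2_def by (rule integral_wt_pos[OF elim(2)]; simp add: sP ps)+
      have psi: "integrable P \<psi>"
        unfolding P_def \<psi>_def by (rule gaussian_exp_moment(1)[OF v order_refl]) (use k in simp)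
      have iwpsi: "integrable P (\<lambda>x. wt \<alpha> x * \<psi> x)"
        using integrable_wt_times[OF elim(2) sP psi] by simp
      have lap: "(\<integral>x. wt \<alpha> x * \<psi> x \<partial>P) \<le> \<theta> * D"
        using elim(1) k mu unfolding P_def D_def \<psi>_def by blast
      have near: "norm (T \<mu>1 - xs) \<le> \<theta>"
        unfolding T_def P_def[symmetric]
      proof (rule consensus_point_dist_le[OF elim(2) sP ps(1) idP(1)])
        have "(\<integral>x. wt \<alpha> x * norm (x - xs) \<partial>P) \<le> (\<integral>x. wt \<alpha> x * \<psi> x \<partial>P)"
        proof (rule integral_mono[OF _ iwpsi])
          have "integrable P (\<lambda>x. wt \<alpha> x *\<^sub>R norm (x - xs))"
            by (intro integrable_wt_times elim(2) sP integrable_norm Bochner_Integration.integrable_diff idP) simp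
          then show "integrable P (\<lambda>x. wt \<alpha> x * norm (x - xs))" by simp
          have "norm (x - xs) * 1 \<le> \<psi> x" for x
            unfolding \<psi>_def by (intro mult_left_mono) (use k in auto)
          then show "wt \<alpha> x * norm (x - xs) \<le> wt \<alpha> x * \<psi> x" for x
            by (intro mult_left_mono less_imp_le[OF wt_pos]) simp
        qed
        then show "(\<integral>x. wt \<alpha> x * norm (x - xs) \<partial>P) \<le> \<theta> * (\<integral>x. wt \<alpha> x \<partial>P)"
          using lap by (simp add: D_def)
      qed
      have hn: "norm h \<le> 2 * \<beta>"
        using mu norm_triangle_ineq4[of \<mu>2 \<mu>1] by (simp add: h_def)
      have yb: "\<bar>y x\<bar> \<le> norm (x - xs) * (norm h / v)" "\<bar>y x\<bar> \<le> k * norm (x - xs)" for x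
      proof -
        have "\<bar>y x\<bar> = \<bar>(x - xs) \<bullet> h\<bar> / v" using v by (simp add: y_def)
        also have "\<dots> \<le> norm (x - xs) * norm h / v"
          using v by (intro divide_right_mono Cauchy_Schwarz_ineq2) auto
        finally show 1: "\<bar>y x\<bar> \<le> norm (x - xs) * (norm h / v)" by simp
        have "norm (x - xs) * (norm h / v) \<le> norm (x - xs) * k"
          unfolding k_def using hn v by (intro mult_left_mono divide_right_mono) auto
        then show "\<bar>y x\<bar> \<le> k * norm (x - xs)" using 1 by (simp add: mult.commute)
      qed
      obtain C where C: "C > 0" "gaussian \<mu>2 v = density P (\<lambda>x. ennreal (C * exp (y x)))"
        using gaussian_tilt[OF v, of \<mu>2 \<mu>1 xs] unfolding P_def y_def h_def by blast
      have [measurable]: "y \<in> borel_measurable borel" unfolding y_def by measurable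
      have dens: "integrable (gaussian \<mu>2 v) g \<longleftrightarrow> integrable P (\<lambda>x. (C * exp (y x)) *\<^sub>R g x)"
          "(\<integral>x. g x \<partial>gaussian \<mu>2 v) = (\<integral>x. (C * exp (y x)) *\<^sub>R g x \<partial>P)"
        if [measurable]: "g \<in> borel_measurable borel" for g :: "'a \<Rightarrow> 'b::{banach, second_countable_topology}"
        unfolding C(2) using C(1)
        by (subst integrable_density integral_density; simp add: less_imp_le)+
      let ?g = "\<lambda>x. wt \<alpha> x *\<^sub>R (x - T \<mu>1)"
      have ig: "integrable P ?g" "integrable (gaussian \<mu>2 v) ?g"
        by (intro integrable_wt_times elim(2) Bochner_Integration.integrable_diff idP; simp add: sP)+
      have g0: "(\<integral>x. ?g x \<partial>P) = 0"
        using integral_wt_centered[OF elim(2) sP ps(1) idP(1), of "T \<mu>1"] by (simp add: T_def P_def)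
      have ieg: "integrable P (\<lambda>x. exp (y x) *\<^sub>R ?g x)"
      proof -
        have "integrable P (\<lambda>x. (1 / C) *\<^sub>R ((C * exp (y x)) *\<^sub>R ?g x))"
          using ig(2) by (intro integrable_scaleR_right) (simp add: dens(1))
        then show ?thesis using C(1) by simp
      qed
      have iew: "integrable P (\<lambda>x. exp (y x) * wt \<alpha> x)"
      proof -
        have "integrable (gaussian \<mu>2 v) (wt \<alpha>)" by (rule integrable_wt[OF elim(2) _ ps(2)]) simp
        then have "integrable P (\<lambda>x. (1 / C) * ((C * exp (y x)) * wt \<alpha> x))"
          by (intro integrable_mult_right) (simp add: dens(1))
        then show ?thesis using C(1) by simp
      qed
      have "D2 *\<^sub>R (T \<mu>2 - T \<mu>1) = (\<integral>x. ?g x \<partial>gaussian \<mu>2 v)"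
        unfolding D2_def T_def[of \<mu>2]
        by (rule integral_wt_centered[symmetric, OF elim(2) _ ps(2) idP(2)]) simp
      also have "\<dots> = C *\<^sub>R (\<integral>x. exp (y x) *\<^sub>R ?g x \<partial>P)"
        by (subst dens(2)) (simp_all add: scaleR_scaleR[symmetric] del: scaleR_scaleR)
      also have "(\<integral>x. exp (y x) *\<^sub>R ?g x \<partial>P) = (\<integral>x. (exp (y x) - 1) *\<^sub>R ?g x \<partial>P)"
        using ieg ig(1) g0 by (simp add: scaleR_diff_left del: scaleR_scaleR)
      finally have "norm (D2 *\<^sub>R (T \<mu>2 - T \<mu>1)) = norm (C *\<^sub>R (\<integral>x. (exp (y x) - 1) *\<^sub>R ?g x \<partial>P))"
        by (rule arg_cong)
      then have num_eq: "D2 * norm (T \<mu>2 - T \<mu>1) = C * norm (\<integral>x. (exp (y x) - 1) *\<^sub>R ?g x \<partial>P)"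
        using Dpos C(1) by (simp only: norm_scaleR abs_of_pos)
      have "norm (\<integral>x. (exp (y x) - 1) *\<^sub>R ?g x \<partial>P) \<le> (\<integral>x. norm h / v * (wt \<alpha> x * \<psi> x) \<partial>P)"
      proof (rule order_trans[OF integral_norm_bound integral_mono[OF integrable_norm]])
        show "integrable P (\<lambda>x. (exp (y x) - 1) *\<^sub>R ?g x)"
          using ieg ig(1) by (simp add: scaleR_diff_left del: scaleR_scaleR)
        show "integrable P (\<lambda>x. norm h / v * (wt \<alpha> x * \<psi> x))" by (intro integrable_mult_right iwpsi)
        fix x
        let ?n = "norm (x - xs)"
        have 1: "\<bar>exp (y x) - 1\<bar> \<le> (?n * (norm h / v)) * exp (k * ?n)"
          by (rule order_trans[OF abs_exp_minus_one_le]) (intro mult_mono yb, use yb v in auto)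
        have "norm (x - T \<mu>1) \<le> ?n + norm (T \<mu>1 - xs)"
          using norm_triangle_ineq4[of "x - xs" "T \<mu>1 - xs"] by simp
        also have "\<dots> \<le> exp ?n"
          using near th(3) exp_ge_add_one_self[of ?n] by linarith
        finally have 2: "norm (x - T \<mu>1) \<le> exp ?n" .
        have "norm ((exp (y x) - 1) *\<^sub>R ?g x) = wt \<alpha> x * (\<bar>exp (y x) - 1\<bar> * norm (x - T \<mu>1))"
          using wt_pos[of \<alpha> x] by (simp add: abs_mult)
        also have "\<dots> \<le> wt \<alpha> x * ((?n * (norm h / v)) * exp (k * ?n) * exp ?n)"
          using v by (intro mult_left_mono mult_mono 1 2 less_imp_le[OF wt_pos]) auto
        also have "\<dots> = norm h / v * (wt \<alpha> x * \<psi> x)"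
          by (simp add: \<psi>_def exp_add algebra_simps)
        finally show "norm ((exp (y x) - 1) *\<^sub>R ?g x) \<le> norm h / v * (wt \<alpha> x * \<psi> x)" .
      qed
      also have "(\<integral>x. norm h / v * (wt \<alpha> x * \<psi> x) \<partial>P) \<le> norm h / v * (\<theta> * D)"
      proof -
        have "norm h / v * (\<integral>x. wt \<alpha> x * \<psi> x \<partial>P) \<le> norm h / v * (\<theta> * D)"
          using lap v by (intro mult_left_mono) auto
        then show ?thesis by (simp only: integral_mult_right_zero)
      qed
      finally have num: "D2 * norm (T \<mu>2 - T \<mu>1) \<le> C * (norm h / v * (\<theta> * D))"
        unfolding num_eq using C(1) by (intro mult_left_mono) auto
      \<comment> \<open>By \<open>exp (y x) \<ge> 1 + y x\<close>, the linear term integrates to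
        \<open>D\<close> times the inner product of \<open>T \<mu>1 - xs\<close> with
        \<open>h /\<^sub>R v\<close>, whose absolute value is at most \<open>\<theta> * k\<close>,
        hence at most 1/2.\<close>
      have den: "C * (D / 2) \<le> D2"
      proof -
        have iwy: "integrable P (\<lambda>x. wt \<alpha> x *\<^sub>R (x - xs))"
          by (intro integrable_wt_times elim(2) sP Bochner_Integration.integrable_diff idP) simp
        have iw: "integrable P (wt \<alpha>)" by (rule integrable_wt[OF elim(2) sP ps(1)])
        have "(\<integral>x. wt \<alpha> x + (wt \<alpha> x *\<^sub>R (x - xs)) \<bullet> (h /\<^sub>R v) \<partial>P) = D + (D *\<^sub>R (T \<mu>1 - xs)) \<bullet> (h /\<^sub>R v)"
        proof -
          have "(\<integral>x. wt \<alpha> x + (wt \<alpha> x *\<^sub>R (x - xs)) \<bullet> (h /\<^sub>R v) \<partial>P)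
              = D + (\<integral>x. (wt \<alpha> x *\<^sub>R (x - xs)) \<bullet> (h /\<^sub>R v) \<partial>P)"
            unfolding D_def by (intro Bochner_Integration.integral_add iw integrable_inner_left iwy)
          also have "(\<integral>x. (wt \<alpha> x *\<^sub>R (x - xs)) \<bullet> (h /\<^sub>R v) \<partial>P)
              = (\<integral>x. wt \<alpha> x *\<^sub>R (x - xs) \<partial>P) \<bullet> (h /\<^sub>R v)"
            by (intro integral_inner_left iwy)
          also have "(\<integral>x. wt \<alpha> x *\<^sub>R (x - xs) \<partial>P) = D *\<^sub>R (T \<mu>1 - xs)"
            unfolding D_def T_def P_def[symmetric] by (rule integral_wt_centered[OF elim(2) sP ps(1) idP(1)])
          finally show ?thesis .
        qed
        moreover have "(\<integral>x. wt \<alpha> x + (wt \<alpha> x *\<^sub>R (x - xs)) \<bullet> (h /\<^sub>R v) \<partial>P) \<le> (\<integral>x. exp (y x) * wt \<alpha> x \<partial>P)"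
        proof (rule integral_mono[OF _ iew])
          show "integrable P (\<lambda>x. wt \<alpha> x + (wt \<alpha> x *\<^sub>R (x - xs)) \<bullet> (h /\<^sub>R v))"
            using iw iwy by (intro Bochner_Integration.integrable_add integrable_inner_left) auto
          fix x
          have "wt \<alpha> x + (wt \<alpha> x *\<^sub>R (x - xs)) \<bullet> (h /\<^sub>R v) = (1 + y x) * wt \<alpha> x"
            by (simp add: y_def distrib_left distrib_right divide_inverse mult.commute mult.left_commute)
          also have "\<dots> \<le> exp (y x) * wt \<alpha> x"
            by (intro mult_right_mono exp_ge_add_one_self less_imp_le[OF wt_pos])
          finally show "wt \<alpha> x + (wt \<alpha> x *\<^sub>R (x - xs)) \<bullet> (h /\<^sub>R v) \<le> exp (y x) * wt \<alpha> x" .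
        qed
        moreover have "D2 = C * (\<integral>x. exp (y x) * wt \<alpha> x \<partial>P)"
          unfolding D2_def by (subst dens(2)) (simp_all add: mult.assoc)
        moreover have "D / 2 \<le> D + (D *\<^sub>R (T \<mu>1 - xs)) \<bullet> (h /\<^sub>R v)"
        proof -
          have "(T \<mu>1 - xs) \<bullet> (h /\<^sub>R v) \<ge> - \<theta> * k"
          proof -
            have "\<bar>(T \<mu>1 - xs) \<bullet> (h /\<^sub>R v)\<bar> \<le> norm (T \<mu>1 - xs) * norm (h /\<^sub>R v)"
              by (rule Cauchy_Schwarz_ineq2)
            also have "\<dots> \<le> \<theta> * k"
            proof (intro mult_mono near)
              show "norm (h /\<^sub>R v) \<le> k" using hn v by (simp add: k_def field_simps)
            qed (use th in auto)
            finally show ?thesis by simp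
          qed
          then have "D * ((T \<mu>1 - xs) \<bullet> (h /\<^sub>R v)) \<ge> D * (- 1 / 2)"
            using th(4) Dpos by (intro mult_left_mono) auto
          then show ?thesis unfolding inner_scaleR_left by linarith
        qed
        ultimately show ?thesis using C(1) by (auto intro!: mult_left_mono)
      qed
      have "C * (D / 2) * norm (T \<mu>2 - T \<mu>1) \<le> C * (norm h / v * (\<theta> * D))"
        by (rule order_trans[OF mult_right_mono[OF den norm_ge_zero] num])
      then have "(C * D / 2) * norm (T \<mu>2 - T \<mu>1) \<le> (C * D / 2) * (2 * \<theta> / v * norm h)"
        using v by (simp add: field_simps)
      then have "norm (T \<mu>2 - T \<mu>1) \<le> 2 * \<theta> / v * norm h"
        using C(1) Dpos(1) by (simp only: mult_le_cancel_left_pos mult_pos_pos half_gt_zero)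
      also have "\<dots> \<le> \<kappa> * norm h" using th by (intro mult_right_mono) auto
      finally show "norm (consensus_point f \<alpha> (gaussian \<mu>1 v) - xs) \<le> \<kappa> \<and>
        norm (consensus_point f \<alpha> (gaussian \<mu>2 v) - consensus_point f \<alpha> (gaussian \<mu>1 v)) \<le> \<kappa> * norm (\<mu>2 - \<mu>1)"
        using near th by (simp add: T_def h_def)
    qed
  qed
qed

end

subsection \<open>Synchronous coupling\<close>

context consensus_objective
begin

text \<open>Quadratic growth of \<open>f\<close> makes the weight decay like a Gaussian. The power 2
  is what \<open>wt_lipschitz\<close> requires: one factor for the linearly growing Lipschitz
  modulus of \<open>f\<close>, one for the factor \<open>x\<close> in the numerator of the consensus
  point.\<close>

lemma wt_growth:
  assumes a: "\<alpha> > 0"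
  obtains G where "G > 0" "\<And>x. (1 + norm x)\<^sup>2 * wt \<alpha> x \<le> G"
proof
  define G where "G = 2 * wt \<alpha> xs * (1 + 1 / (\<alpha> * cl)) + (1 + R)\<^sup>2 * wt \<alpha> xs"
  have ac: "\<alpha> * cl > 0" using a cl_pos by simp
  have parts: "0 < 2 * wt \<alpha> xs * (1 + 1 / (\<alpha> * cl))" "0 \<le> (1 + R)\<^sup>2 * wt \<alpha> xs"
    using ac wt_pos[of \<alpha> xs] by (auto intro!: mult_pos_pos add_pos_pos)
  then show "G > 0" by (simp add: G_def)
  fix x
  have le: "wt \<alpha> x \<le> wt \<alpha> xs" using a by (intro wt_le) simp
  show "(1 + norm x)\<^sup>2 * wt \<alpha> x \<le> G"
  proof (cases "norm x \<ge> R")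
    case False
    then have "(1 + norm x)\<^sup>2 * wt \<alpha> x \<le> (1 + R)\<^sup>2 * wt \<alpha> xs"
      using wt_pos[of \<alpha> x] by (intro mult_mono power_mono le) auto
    then show ?thesis using parts by (simp add: G_def)
  next
    case True
    let ?y = "\<alpha> * cl * (norm x)\<^sup>2"
    have y: "?y \<ge> 0" using ac by simp
    have "\<alpha> * (f xs + cl * (norm x)\<^sup>2) \<le> \<alpha> * f x"
      using f_lower[OF True] a by (intro mult_left_mono) auto
    then have "wt \<alpha> x \<le> exp (- \<alpha> * f xs - ?y)"
      by (simp add: wt_def algebra_simps)
    then have w: "wt \<alpha> x \<le> wt \<alpha> xs * exp (- ?y)" by (simp add: wt_def exp_diff exp_minus divide_inverse)
    have "(1 + norm x)\<^sup>2 \<le> 2 * (1 + (norm x)\<^sup>2)"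
      using sum_squares_bound[of 1 "norm x"] by (simp add: power2_eq_square algebra_simps)
    also have "(norm x)\<^sup>2 = ?y / (\<alpha> * cl)" using a cl_pos by simp
    finally have "(1 + norm x)\<^sup>2 * wt \<alpha> x \<le> (2 * (1 + ?y / (\<alpha> * cl))) * (wt \<alpha> xs * exp (- ?y))"
      using wt_pos[of \<alpha> x] y ac by (intro mult_mono w) auto
    also have "\<dots> = 2 * wt \<alpha> xs * (exp (- ?y) + (?y * exp (- ?y)) / (\<alpha> * cl))"
      by (simp add: algebra_simps)
    also have "\<dots> \<le> 2 * wt \<alpha> xs * (1 + 1 / (\<alpha> * cl))"
    proof (intro mult_left_mono add_mono divide_right_mono)
      show "exp (- ?y) \<le> 1" using y by simp
      have "?y * exp (- ?y) \<le> exp ?y * exp (- ?y)" by (intro mult_right_mono le_exp_self) simp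
      then show "?y * exp (- ?y) \<le> 1" by (simp add: exp_minus)
    qed (use ac wt_pos[of \<alpha> xs] in auto)
    finally show ?thesis using parts by (simp add: G_def)
  qed
qed

text \<open>By symmetry let \<open>f x \<le> f y\<close>, so that \<open>wt \<alpha> x\<close> is
  the larger weight; factoring it out and using \<open>1 - exp (- t) \<le> t\<close> leaves \<alpha>
  times the increment of \<open>f\<close>. For points at distance below 1 the modulus of
  \<open>f\<close> is controlled by \<open>norm x\<close> alone, and the weight at \<open>x\<close>
  absorbs it. For other points the difference is bounded by a constant anyway.\<close>

lemma wt_lipschitz:
  assumes a: "\<alpha> > 0"
  obtains \<Lambda> where "\<Lambda> > 0" "\<And>x y. \<bar>wt \<alpha> x - wt \<alpha> y\<bar> \<le> \<Lambda> * norm (x - y)"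
    "\<And>x y. norm (wt \<alpha> x *\<^sub>R x - wt \<alpha> y *\<^sub>R y) \<le> \<Lambda> * norm (x - y)"
proof -
  obtain G where G: "G > 0" "\<And>x. (1 + norm x)\<^sup>2 * wt \<alpha> x \<le> G" using wt_growth[OF a] by blast
  \<comment> \<open>The first summand bounds the change of the weight; \<open>2 * G\<close> covers
    points at distance at least 1 and also the term
    \<open>wt \<alpha> y *\<^sub>R (x - y)\<close>.\<close>
  define \<Lambda> where "\<Lambda> = 2 * \<alpha> * L * G + 2 * G"
  have ALG: "2 * \<alpha> * L * G > 0" using a L_pos G by simp
  have grow: "wt \<alpha> x \<le> G" "norm x * wt \<alpha> x \<le> G" "(1 + norm x) * wt \<alpha> x \<le> G" "norm x * (1 + norm x) * wt \<alpha> x \<le> G" for x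
  proof -
    have w: "wt \<alpha> x \<ge> 0" using wt_pos[of \<alpha> x] by simp
    have c: "c * wt \<alpha> x \<le> G" if "c \<le> (1 + norm x)\<^sup>2" for c
      using mult_right_mono[OF that w] G(2)[of x] by linarith
    note c
    moreover have "(1 + norm x)\<^sup>2 = 1 + 2 * norm x + norm x * norm x"
      by (simp add: power2_eq_square algebra_simps)
    moreover have "0 \<le> norm x" "0 \<le> norm x * norm x" by auto
    ultimately show "norm x * wt \<alpha> x \<le> G" "(1 + norm x) * wt \<alpha> x \<le> G"
      by auto
    show "norm x * (1 + norm x) * wt \<alpha> x \<le> G"
      by (rule c) (use \<open>0 \<le> norm x\<close> in \<open>simp add: power2_eq_square algebra_simps\<close>)
    show "wt \<alpha> x \<le> G"
      using c[of 1] \<open>0 \<le> norm x\<close> by (simp add: one_le_power)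
  qed
  have main: "\<bar>wt \<alpha> x - wt \<alpha> y\<bar> \<le> \<Lambda> * norm (x - y) \<and>
      norm (wt \<alpha> x *\<^sub>R x - wt \<alpha> y *\<^sub>R y) \<le> \<Lambda> * norm (x - y)" if fxy: "f x \<le> f y" for x y
  proof (cases "norm (x - y) \<ge> 1")
    case True
    have w: "wt \<alpha> x > 0" "wt \<alpha> y > 0" by (auto simp: wt_pos)
    have "2 * G \<le> \<Lambda> * 1" using ALG by (simp add: \<Lambda>_def)
    also have "\<dots> \<le> \<Lambda> * norm (x - y)"
      using True ALG G(1) by (intro mult_left_mono) (auto simp: \<Lambda>_def)
    finally have big: "2 * G \<le> \<Lambda> * norm (x - y)" .
    moreover have "\<bar>wt \<alpha> x - wt \<alpha> y\<bar> \<le> 2 * G" using grow(1)[of x] grow(1)[of y] w by linarith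
    moreover have "norm (wt \<alpha> x *\<^sub>R x - wt \<alpha> y *\<^sub>R y) \<le> 2 * G"
      using norm_triangle_ineq4[of "wt \<alpha> x *\<^sub>R x" "wt \<alpha> y *\<^sub>R y"] grow(2)[of x] grow(2)[of y] w
      by (simp add: mult.commute)
    ultimately show ?thesis by linarith
  next
    case False
    define d where "d = norm (x - y)"
    have d: "0 \<le> d" by (simp add: d_def)
    have wyx: "wt \<alpha> y \<le> wt \<alpha> x" using fxy a by (simp add: wt_def mult_left_mono)
    have wx: "wt \<alpha> x \<ge> 0" "wt \<alpha> y \<ge> 0" using wt_pos[of \<alpha>] by (auto intro: less_imp_le)
    have "norm y \<le> norm x + 1"
      using False norm_triangle_sub[of y x] by (simp add: norm_minus_commute)
    have "1 - exp (- (\<alpha> * (f y - f x))) \<le> \<alpha> * (f y - f x)"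
      using exp_ge_add_one_self[of "- (\<alpha> * (f y - f x))"] by linarith
    also have "\<dots> \<le> \<alpha> * (L * (1 + norm x + norm y) * d)"
      using f_lip[of x y] a by (intro mult_left_mono) (auto simp: d_def)
    also have "\<dots> \<le> \<alpha> * (L * (2 * (1 + norm x)) * d)"
      using a L_pos d \<open>norm y \<le> norm x + 1\<close> by (intro mult_left_mono mult_right_mono) auto
    finally have "wt \<alpha> x * (1 - exp (- (\<alpha> * (f y - f x)))) \<le> wt \<alpha> x * (\<alpha> * (L * (2 * (1 + norm x)) * d))"
      using wx by (intro mult_left_mono) auto
    moreover have "wt \<alpha> x * exp (- (\<alpha> * (f y - f x))) = wt \<alpha> y"
      by (simp add: wt_def exp_add[symmetric] algebra_simps)
    ultimately have dif: "wt \<alpha> x - wt \<alpha> y \<le> 2 * \<alpha> * L * d * ((1 + norm x) * wt \<alpha> x)"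
      by (simp add: algebra_simps)
    have "2 * \<alpha> * L * d * ((1 + norm x) * wt \<alpha> x) \<le> 2 * \<alpha> * L * d * G"
      using a L_pos d by (intro mult_left_mono grow) auto
    with dif have 1: "wt \<alpha> x - wt \<alpha> y \<le> 2 * \<alpha> * L * G * d" by (simp add: mult.commute mult.left_commute)
    have "norm x * (wt \<alpha> x - wt \<alpha> y) \<le> norm x * (2 * \<alpha> * L * d * ((1 + norm x) * wt \<alpha> x))"
      by (intro mult_left_mono dif) simp
    also have "\<dots> = 2 * \<alpha> * L * d * (norm x * (1 + norm x) * wt \<alpha> x)" by (simp add: mult.commute mult.left_commute)
    also have "\<dots> \<le> 2 * \<alpha> * L * d * G"
      using a L_pos d by (intro mult_left_mono grow) auto
    finally have 2: "norm x * (wt \<alpha> x - wt \<alpha> y) \<le> 2 * \<alpha> * L * G * d" by (simp add: mult.commute mult.left_commute)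
    have Ld: "\<Lambda> * d = 2 * \<alpha> * L * G * d + 2 * (G * d)" "0 \<le> G * d"
      using d G(1) by (auto simp: \<Lambda>_def algebra_simps)
    have "\<bar>wt \<alpha> x - wt \<alpha> y\<bar> \<le> \<Lambda> * d" using 1 wyx Ld by linarith
    moreover have "norm (wt \<alpha> x *\<^sub>R x - wt \<alpha> y *\<^sub>R y) \<le> \<Lambda> * d"
    proof -
      have "wt \<alpha> x *\<^sub>R x - wt \<alpha> y *\<^sub>R y = (wt \<alpha> x - wt \<alpha> y) *\<^sub>R x + wt \<alpha> y *\<^sub>R (x - y)"
        by (simp add: algebra_simps)
      then have "norm (wt \<alpha> x *\<^sub>R x - wt \<alpha> y *\<^sub>R y) \<le> norm ((wt \<alpha> x - wt \<alpha> y) *\<^sub>R x) + norm (wt \<alpha> y *\<^sub>R (x - y))"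
        by (metis norm_triangle_ineq)
      also have "\<dots> = norm x * (wt \<alpha> x - wt \<alpha> y) + wt \<alpha> y * d"
        using wyx wx by (simp add: d_def)
      also have "wt \<alpha> y * d \<le> G * d" by (intro mult_right_mono grow d)
      finally show ?thesis using 2 Ld by linarith
    qed
    ultimately show ?thesis by (simp add: d_def)
  qed
  show ?thesis
  proof
    show "\<Lambda> > 0" using ALG G(1) unfolding \<Lambda>_def by linarith
    fix x y
    show "\<bar>wt \<alpha> x - wt \<alpha> y\<bar> \<le> \<Lambda> * norm (x - y)" "norm (wt \<alpha> x *\<^sub>R x - wt \<alpha> y *\<^sub>R y) \<le> \<Lambda> * norm (x - y)"
      using main[of x y] main[of y x] by (cases "f x \<le> f y"; simp add: norm_minus_commute abs_minus_commute)+
  qed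
qed

end

text \<open>The synchronous coupling of \<^term>\<open>ou_law \<nu> v b p\<close> and \<^term>\<open>gaussian \<mu> v\<close>: both are driven by the same
  noise \<open>\<xi>\<close>, and only their initial data \<open>x\<close> and \<open>z\<close> differ.\<close>

abbreviation coupling_space :: "'a::euclidean_space measure \<Rightarrow> ('a \<times> 'a \<times> 'a) measure" where
  "coupling_space \<nu> \<equiv> \<nu> \<Otimes>\<^sub>M (gaussian 0 1 \<Otimes>\<^sub>M gaussian 0 1)"

definition couple_left :: "'a::euclidean_space measure \<Rightarrow> real \<Rightarrow> 'a \<Rightarrow> real \<Rightarrow> 'a \<times> 'a \<times> 'a \<Rightarrow> 'a" where
  "couple_left \<nu> v b p = (\<lambda>(x, z, \<xi>). b - p *\<^sub>R (\<integral>x. x \<partial>\<nu>) + p *\<^sub>R x + sqrt (v * (1 - p\<^sup>2)) *\<^sub>R \<xi>)"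

definition couple_right :: "real \<Rightarrow> 'a::euclidean_space \<Rightarrow> real \<Rightarrow> 'a \<times> 'a \<times> 'a \<Rightarrow> 'a" where
  "couple_right v \<mu> p = (\<lambda>(x, z, \<xi>). \<mu> + ((p * sqrt v) *\<^sub>R z + sqrt (v * (1 - p\<^sup>2)) *\<^sub>R \<xi>))"

text \<open>The common noise cancels. What remains is the difference of the means plus
  \<open>p\<close> times a variable that depends on neither \<open>b\<close>, \<open>\<mu>\<close>
  nor \<open>p\<close>, so a single moment of it serves for all times and all values of
  \<open>s\<close>.\<close>

lemma couple_diff:
  "couple_left \<nu> v b p \<omega> - couple_right v \<mu> p \<omega>
    = (b - \<mu>) + p *\<^sub>R (fst \<omega> - (\<integral>x. x \<partial>\<nu>) - sqrt v *\<^sub>R fst (snd \<omega>))"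
  by (simp add: couple_left_def couple_right_def split_beta' algebra_simps)

lemma prob_space_std_pair: "prob_space (gaussian (0::'a::euclidean_space) 1 \<Otimes>\<^sub>M gaussian (0::'a) 1)"
  by (rule prob_space_pair_std[OF prob_space_gaussian]) simp

lemma prob_space_coupling_space:
  fixes \<nu> :: "'a::euclidean_space measure"
  assumes "prob_space \<nu>"
  shows "prob_space (coupling_space \<nu>)"
proof -
  interpret n: prob_space \<nu> by fact
  interpret g: prob_space "gaussian (0::'a) 1 \<Otimes>\<^sub>M gaussian (0::'a) 1" by (rule prob_space_std_pair)
  interpret pair_prob_space \<nu> "gaussian (0::'a) 1 \<Otimes>\<^sub>M gaussian (0::'a) 1" ..
  show ?thesis by unfold_locales
qed

context
  fixes \<nu> :: "'a::euclidean_space measure" and v :: real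
  assumes nu: "prob_space \<nu>" and s [measurable_cong]: "sets \<nu> = sets borel" and v: "v > 0"
begin

lemma couple_measurable [measurable]:
  "couple_left \<nu> v b p \<in> borel_measurable (coupling_space \<nu>)" "couple_right v \<mu> p \<in> borel_measurable (coupling_space \<nu>)"
  unfolding couple_left_def couple_right_def by measurable

lemma distr_couple_left: "distr (coupling_space \<nu>) borel (couple_left \<nu> v b p) = ou_law \<nu> v b p"
proof (rule measure_eqI)
  interpret g: prob_space "gaussian (0::'a) 1" by (rule prob_space_gaussian) simp
  interpret gg: prob_space "gaussian (0::'a) 1 \<Otimes>\<^sub>M gaussian (0::'a) 1" by (rule prob_space_std_pair)
  fix A assume "A \<in> sets (distr (coupling_space \<nu>) borel (couple_left \<nu> v b p))"
  then have [measurable]: "A \<in> sets borel" by simp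
  define h where "h x = (indicator A (b - p *\<^sub>R (\<integral>x. x \<partial>\<nu>) + p *\<^sub>R fst x + sqrt (v * (1 - p\<^sup>2)) *\<^sub>R snd x) :: ennreal)"
    for x :: "'a \<times> 'a"
  have [measurable]: "h \<in> borel_measurable (borel \<Otimes>\<^sub>M borel)" unfolding h_def by measurable
  have "emeasure (distr (coupling_space \<nu>) borel (couple_left \<nu> v b p)) A
      = (\<integral>\<^sup>+x. indicator A x \<partial>distr (coupling_space \<nu>) borel (couple_left \<nu> v b p))" by simp
  also have "\<dots> = (\<integral>\<^sup>+\<omega>. h (fst \<omega>, snd (snd \<omega>)) \<partial>coupling_space \<nu>)"
    by (subst nn_integral_distr) (auto simp: h_def couple_left_def split_beta')
  also have "\<dots> = (\<integral>\<^sup>+x. \<integral>\<^sup>+y. h (x, snd y) \<partial>(gaussian (0::'a) 1 \<Otimes>\<^sub>M gaussian (0::'a) 1) \<partial>\<nu>)"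
    by (subst gg.nn_integral_fst[symmetric]) auto
  also have "\<dots> = (\<integral>\<^sup>+x. \<integral>\<^sup>+z. \<integral>\<^sup>+\<xi>. h (x, \<xi>) \<partial>gaussian 0 1 \<partial>gaussian (0::'a) 1 \<partial>\<nu>)"
    by (subst g.nn_integral_fst[symmetric]) auto
  also have "\<dots> = (\<integral>\<^sup>+x. indicator A x \<partial>ou_law \<nu> v b p)"
    unfolding ou_law_def by (subst nn_integral_noised[OF s]) (simp_all add: h_def g.emeasure_space_1[simplified])
  finally show "emeasure (distr (coupling_space \<nu>) borel (couple_left \<nu> v b p)) A = emeasure (ou_law \<nu> v b p) A"
    by (simp add: ou_law_def)
qed (simp add: ou_law_def)

text \<open>This is the stationarity of the Gaussian: contracting by \<open>p\<close> and adding
  noise of variance \<open>v * (1 - p\<^sup>2)\<close> restores the variance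
  \<open>v\<close>.\<close>

lemma distr_couple_right:
  assumes p: "0 \<le> p" "p \<le> 1"
  shows "distr (coupling_space \<nu>) borel (couple_right v \<mu> p) = gaussian \<mu> v"
proof -
  let ?gg = "gaussian (0::'a) 1 \<Otimes>\<^sub>M gaussian (0::'a) 1"
  interpret gg: prob_space ?gg by (rule prob_space_std_pair)
  have "v * (1 - p\<^sup>2) \<ge> 0" using v p by (simp add: power_le_one)
  then have c: "(p * sqrt v)\<^sup>2 + (sqrt (v * (1 - p\<^sup>2)))\<^sup>2 = v"
    using v by (simp add: power_mult_distrib algebra_simps)
  have "distr (coupling_space \<nu>) borel (couple_right v \<mu> p)
      = distr (distr (distr (coupling_space \<nu>) ?gg snd) borel (\<lambda>(z, \<xi>). (p * sqrt v) *\<^sub>R z + sqrt (v * (1 - p\<^sup>2)) *\<^sub>R \<xi>)) borel (\<lambda>x. \<mu> + x)"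
    by (simp add: distr_distr comp_def couple_right_def split_beta')
  also have "distr (coupling_space \<nu>) ?gg snd = ?gg" by (rule distr_pair_snd[OF nu gg.sigma_finite_measure_axioms])
  also have "distr (distr ?gg borel (\<lambda>(z, \<xi>). (p * sqrt v) *\<^sub>R z + sqrt (v * (1 - p\<^sup>2)) *\<^sub>R \<xi>)) borel (\<lambda>x. \<mu> + x)
      = distr (gaussian 0 1) borel (\<lambda>x. \<mu> + sqrt v *\<^sub>R x)"
    unfolding gaussian_convolution c by (simp add: distr_distr comp_def)
  also have "\<dots> = gaussian \<mu> v" by (rule gaussian_eq_distr_std[OF v, symmetric])
  finally show ?thesis .
qed

text \<open>The cost of the synchronous coupling bounds the infimum, and \<open>couple_diff\<close>
  gives that cost up to the crude factors from
  \<open>(x + y)\<^sup>2 \<le> 2 * x\<^sup>2 + 2 * y\<^sup>2\<close>.\<close>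

lemma W2_ou_law:
  assumes int2: "integrable \<nu> (\<lambda>x. (norm x)\<^sup>2)" and p: "0 \<le> p" "p \<le> 1"
  shows "W2 (ou_law \<nu> v b p) (gaussian \<mu> v)
    \<le> ennreal (2 * norm (b - \<mu>)
        + 2 * sqrt (\<integral>\<omega>. (norm (fst \<omega> - (\<integral>x. x \<partial>\<nu>) - sqrt v *\<^sub>R fst (snd \<omega>)))\<^sup>2 \<partial>coupling_space \<nu>) * p)"
proof -
  let ?D = "\<lambda>\<omega>::'a \<times> 'a \<times> 'a. fst \<omega> - (\<integral>x. x \<partial>\<nu>) - sqrt v *\<^sub>R fst (snd \<omega>)"
  define m where "m = (\<integral>\<omega>. (norm (?D \<omega>))\<^sup>2 \<partial>coupling_space \<nu>)"
  let ?e = "norm (b - \<mu>)"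
  define K where "K = 2 * ?e\<^sup>2 + 2 * p\<^sup>2 * m"
  interpret t: prob_space "coupling_space \<nu>" by (rule prob_space_coupling_space[OF nu])
  interpret n: prob_space \<nu> by (rule nu)
  interpret g: prob_space "gaussian (0::'a) 1" by (rule prob_space_gaussian) simp
  interpret gg: prob_space "gaussian (0::'a) 1 \<Otimes>\<^sub>M gaussian (0::'a) 1" by (rule prob_space_std_pair)
  have m0: "m \<ge> 0" by (simp add: m_def)
  have sq3: "(norm (x - c - y))\<^sup>2 \<le> 3 * (norm x)\<^sup>2 + 3 * (norm c)\<^sup>2 + 3 * (norm y)\<^sup>2" for x c y :: 'a
  proof -
    have "norm (x - c - y) \<le> norm x + norm c + norm y"
      using norm_triangle_ineq4[of "x - c" y] norm_triangle_ineq4[of x c] by linarith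
    then have "(norm (x - c - y))\<^sup>2 \<le> (norm x + norm c + norm y)\<^sup>2" by (rule power_mono) simp
    also have "\<dots> \<le> 3 * (norm x)\<^sup>2 + 3 * (norm c)\<^sup>2 + 3 * (norm y)\<^sup>2"
      using sum_squares_bound[of "norm x" "norm c"] sum_squares_bound[of "norm x" "norm y"]
        sum_squares_bound[of "norm c" "norm y"]
      by (simp add: power2_eq_square algebra_simps)
    finally show ?thesis .
  qed
  have iD: "integrable (coupling_space \<nu>) (\<lambda>\<omega>. (norm (?D \<omega>))\<^sup>2)"
  proof (rule Bochner_Integration.integrable_bound)
    have i1: "integrable (coupling_space \<nu>) (\<lambda>\<omega>. (norm (fst \<omega>))\<^sup>2)"
      by (rule integrable_pair_fst[OF gg.prob_space_axioms int2])
    have "integrable (gaussian (0::'a) 1 \<Otimes>\<^sub>M gaussian (0::'a) 1) (\<lambda>z. (norm (fst z))\<^sup>2)"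
      by (rule integrable_pair_fst[OF g.prob_space_axioms integrable_norm2_gaussian])
    then have i2: "integrable (coupling_space \<nu>) (\<lambda>\<omega>. (norm (fst (snd \<omega>)))\<^sup>2)"
      by (rule integrable_pair_snd[OF nu gg.sigma_finite_measure_axioms])
    show "integrable (coupling_space \<nu>) (\<lambda>\<omega>. 3 * (norm (fst \<omega>))\<^sup>2 + 3 * (norm (\<integral>x. x \<partial>\<nu>))\<^sup>2 + 3 * (v * (norm (fst (snd \<omega>)))\<^sup>2))"
      by (intro Bochner_Integration.integrable_add integrable_mult_right i1 i2) simp
    have "(norm (?D \<omega>))\<^sup>2 \<le> 3 * (norm (fst \<omega>))\<^sup>2 + 3 * (norm (\<integral>x. x \<partial>\<nu>))\<^sup>2 + 3 * (v * (norm (fst (snd \<omega>)))\<^sup>2)" for \<omega>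
      using sq3[of "fst \<omega>" "\<integral>x. x \<partial>\<nu>" "sqrt v *\<^sub>R fst (snd \<omega>)"] v by (simp add: power_mult_distrib)
    then show "AE \<omega> in coupling_space \<nu>. norm ((norm (?D \<omega>))\<^sup>2)
        \<le> norm (3 * (norm (fst \<omega>))\<^sup>2 + 3 * (norm (\<integral>x. x \<partial>\<nu>))\<^sup>2 + 3 * (v * (norm (fst (snd \<omega>)))\<^sup>2))"
      using v by (auto intro!: AE_I2)
  qed measurable
  define \<pi> where "\<pi> = distr (coupling_space \<nu>) (borel \<Otimes>\<^sub>M borel) (\<lambda>\<omega>. (couple_left \<nu> v b p \<omega>, couple_right v \<mu> p \<omega>))"
  have pi: "\<pi> \<in> couplings (ou_law \<nu> v b p) (gaussian \<mu> v)"
    unfolding couplings_def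
  proof (intro CollectI conjI)
    show "prob_space \<pi>" unfolding \<pi>_def by (rule t.prob_space_distr) measurable
    show "distr \<pi> borel fst = ou_law \<nu> v b p"
      unfolding \<pi>_def by (subst distr_distr) (simp_all add: comp_def distr_couple_left)
    show "distr \<pi> borel snd = gaussian \<mu> v"
      unfolding \<pi>_def by (subst distr_distr) (simp_all add: comp_def distr_couple_right[OF p])
  qed (simp add: \<pi>_def)
  have "(\<integral>\<^sup>+ z. ennreal ((dist (fst z) (snd z))\<^sup>2) \<partial>\<pi>)
      = (\<integral>\<^sup>+ \<omega>. ennreal ((norm (couple_left \<nu> v b p \<omega> - couple_right v \<mu> p \<omega>))\<^sup>2) \<partial>coupling_space \<nu>)"
    unfolding \<pi>_def by (subst nn_integral_distr) (auto simp: dist_norm)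
  also have "\<dots> \<le> (\<integral>\<^sup>+ \<omega>. ennreal (2 * ?e\<^sup>2 + 2 * p\<^sup>2 * (norm (?D \<omega>))\<^sup>2) \<partial>coupling_space \<nu>)"
  proof (intro nn_integral_mono ennreal_leI)
    fix \<omega> :: "'a \<times> 'a \<times> 'a"
    have "norm ((b - \<mu>) + p *\<^sub>R ?D \<omega>) \<le> ?e + p * norm (?D \<omega>)"
      using norm_triangle_ineq[of "b - \<mu>" "p *\<^sub>R ?D \<omega>"] p by simp
    then have "(norm ((b - \<mu>) + p *\<^sub>R ?D \<omega>))\<^sup>2 \<le> (?e + p * norm (?D \<omega>))\<^sup>2" by (rule power_mono) simp
    also have "\<dots> \<le> 2 * ?e\<^sup>2 + 2 * (p * norm (?D \<omega>))\<^sup>2"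
      using sum_squares_bound[of ?e "p * norm (?D \<omega>)"] by (simp add: power2_sum)
    finally show "(norm (couple_left \<nu> v b p \<omega> - couple_right v \<mu> p \<omega>))\<^sup>2 \<le> 2 * ?e\<^sup>2 + 2 * p\<^sup>2 * (norm (?D \<omega>))\<^sup>2"
      unfolding couple_diff by (simp add: power_mult_distrib)
  qed
  also have "\<dots> = ennreal (\<integral>\<omega>. 2 * ?e\<^sup>2 + 2 * p\<^sup>2 * (norm (?D \<omega>))\<^sup>2 \<partial>coupling_space \<nu>)"
    by (intro nn_integral_eq_integral Bochner_Integration.integrable_add integrable_mult_right iD) auto
  also have "(\<integral>\<omega>. 2 * ?e\<^sup>2 + 2 * p\<^sup>2 * (norm (?D \<omega>))\<^sup>2 \<partial>coupling_space \<nu>) = K"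
    unfolding K_def m_def using iD t.prob_space
    by (subst Bochner_Integration.integral_add) (auto intro!: integrable_mult_right)
  finally have "(INF \<pi>\<in>couplings (ou_law \<nu> v b p) (gaussian \<mu> v). \<integral>\<^sup>+ z. ennreal ((dist (fst z) (snd z))\<^sup>2) \<partial>\<pi>) \<le> ennreal K"
    by (rule INF_lower2[OF pi])
  then obtain c where c: "c = (INF \<pi>\<in>couplings (ou_law \<nu> v b p) (gaussian \<mu> v). \<integral>\<^sup>+ z. ennreal ((dist (fst z) (snd z))\<^sup>2) \<partial>\<pi>)"
      "c \<le> ennreal K" by blast
  have K0: "K \<ge> 0" using m0 by (simp add: K_def)
  \<comment> \<open>Finiteness selects the real branch in the definition of
    \<open>W2\<close>.\<close>
  have "c \<noteq> \<infinity>" using c(2) by (metis ennreal_neq_top infinity_ennreal_def top.extremum_uniqueI)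
  then have "W2 (ou_law \<nu> v b p) (gaussian \<mu> v) = ennreal (sqrt (enn2real c))"
    unfolding W2_def Let_def c(1)[symmetric] by simp
  also have "\<dots> \<le> ennreal (sqrt K)"
    using c(2) K0 by (intro ennreal_leI real_sqrt_le_mono enn2real_leI) auto
  also have "sqrt K \<le> 2 * ?e + 2 * sqrt m * p"
  proof (rule real_le_lsqrt)
    have "K \<le> (2 * ?e)\<^sup>2 + (2 * sqrt m * p)\<^sup>2"
      using m0 by (simp add: K_def power_mult_distrib)
    also have "\<dots> \<le> (2 * ?e + 2 * sqrt m * p)\<^sup>2"
      using m0 p by (simp add: power2_sum)
    finally show "K \<le> (2 * ?e + 2 * sqrt m * p)\<^sup>2" .
  qed (use m0 p in auto)
  finally show ?thesis unfolding m_def by (simp add: ennreal_leI)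
qed

end

lemma sets_ou_law [simp, measurable_cong]: "sets (ou_law \<nu> v b p) = sets borel"
  by (simp add: ou_law_def)

lemma prob_space_ou_law: "prob_space \<nu> \<Longrightarrow> sets \<nu> = sets borel \<Longrightarrow> prob_space (ou_law \<nu> v b p)"
  unfolding ou_law_def by (rule prob_space_noised)

lemma ou_law_coeff:
  assumes "v \<ge> 0" "0 \<le> p" "p \<le> q" "q \<le> 1"
  shows "sqrt (v * (1 - q\<^sup>2)) \<le> sqrt (v * (1 - p\<^sup>2))" "sqrt (v * (1 - p\<^sup>2)) \<le> sqrt v"
    "0 \<le> sqrt (v * (1 - p\<^sup>2))"
proof -
  have "p\<^sup>2 \<le> q\<^sup>2" "q\<^sup>2 \<le> 1" using assms by (auto simp: power_mono power_le_one)
  then show "sqrt (v * (1 - q\<^sup>2)) \<le> sqrt (v * (1 - p\<^sup>2))" "0 \<le> sqrt (v * (1 - p\<^sup>2))"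
    using assms(1) by (auto intro!: mult_left_mono)
  show "sqrt (v * (1 - p\<^sup>2)) \<le> sqrt v"
    using assms(1) by (auto intro!: mult_left_le)
qed

section \<open>Consensus points of the laws reached by the dynamics\<close>

context consensus_objective
begin

text \<open>Under the synchronous coupling both integrals of the consensus quotient change by at
  most \<open>\<Lambda> * (p * m)\<close>. The difference of the quotients is arranged so that only
  the Gaussian normalization is divided by: it is bounded below for all means in the ball, whereas
  at \<open>p = 1\<close> the other law carries no noise. The price is the a priori bound
  \<open>K\<close> on the other consensus point.\<close>

lemma consensus_point_stability:
  fixes \<nu> :: "'a measure"
  assumes nu: "prob_space \<nu>" and s [measurable_cong]: "sets \<nu> = sets borel"
    and int: "integrable \<nu> (\<lambda>x. x)" and v: "v > 0" and a: "\<alpha> > 0" and K: "K \<ge> 0"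
  obtains C where "C \<ge> 0"
    "\<And>b p. norm b \<le> \<beta> \<Longrightarrow> 0 \<le> p \<Longrightarrow> p \<le> 1 \<Longrightarrow> norm (consensus_point f \<alpha> (ou_law \<nu> v b p)) \<le> K
      \<Longrightarrow> norm (consensus_point f \<alpha> (ou_law \<nu> v b p) - consensus_point f \<alpha> (gaussian b v)) \<le> C * p"
proof -
  obtain \<Lambda> where L: "\<Lambda> > 0" "\<And>x y. \<bar>wt \<alpha> x - wt \<alpha> y\<bar> \<le> \<Lambda> * norm (x - y)"
      "\<And>x y. norm (wt \<alpha> x *\<^sub>R x - wt \<alpha> y *\<^sub>R y) \<le> \<Lambda> * norm (x - y)"
    using wt_lipschitz[OF a] by blast
  let ?D = "\<lambda>\<omega>::'a \<times> 'a \<times> 'a. fst \<omega> - (\<integral>x. x \<partial>\<nu>) - sqrt v *\<^sub>R fst (snd \<omega>)"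
  define m where "m = (\<integral>\<omega>. norm (?D \<omega>) \<partial>coupling_space \<nu>)"
  have m: "m \<ge> 0" by (simp add: m_def)
  interpret t: prob_space "coupling_space \<nu>" by (rule prob_space_coupling_space[OF nu])
  interpret g: prob_space "gaussian (0::'a) 1" by (rule prob_space_gaussian) simp
  interpret gg: prob_space "gaussian (0::'a) 1 \<Otimes>\<^sub>M gaussian (0::'a) 1" by (rule prob_space_std_pair)
  have iD: "integrable (coupling_space \<nu>) (\<lambda>\<omega>. norm (?D \<omega>))"
  proof -
    have i1: "integrable (coupling_space \<nu>) (\<lambda>\<omega>. fst \<omega>)"
      by (rule integrable_pair_fst[OF gg.prob_space_axioms int])
    have "integrable (gaussian (0::'a) 1 \<Otimes>\<^sub>M gaussian (0::'a) 1) (\<lambda>z. fst z)"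
      by (rule integrable_pair_fst[OF g.prob_space_axioms integrable_gaussian_id]) simp
    then have i2: "integrable (coupling_space \<nu>) (\<lambda>\<omega>. fst (snd \<omega>))"
      by (rule integrable_pair_snd[OF nu gg.sigma_finite_measure_axioms])
    show ?thesis
      by (intro integrable_norm Bochner_Integration.integrable_diff integrable_scaleR_right i1 i2) simp
  qed
  obtain e where e: "e > 0" "cball xs e \<subseteq> {x. f x \<le> f xs + 1}"
    using sublevel_contains_ball[of 1] by auto
  have "sqrt v > 0" using v by simp
  from noised_ball_mass[OF nu s this order_refl e(1), of \<beta> xs]
  obtain p0 where p0: "p0 > 0" "\<And>b p c. norm b \<le> \<beta> \<Longrightarrow> 0 \<le> p \<Longrightarrow> p \<le> 1 \<Longrightarrow> sqrt v \<le> c \<Longrightarrow> c \<le> sqrt v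
      \<Longrightarrow> p0 \<le> measure (noised \<nu> b p c) (cball xs e)" by blast
  define d where "d = p0 * exp (- \<alpha> * (f xs + 1))"
  have d: "d > 0" using p0 by (simp add: d_def)
  have low: "d \<le> (\<integral>x. wt \<alpha> x \<partial>gaussian b v)" if b: "norm b \<le> \<beta>" for b
  proof -
    interpret G: prob_space "gaussian b v" by (rule prob_space_gaussian[OF v])
    have "p0 \<le> measure (gaussian b v) (cball xs e)"
      using p0(2)[OF b, of 0 "sqrt v"] gaussian_eq_noised[OF v nu s, of b] by simp
    also have "\<dots> \<le> measure (gaussian b v) {x. f x \<le> f xs + 1}"
      by (intro G.finite_measure_mono e) simp
    finally show ?thesis
      unfolding d_def using a p0(1)
      by (intro laplace_bound(1)[where \<psi> = "\<lambda>_. 0" and m = 0 and \<epsilon> = 0 and \<eta> = 0] G.prob_space_axioms) auto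
  qed
  define C where "C = \<Lambda> * m * (1 + K) / d"
  show ?thesis
  proof
    show "C \<ge> 0" using L(1) m K d by (simp add: C_def)
    fix b :: 'a and p :: real
    assume b: "norm b \<le> \<beta>" and p: "0 \<le> p" "p \<le> 1" and X: "norm (consensus_point f \<alpha> (ou_law \<nu> v b p)) \<le> K"
    define U where "U = couple_left \<nu> v b p"
    define V where "V = couple_right v b p"
    let ?P = "ou_law \<nu> v b p" and ?G = "gaussian b v"
    define Y where "Y = consensus_point f \<alpha> ?P"
    define T where "T = consensus_point f \<alpha> ?G"
    have P: "prob_space ?P" "prob_space ?G" by (rule prob_space_ou_law[OF nu s] prob_space_gaussian[OF v])+
    have a0: "\<alpha> \<ge> 0" using a by simp
    have UV: "U \<in> borel_measurable (coupling_space \<nu>)" "V \<in> borel_measurable (coupling_space \<nu>)"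
      unfolding U_def V_def using couple_measurable[OF nu s v] by auto
    note UV [measurable]
    have lU: "?P = distr (coupling_space \<nu>) borel U" and lV: "?G = distr (coupling_space \<nu>) borel V"
      unfolding U_def V_def using distr_couple_left[OF nu s v] distr_couple_right[OF nu s v p] by simp_all
    have idP: "integrable ?P (\<lambda>x. x)" "integrable ?G (\<lambda>x. x)"
      unfolding ou_law_def
      using noised_first_moment(1)[OF nu s int order_refl p _ order_refl] ou_law_coeff(3)[OF _ p order_refl, of v] v
        integrable_gaussian_id[OF v] by auto
    have tr: "integrable ?P h \<Longrightarrow> integrable ?G h \<Longrightarrow> (\<And>x y. norm (h x - h y) \<le> \<Lambda> * norm (x - y))
        \<Longrightarrow> norm ((\<integral>x. h x \<partial>?P) - (\<integral>x. h x \<partial>?G)) \<le> \<Lambda> * (p * m)"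
      if [measurable]: "h \<in> borel_measurable borel" for h :: "'a \<Rightarrow> 'b::{banach, second_countable_topology}"
    proof -
      assume i: "integrable ?P h" "integrable ?G h" and lip: "\<And>x y. norm (h x - h y) \<le> \<Lambda> * norm (x - y)"
      have i': "integrable (coupling_space \<nu>) (\<lambda>\<omega>. h (U \<omega>))" "integrable (coupling_space \<nu>) (\<lambda>\<omega>. h (V \<omega>))"
        using i unfolding lU lV by (simp_all add: integrable_distr_eq)
      have "norm ((\<integral>x. h x \<partial>?P) - (\<integral>x. h x \<partial>?G)) = norm (\<integral>\<omega>. h (U \<omega>) - h (V \<omega>) \<partial>coupling_space \<nu>)"
        unfolding lU lV using i' by (simp add: integral_distr)
      also have "\<dots> \<le> (\<integral>\<omega>. \<Lambda> * (p * norm (?D \<omega>)) \<partial>coupling_space \<nu>)"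
      proof (rule order_trans[OF integral_norm_bound integral_mono[OF integrable_norm]])
        show "integrable (coupling_space \<nu>) (\<lambda>\<omega>. h (U \<omega>) - h (V \<omega>))" using i' by simp
        show "integrable (coupling_space \<nu>) (\<lambda>\<omega>. \<Lambda> * (p * norm (?D \<omega>)))" by (intro integrable_mult_right iD)
        show "norm (h (U \<omega>) - h (V \<omega>)) \<le> \<Lambda> * (p * norm (?D \<omega>))" for \<omega>
          using lip[of "U \<omega>" "V \<omega>"] p by (simp add: U_def V_def couple_diff)
      qed
      also have "\<dots> = \<Lambda> * (p * m)" unfolding m_def by (simp only: integral_mult_right_zero)
      finally show ?thesis .
    qed
    have "(\<integral>x. wt \<alpha> x \<partial>?G) *\<^sub>R (T - Y)
        = ((\<integral>x. wt \<alpha> x *\<^sub>R x \<partial>?G) - (\<integral>x. wt \<alpha> x *\<^sub>R x \<partial>?P))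
          + ((\<integral>x. wt \<alpha> x \<partial>?P) - (\<integral>x. wt \<alpha> x \<partial>?G)) *\<^sub>R Y"
    proof -
      have "(\<integral>x. wt \<alpha> x *\<^sub>R x \<partial>?P) = (\<integral>x. wt \<alpha> x \<partial>?P) *\<^sub>R Y"
        using integral_wt_centered[OF a0 _ P(1) idP(1), of 0] by (simp add: Y_def)
      moreover have "(\<integral>x. wt \<alpha> x *\<^sub>R x \<partial>?G) = (\<integral>x. wt \<alpha> x \<partial>?G) *\<^sub>R T"
        using integral_wt_centered[OF a0 _ P(2) idP(2), of 0] by (simp add: T_def)
      ultimately show ?thesis by (simp add: scaleR_diff_left scaleR_diff_right)
    qed
    then have "norm ((\<integral>x. wt \<alpha> x \<partial>?G) *\<^sub>R (T - Y))
        \<le> norm ((\<integral>x. wt \<alpha> x *\<^sub>R x \<partial>?P) - (\<integral>x. wt \<alpha> x *\<^sub>R x \<partial>?G))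
          + norm ((\<integral>x. wt \<alpha> x \<partial>?P) - (\<integral>x. wt \<alpha> x \<partial>?G)) * norm Y"
      using norm_triangle_ineq[of "(\<integral>x. wt \<alpha> x *\<^sub>R x \<partial>?G) - (\<integral>x. wt \<alpha> x *\<^sub>R x \<partial>?P)"
          "((\<integral>x. wt \<alpha> x \<partial>?P) - (\<integral>x. wt \<alpha> x \<partial>?G)) *\<^sub>R Y"]
      by (simp only: norm_scaleR real_norm_def norm_minus_commute[of "\<integral>x. wt \<alpha> x *\<^sub>R x \<partial>?G"])
    also have "\<dots> \<le> \<Lambda> * (p * m) + \<Lambda> * (p * m) * K"
    proof (intro add_mono mult_mono tr)
      show "integrable ?P (\<lambda>x. wt \<alpha> x *\<^sub>R x)" "integrable ?G (\<lambda>x. wt \<alpha> x *\<^sub>R x)"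
        by (rule integrable_wt_times[OF a0 _ idP(1)] integrable_wt_times[OF a0 _ idP(2)]; simp)+
      show "integrable ?P (wt \<alpha>)" "integrable ?G (wt \<alpha>)"
        by (rule integrable_wt[OF a0 _ P(1)] integrable_wt[OF a0 _ P(2)]; simp)+
    qed (use L m p X in \<open>simp_all add: Y_def\<close>)
    also have "\<dots> = \<Lambda> * m * (1 + K) * p" by (simp add: algebra_simps)
    finally have "(\<integral>x. wt \<alpha> x \<partial>?G) * norm (T - Y) \<le> \<Lambda> * m * (1 + K) * p"
      using low[OF b] d by (simp only: norm_scaleR abs_of_pos order.strict_trans2)
    then have "d * norm (T - Y) \<le> \<Lambda> * m * (1 + K) * p"
      using mult_right_mono[OF low[OF b], of "norm (T - Y)"] by simp
    then show "norm (consensus_point f \<alpha> ?P - consensus_point f \<alpha> ?G) \<le> C * p"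
      using d by (simp add: C_def Y_def[symmetric] T_def[symmetric] norm_minus_commute field_simps)
  qed
qed

text \<open>The constant \<open>min (1 / 2) r\<close> is used twice: as a Lipschitz constant, and as
  a bound on the distance of the images from \<open>xs\<close>, so that the ball is mapped into
  itself and Banach's theorem applies. This gives the description in \<open>mu_inf\<close> its
  meaning.\<close>

lemma consensus_fixed_point_unique:
  assumes v: "v > 0" and r: "r > 0"
  defines "T \<equiv> \<lambda>\<alpha> \<mu>. consensus_point f \<alpha> (gaussian \<mu> v)"
  shows "\<forall>\<^sub>F \<alpha> in at_top. \<exists>!\<mu>. \<mu> \<in> cball xs r \<and> T \<alpha> \<mu> = \<mu>"
proof -
  have "min (1 / 2) r > 0" "norm xs + r > 0" using r by (auto simp: add_nonneg_pos)
  from gaussian_consensus_contraction[OF v this(2,1)]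
  show ?thesis
  proof eventually_elim
    case (elim \<alpha>)
    have sub: "\<mu> \<in> cball 0 (norm xs + r)" if "\<mu> \<in> cball xs r" for \<mu>
      using that norm_triangle_sub[of \<mu> xs] by (auto simp: dist_norm norm_minus_commute)
    have "\<exists>!\<mu>\<in>cball xs r. T \<alpha> \<mu> = \<mu>"
    proof (rule Banach_fix)
      show "T \<alpha> ` cball xs r \<subseteq> cball xs r"
        using elim sub by (force simp: T_def dist_norm norm_minus_commute)
      show "dist (T \<alpha> x) (T \<alpha> y) \<le> 1 / 2 * dist x y" if "x \<in> cball xs r" "y \<in> cball xs r" for x y
      proof -
        have "dist (T \<alpha> x) (T \<alpha> y) \<le> min (1 / 2) r * dist x y"
          using elim sub[OF that(1)] sub[OF that(2)] unfolding T_def dist_norm by blast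
        also have "\<dots> \<le> 1 / 2 * dist x y" by (intro mult_right_mono) auto
        finally show ?thesis .
      qed
    qed (use r in \<open>auto simp: complete_eq_closed\<close>)
    then show ?case by blast
  qed
qed

text \<open>The bound \<open>p \<le> q < 1\<close> keeps the noise level above
  \<open>sqrt (v * (1 - q\<^sup>2))\<close>, so these laws charge each ball around \<open>xs\<close>
  uniformly. The threshold for \<alpha> is therefore common to all means in the ball and all such
  \<open>p\<close>.\<close>

lemma ou_law_laplace:
  fixes \<nu> :: "'a measure"
  assumes nu: "prob_space \<nu>" and s [measurable_cong]: "sets \<nu> = sets borel"
    and int: "integrable \<nu> (\<lambda>x. x)" and v: "v > 0" and q: "0 \<le> q" "q < 1"
  shows "\<forall>\<^sub>F \<alpha> in at_top. \<forall>b p. norm b \<le> \<beta> \<longrightarrow> 0 \<le> p \<longrightarrow> p \<le> q \<longrightarrow>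
    norm (consensus_point f \<alpha> (ou_law \<nu> v b p) - xs) \<le> 1"
proof -
  define \<K> where "\<K> = {ou_law \<nu> v b p |b p. norm b \<le> \<beta> \<and> 0 \<le> p \<and> p \<le> q}"
  define c0 where "c0 = sqrt (v * (1 - q\<^sup>2))"
  define c1 where "c1 = sqrt v"
  define \<beta>' where "\<beta>' = \<beta> + norm (\<integral>x. x \<partial>\<nu>)"
  have "q\<^sup>2 < 1" using q by (simp add: power_less_one_iff)
  then have c0: "c0 > 0" using v by (simp add: c0_def)
  have repr: "\<exists>b p c. \<rho> = noised \<nu> b p c \<and> norm b \<le> \<beta>' \<and> 0 \<le> p \<and> p \<le> 1 \<and> c0 \<le> c \<and> c \<le> c1" if in_K: "\<rho> \<in> \<K>" for \<rho>
  proof -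
    obtain b p where bp: "\<rho> = ou_law \<nu> v b p" "norm b \<le> \<beta>" "0 \<le> p" "p \<le> q" using in_K unfolding \<K>_def by blast
    have "norm (b - p *\<^sub>R (\<integral>x. x \<partial>\<nu>)) \<le> norm b + p * norm (\<integral>x. x \<partial>\<nu>)"
      using norm_triangle_ineq4[of b "p *\<^sub>R (\<integral>x. x \<partial>\<nu>)"] bp by simp
    also have "\<dots> \<le> \<beta>'" unfolding \<beta>'_def using bp q by (intro add_mono mult_left_le_one_le) auto
    finally show ?thesis
      using bp q ou_law_coeff[of v p q] v unfolding bp(1) ou_law_def c0_def c1_def by fastforce
  qed
  have c01: "c0 \<le> c1" unfolding c0_def c1_def using ou_law_coeff(2)[of v q 1] q v by simp
  have "\<forall>\<^sub>F \<alpha> in at_top. \<forall>\<rho>\<in>\<K>. (\<integral>x. wt \<alpha> x * norm (x - xs) \<partial>\<rho>) \<le> 1 * (\<integral>x. wt \<alpha> x \<partial>\<rho>)"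
  proof (rule laplace_uniform)
    show "prob_space \<rho> \<and> sets \<rho> = sets borel" if "\<rho> \<in> \<K>" for \<rho>
      using that by (auto simp: \<K>_def s intro: prob_space_ou_law[OF nu s])
    show "\<exists>p>0. \<forall>\<rho>\<in>\<K>. p \<le> measure \<rho> (cball xs \<epsilon>)" if e: "\<epsilon> > 0" for \<epsilon>
    proof -
      obtain p0 where "p0 > 0" "\<And>b p c. norm b \<le> \<beta>' \<Longrightarrow> 0 \<le> p \<Longrightarrow> p \<le> 1 \<Longrightarrow> c0 \<le> c \<Longrightarrow> c \<le> c1
          \<Longrightarrow> p0 \<le> measure (noised \<nu> b p c) (cball xs \<epsilon>)"
        using noised_ball_mass[OF nu s c0 c01 e, of \<beta>' xs] by blast
      then show ?thesis using repr by metis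
    qed
    show "integrable \<rho> (\<lambda>x. norm (x - xs)) \<and> (\<integral>x. norm (x - xs) \<partial>\<rho>)
      \<le> \<beta>' + norm xs + (\<integral>x. norm x \<partial>\<nu>) + c1 * (\<integral>\<xi>. norm \<xi> \<partial>gaussian (0::'a) 1)" if r: "\<rho> \<in> \<K>" for \<rho>
    proof -
      obtain b p c where bpc: "\<rho> = noised \<nu> b p c" "norm b \<le> \<beta>'" "0 \<le> p" "p \<le> 1" "c0 \<le> c" "c \<le> c1"
        using repr[OF r] by blast
      interpret prob_space \<rho> unfolding bpc(1) by (rule prob_space_noised[OF nu s])
      have c: "0 \<le> c" using bpc c0 by simp
      have "integrable \<rho> (\<lambda>x. x)"
        unfolding bpc(1) by (rule noised_first_moment(1)[OF nu s int bpc(2-4) c bpc(6)])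
      then have "integrable \<rho> (\<lambda>x. norm (x - xs))"
        by (intro integrable_norm Bochner_Integration.integrable_diff) simp_all
      then show ?thesis
        unfolding bpc(1) using noised_first_moment(2)[OF nu s int bpc(2-4) c bpc(6)] by blast
    qed
    have "((\<lambda>x. norm (x - xs)) \<longlongrightarrow> norm (xs - xs)) (nhds xs)"
      by (intro tendsto_intros filterlim_ident)
    then show "((\<lambda>x. norm (x - xs)) \<longlongrightarrow> 0) (nhds xs)" by simp
  qed simp_all
  then show ?thesis
    using eventually_ge_at_top[of 0]
  proof eventually_elim
    case (elim \<alpha>)
    show ?case
    proof (intro allI impI)
      fix b :: 'a and p :: real
      assume bp: "norm b \<le> \<beta>" "0 \<le> p" "p \<le> q"
      then have "ou_law \<nu> v b p \<in> \<K>" by (auto simp: \<K>_def)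
      then have "(\<integral>x. wt \<alpha> x * norm (x - xs) \<partial>ou_law \<nu> v b p) \<le> 1 * (\<integral>x. wt \<alpha> x \<partial>ou_law \<nu> v b p)"
        using elim by blast
      moreover have "integrable (ou_law \<nu> v b p) (\<lambda>x. x)"
        unfolding ou_law_def
        by (rule noised_first_moment(1)[OF nu s int order_refl bp(2) _ _ order_refl])
           (use bp q ou_law_coeff(3)[of v p q] v in auto)
      ultimately show "norm (consensus_point f \<alpha> (ou_law \<nu> v b p) - xs) \<le> 1"
        by (intro consensus_point_dist_le elim prob_space_ou_law nu s) simp_all
    qed
  qed
qed

end

subsection \<open>Exponential convergence\<close>

text \<open>The sequence \<open>A * \<gamma> ^ i\<close> is a supersolution as soon as
  \<open>g' * A + C \<le> \<gamma> * A\<close>, which the stated constant achieves. The strict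
  inequality \<open>g' < \<gamma>\<close> prevents a resonance, so no factor growing with
  \<open>i\<close> appears.\<close>

lemma geometric_perturbation:
  fixes e :: "nat \<Rightarrow> real"
  assumes step: "\<And>i. e (Suc i) \<le> g' * e i + C * \<gamma> ^ i" and e0: "e 0 \<le> E" "E \<ge> 0"
    and g: "0 \<le> g'" "g' < \<gamma>" and C: "C \<ge> 0"
  shows "e i \<le> (E + C / (\<gamma> - g')) * \<gamma> ^ i"
proof (induction i)
  case 0
  then show ?case using e0 C g by (simp add: add_increasing2)
next
  case (Suc i)
  let ?A = "E + C / (\<gamma> - g')"
  have "C / (\<gamma> - g') * (\<gamma> - g') = C" using g by simp
  moreover have "E * (\<gamma> - g') \<ge> 0" using e0 g by simp
  ultimately have "C \<le> ?A * (\<gamma> - g')" by (simp add: distrib_right)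
  moreover have "?A * (\<gamma> - g') = \<gamma> * ?A - g' * ?A" by (subst mult.commute) (rule left_diff_distrib)
  ultimately have A: "g' * ?A + C \<le> \<gamma> * ?A" by linarith
  have "e (Suc i) \<le> g' * e i + C * \<gamma> ^ i" by (rule step)
  also have "\<dots> \<le> g' * (?A * \<gamma> ^ i) + C * \<gamma> ^ i"
    using Suc g by (intro add_right_mono mult_left_mono) auto
  also have "\<dots> = (g' * ?A + C) * \<gamma> ^ i" by (simp add: algebra_simps)
  also have "\<dots> \<le> (\<gamma> * ?A) * \<gamma> ^ i" by (rule mult_right_mono[OF A]) (use g in simp)
  finally show ?case by (simp add: mult.commute mult.left_commute)
qed

context consensus_objective
begin

text \<open>The solution is represented only by the implicit relation between the consensus points
  \<open>m\<close> and the laws they generate. As \<open>C\<close> is chosen before \<open>q\<close>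
  and \<open>m\<close>, one constant serves all \<open>q \<le> q'\<close>, hence all sufficiently
  large \<open>s\<close>.\<close>

lemma ou_law_convergence:
  fixes \<nu> :: "'a measure"
  assumes nu: "prob_space \<nu>" and s [measurable_cong]: "sets \<nu> = sets borel"
    and int: "integrable \<nu> (\<lambda>x. x)" and int2: "integrable \<nu> (\<lambda>x. (norm x)\<^sup>2)"
    and v: "v > 0" and S: "S > 0" "norm xs \<le> S" "norm (\<integral>x. x \<partial>\<nu>) \<le> S"
    and q': "0 \<le> q'" "q' < \<gamma>" "\<gamma> < 1"
  shows "\<forall>\<^sub>F \<alpha> in at_top. \<forall>\<mu>. \<mu> \<in> cball xs (2 * S) \<longrightarrow> consensus_point f \<alpha> (gaussian \<mu> v) = \<mu> \<longrightarrow>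
    (\<exists>C>0. \<forall>q m. 0 \<le> q \<longrightarrow> q \<le> q' \<longrightarrow>
      (\<forall>i. m i = consensus_point f \<alpha> (ou_law \<nu> v (mean_seq m q (\<integral>x. x \<partial>\<nu>) i) (q ^ i))) \<longrightarrow>
      (\<forall>i p. 0 \<le> p \<longrightarrow> p \<le> 1 \<longrightarrow>
        W2 (ou_law \<nu> v (p *\<^sub>R mean_seq m q (\<integral>x. x \<partial>\<nu>) i + (1 - p) *\<^sub>R m i) (p * q ^ i)) (gaussian \<mu> v)
          \<le> ennreal (C * \<gamma> ^ i)))"
proof -
  obtain K0 where K0: "\<forall>\<^sub>F \<alpha> in at_top. norm (consensus_point f \<alpha> \<nu>) \<le> K0"
    using consensus_point_bounded[OF nu s int] by blast
  \<comment> \<open>The radius of a ball that holds everything: \<open>3 * S\<close> covers the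
    initial mean and \<open>cball xs (2 * S)\<close>, \<open>K0\<close> the consensus point of the
    initial law, and \<open>norm xs + 1\<close> all later consensus points.\<close>
  define \<beta> where "\<beta> = max (3 * S) (max K0 (norm xs + 1))"
  \<comment> \<open>Half of the gap keeps the rate \<open>q' + \<kappa>\<close> of the means
    strictly below \<open>\<gamma>\<close>; the cap 1 simplifies the bound at times between
    updates.\<close>
  define \<kappa> where "\<kappa> = min 1 ((\<gamma> - q') / 2)"
  have beta: "\<beta> > 0" "3 * S \<le> \<beta>" "K0 \<le> \<beta>" "norm xs + 1 \<le> \<beta>" using S by (auto simp: \<beta>_def)
  have kappa: "\<kappa> > 0" "\<kappa> \<le> 1" "q' + \<kappa> < \<gamma>"
    using q' by (auto simp: \<kappa>_def min_def field_simps)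
  show ?thesis
    using K0 gaussian_consensus_contraction[OF v beta(1) kappa(1)]
      ou_law_laplace[OF nu s int v q'(1) order.strict_trans[OF q'(2,3)], of \<beta>] eventually_gt_at_top[of 0]
  proof eventually_elim
    case (elim \<alpha>)
    let ?X = "consensus_point f \<alpha>"
    obtain C1 where C1: "C1 \<ge> 0" "\<And>b p. norm b \<le> \<beta> \<Longrightarrow> 0 \<le> p \<Longrightarrow> p \<le> 1 \<Longrightarrow> norm (?X (ou_law \<nu> v b p)) \<le> \<beta>
      \<Longrightarrow> norm (?X (ou_law \<nu> v b p) - ?X (gaussian b v)) \<le> C1 * p"
      using consensus_point_stability[OF nu s int v elim(4), of \<beta> \<beta>] beta(1) by (metis less_imp_le)
    define M where "M = sqrt (\<integral>\<omega>. (norm (fst \<omega> - (\<integral>x. x \<partial>\<nu>) - sqrt v *\<^sub>R fst (snd \<omega>)))\<^sup>2 \<partial>coupling_space \<nu>)"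
    have M: "M \<ge> 0" by (simp add: M_def)
    define A where "A = 2 * \<beta> + C1 / (\<gamma> - (q' + \<kappa>))"
    have A: "A \<ge> 0" using beta C1 kappa by (simp add: A_def)
    \<comment> \<open>Between updates the means differ by at most
      \<open>(2 * A + C1) * \<gamma> ^ i\<close>, where \<open>A\<close> is the constant of
      \<open>geometric_perturbation\<close> with initial error \<open>2 * \<beta>\<close>. The outer
      factor 2 and \<open>2 * M\<close> come from \<open>W2_ou_law\<close>, and the 1 ensures
      positivity.\<close>
    define C where "C = 2 * (2 * A + C1) + 2 * M + 1"
    have C: "C > 0" using A C1 M by (simp add: C_def add_nonneg_pos)
    show ?case
    proof (intro allI impI exI[of _ C] conjI C)
      fix \<mu> :: 'a and q :: real and m :: "nat \<Rightarrow> 'a" and i :: nat and p :: real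
      assume mu: "\<mu> \<in> cball xs (2 * S)" "?X (gaussian \<mu> v) = \<mu>" and q: "0 \<le> q" "q \<le> q'"
        and m: "\<forall>i. m i = ?X (ou_law \<nu> v (mean_seq m q (\<integral>x. x \<partial>\<nu>) i) (q ^ i))" and p: "0 \<le> p" "p \<le> 1"
      define b where "b = mean_seq m q (\<integral>x. x \<partial>\<nu>)"
      have m': "m i = ?X (ou_law \<nu> v (b i) (q ^ i))" for i using m by (simp add: b_def)
      have q1: "q \<le> 1" using q q' by simp
      have qi: "0 \<le> q ^ i" "q ^ i \<le> 1" "q ^ i \<le> \<gamma> ^ i" for i
        using q q1 q' by (auto simp: power_le_one intro!: power_mono)
      have muB: "norm \<mu> \<le> \<beta>"
        using mu(1) S(2) beta(2) norm_triangle_sub[of \<mu> xs] by (auto simp: dist_norm norm_minus_commute)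
      \<comment> \<open>The index 0 is separate because the initial law carries no Gaussian noise.
        From index 1 on, \<open>q ^ i \<le> q \<le> q'\<close> leaves enough noise for concentration
        near \<open>xs\<close>.\<close>
      have mb: "norm (m i) \<le> \<beta>" if "norm (b i) \<le> \<beta>" for i
      proof (cases i)
        case 0
        have "ou_law \<nu> v (b 0) (q ^ 0) = \<nu>" by (simp add: b_def ou_law_def noised_trivial[OF s])
        then show ?thesis using elim(1) beta(3) by (simp add: m' 0)
      next
        case (Suc j)
        have "q ^ i \<le> q" using q q1 by (simp add: Suc mult_left_le power_le_one)
        then have "norm (m i - xs) \<le> 1"
          using elim(3) that qi(1)[of i] q unfolding m' by (meson order_trans)
        then show ?thesis using beta(4) norm_triangle_sub[of "m i" xs] by linarith
      qed
      have convex: "norm (c *\<^sub>R x + (1 - c) *\<^sub>R y) \<le> c * norm x + (1 - c) * norm y" if "0 \<le> c" "c \<le> 1"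
        for c :: real and x y :: 'a
        using norm_triangle_ineq[of "c *\<^sub>R x" "(1 - c) *\<^sub>R y"] that by simp
      have bb: "norm (b i) \<le> \<beta>" for i
      proof (induction i)
        case 0 then show ?case using S beta by (simp add: b_def)
      next
        case (Suc i)
        have "norm (b (Suc i)) \<le> q * norm (b i) + (1 - q) * norm (m i)"
          using convex[OF q(1) q1] by (simp add: b_def)
        also have "\<dots> \<le> q * \<beta> + (1 - q) * \<beta>"
          using q q1 Suc mb[OF Suc] by (intro add_mono mult_left_mono) auto
        finally show ?case by (simp add: algebra_simps)
      qed
      define e where "e i = norm (b i - \<mu>)" for i
      have mm: "norm (m i - \<mu>) \<le> C1 * q ^ i + \<kappa> * e i" for i
      proof -
        have "norm (?X (gaussian (b i) v) - ?X (gaussian \<mu> v)) \<le> \<kappa> * norm (b i - \<mu>)"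
          using elim(2) bb[of i] muB by auto
        moreover have "norm (m i - ?X (gaussian (b i) v)) \<le> C1 * q ^ i"
          unfolding m' using mb[OF bb, of i] by (intro C1(2) bb qi) (simp add: m')
        moreover have "norm (m i - \<mu>) \<le> norm (m i - ?X (gaussian (b i) v)) + norm (?X (gaussian (b i) v) - \<mu>)"
          using norm_triangle_ineq[of "m i - ?X (gaussian (b i) v)" "?X (gaussian (b i) v) - \<mu>"] by simp
        ultimately show ?thesis by (simp add: mu(2) e_def)
      qed
      have mix: "norm (c *\<^sub>R b i + (1 - c) *\<^sub>R m i - \<mu>) \<le> c * e i + (\<kappa> * e i + C1 * \<gamma> ^ i)"
        if c: "0 \<le> c" "c \<le> 1" for c i
      proof -
        have "c *\<^sub>R b i + (1 - c) *\<^sub>R m i - \<mu> = c *\<^sub>R (b i - \<mu>) + (1 - c) *\<^sub>R (m i - \<mu>)"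
          by (simp add: algebra_simps)
        then have "norm (c *\<^sub>R b i + (1 - c) *\<^sub>R m i - \<mu>) \<le> c * e i + (1 - c) * norm (m i - \<mu>)"
          using convex[OF c, of "b i - \<mu>" "m i - \<mu>"] by (simp add: e_def)
        also have "(1 - c) * norm (m i - \<mu>) \<le> norm (m i - \<mu>)"
          using c by (intro mult_left_le_one_le) auto
        also have "norm (m i - \<mu>) \<le> \<kappa> * e i + C1 * \<gamma> ^ i"
          using mm[of i] mult_left_mono[OF qi(3)[of i] C1(1)] by linarith
        finally show ?thesis by simp
      qed
      have ei: "e i \<le> A * \<gamma> ^ i" for i
        unfolding A_def
      proof (rule geometric_perturbation)
        show "e (Suc i) \<le> (q' + \<kappa>) * e i + C1 * \<gamma> ^ i" for i
        proof -
          have "e (Suc i) \<le> q * e i + (\<kappa> * e i + C1 * \<gamma> ^ i)"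
            using mix[OF q(1) q1, of i] by (simp add: e_def b_def)
          moreover have "q * e i \<le> q' * e i" by (intro mult_right_mono q) (simp add: e_def)
          ultimately show ?thesis by (simp add: distrib_right)
        qed
        show "e 0 \<le> 2 * \<beta>" using norm_triangle_ineq4[of "b 0" \<mu>] bb[of 0] muB by (simp add: e_def)
      qed (use beta kappa q' C1 in auto)
      define w where "w = p *\<^sub>R b i + (1 - p) *\<^sub>R m i"
      have e0: "e i \<ge> 0" by (simp add: e_def)
      have "norm (w - \<mu>) \<le> p * e i + (\<kappa> * e i + C1 * \<gamma> ^ i)" unfolding w_def by (rule mix[OF p])
      also have "p * e i \<le> A * \<gamma> ^ i" using mult_left_le_one_le[OF e0 p] ei[of i] by linarith
      also have "\<kappa> * e i \<le> A * \<gamma> ^ i"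
        using mult_left_le_one_le[OF e0 less_imp_le[OF kappa(1)] kappa(2)] ei[of i] by linarith
      finally have wm: "norm (w - \<mu>) \<le> (2 * A + C1) * \<gamma> ^ i" by (simp add: algebra_simps)
      have pq: "0 \<le> p * q ^ i" "p * q ^ i \<le> 1" "p * q ^ i \<le> \<gamma> ^ i"
        using p qi[of i] by (auto intro: mult_le_one order_trans[OF mult_left_le_one_le])
      have "W2 (ou_law \<nu> v w (p * q ^ i)) (gaussian \<mu> v) \<le> ennreal (2 * norm (w - \<mu>) + 2 * M * (p * q ^ i))"
        unfolding M_def by (rule W2_ou_law[OF nu s v int2 pq(1,2)])
      also have "\<dots> \<le> ennreal (C * \<gamma> ^ i)"
      proof (rule ennreal_leI)
        have "2 * M * (p * q ^ i) \<le> 2 * M * \<gamma> ^ i" using M pq by (intro mult_left_mono) auto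
        moreover have "0 \<le> \<gamma> ^ i" using q' by simp
        ultimately show "2 * norm (w - \<mu>) + 2 * M * (p * q ^ i) \<le> C * \<gamma> ^ i"
          using wm by (simp add: C_def algebra_simps)
      qed
      finally show "W2 (ou_law \<nu> v (p *\<^sub>R mean_seq m q (\<integral>x. x \<partial>\<nu>) i + (1 - p) *\<^sub>R m i) (p * q ^ i)) (gaussian \<mu> v)
          \<le> ennreal (C * \<gamma> ^ i)"
        by (simp add: w_def b_def)
    qed
  qed
qed

end

lemma P4_integrable:
  assumes "\<rho> \<in> P4"
  shows "prob_space \<rho>" "sets \<rho> = sets borel" "integrable \<rho> (\<lambda>x. x)" "integrable \<rho> (\<lambda>x. (norm x)\<^sup>2)"
proof -
  show p: "prob_space \<rho>" and s [measurable_cong]: "sets \<rho> = sets borel" using assms by (auto simp: P4_def)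
  interpret prob_space \<rho> by (rule p)
  have "integrable \<rho> (\<lambda>x. norm x ^ 4)"
    using assms by (intro integrableI_nonneg) (auto simp: P4_def moment_def)
  then have i: "integrable \<rho> (\<lambda>x. 1 + norm x ^ 4)" by simp
  have sq: "t\<^sup>2 \<le> 1 + t ^ 4" "t \<le> 1 + t ^ 4" for t :: real
  proof -
    have "0 \<le> (t\<^sup>2 - 1)\<^sup>2" by simp
    then have 2: "2 * t\<^sup>2 \<le> 1 + t ^ 4" by (simp add: power2_diff power_mult[symmetric])
    then show "t\<^sup>2 \<le> 1 + t ^ 4" using zero_le_power2[of t] by linarith
    have "0 \<le> (t - 1)\<^sup>2" by simp
    then have "2 * t \<le> t\<^sup>2 + 1" by (simp add: power2_diff)
    moreover have "0 \<le> t ^ 4" by simp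
    ultimately show "t \<le> 1 + t ^ 4" using 2 by linarith
  qed
  show "integrable \<rho> (\<lambda>x. x)" "integrable \<rho> (\<lambda>x. (norm x)\<^sup>2)"
    by (rule Bochner_Integration.integrable_bound[OF i]; use sq in \<open>auto intro!: AE_I2\<close>)+
qed

theorem theorem3p10:
  fixes f :: "real ^ 'd \<Rightarrow> real" and xs :: "real ^ 'd"
    and L\<^sub>f c\<^sub>l c\<^sub>u R lam \<delta> \<Delta>t S :: real
    and \<rho>\<^sub>0 :: "(real ^ 'd) measure"
    and M :: "real \<Rightarrow> real \<Rightarrow> 'w measure" and F :: "real \<Rightarrow> real \<Rightarrow> real \<Rightarrow> 'w measure"
    and B X :: "real \<Rightarrow> real \<Rightarrow> real \<Rightarrow> 'w \<Rightarrow> real ^ 'd"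
    and \<rho> :: "real \<Rightarrow> real \<Rightarrow> real \<Rightarrow> (real ^ 'd) measure"
  assumes f_cont: "continuous_on UNIV f"
    and xs_min: "\<And>x. f xs \<le> f x"
    and xs_unique: "\<And>x. f x = f xs \<Longrightarrow> x = xs"
    and consts_pos: "L\<^sub>f > 0" "c\<^sub>l > 0" "c\<^sub>u > 0" "R > 0"
    and f_lipschitz: "\<And>x y. \<bar>f x - f y\<bar> \<le> L\<^sub>f * (1 + norm x + norm y) * norm (x - y)"
    and f_upper: "\<And>x. f x - f xs \<le> c\<^sub>u * ((norm x)\<^sup>2 + 1)"
    and f_lower: "\<And>x. norm x \<ge> R \<Longrightarrow> c\<^sub>l * (norm x)\<^sup>2 \<le> f x - f xs"
    and params_pos: "lam > 0" "\<delta> > 0" "\<Delta>t > 0"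
    and init: "\<rho>\<^sub>0 \<in> P4"
    and sol: "\<And>\<alpha> s. \<alpha> > 0 \<Longrightarrow> s > 0 \<Longrightarrow>
      CF_solution f \<alpha> lam \<delta> s \<Delta>t \<rho>\<^sub>0 (M \<alpha> s) (F \<alpha> s) (B \<alpha> s) (X \<alpha> s)"
    and law: "\<And>\<alpha> s t. \<alpha> > 0 \<Longrightarrow> s > 0 \<Longrightarrow> t \<ge> 0 \<Longrightarrow> \<rho> \<alpha> s t = distr (M \<alpha> s) borel (X \<alpha> s t)"
    and S_pos: "S > 0"
    and S_balls: "xs \<in> cball 0 S" "(\<integral>x. x \<partial>\<rho>\<^sub>0) \<in> cball 0 S"
  shows "(\<forall>\<^sub>F \<alpha> in at_top. \<forall>s>0.
            CF_invariant TYPE('w) f \<alpha> lam \<delta> s \<Delta>t (rho_inf f \<alpha> lam \<delta> xs (2 * S))) \<and>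
         (\<forall>s>0. S_bounds f (\<lambda>\<alpha>. \<rho> \<alpha> s) S \<longrightarrow>
            (\<forall>\<gamma>. exp (- s * lam * \<Delta>t) < \<gamma> \<and> \<gamma> < 1 \<longrightarrow>
               (\<forall>\<^sub>F \<alpha> in at_top. \<exists>C>0.
                  \<forall>i::nat. \<forall>t\<in>{real i * \<Delta>t ..< real (Suc i) * \<Delta>t}.
                    W2 (\<rho> \<alpha> s t) (rho_inf f \<alpha> lam \<delta> xs (2 * S)) \<le> ennreal (C * \<gamma> ^ i)))) \<and>
         (\<forall>s'>0. (\<forall>s\<ge>s'. S_bounds f (\<lambda>\<alpha>. \<rho> \<alpha> s) S) \<longrightarrow>
            (\<forall>\<gamma>. exp (- s' * lam * \<Delta>t) < \<gamma> \<and> \<gamma> < 1 \<longrightarrow>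
               (\<forall>\<^sub>F \<alpha> in at_top. \<exists>C>0. \<forall>s\<ge>s'.
                  \<forall>i::nat. \<forall>t\<in>{real i * \<Delta>t ..< real (Suc i) * \<Delta>t}.
                    W2 (\<rho> \<alpha> s t) (rho_inf f \<alpha> lam \<delta> xs (2 * S)) \<le> ennreal (C * \<gamma> ^ i))))"
proof -
  interpret consensus_objective f xs L\<^sub>f c\<^sub>l R
    by unfold_locales (use f_cont xs_min xs_unique consts_pos f_lipschitz f_lower in auto)
  define v where "v = \<delta>\<^sup>2 / (2 * lam)"
  have v: "v > 0" using params_pos by (simp add: v_def)
  define \<mu> where "\<mu> \<alpha> = mu_inf f \<alpha> lam \<delta> xs (2 * S)" for \<alpha>
  have rho: "rho_inf f \<alpha> lam \<delta> xs (2 * S) = gaussian (\<mu> \<alpha>) v" for \<alpha>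
    by (simp add: rho_inf_def \<mu>_def v_def)
  have r: "2 * S > 0" using S_pos by simp
  have fixed: "\<forall>\<^sub>F \<alpha> in at_top. \<mu> \<alpha> \<in> cball xs (2 * S) \<and> consensus_map f \<alpha> lam \<delta> (\<mu> \<alpha>) = \<mu> \<alpha>"
    using consensus_fixed_point_unique[OF v r]
  proof eventually_elim
    case (elim \<alpha>)
    then show ?case
      unfolding \<mu>_def mu_inf_def consensus_map_def v_def[symmetric] by (rule theI')
  qed
  note P4 = P4_integrable[OF init]
  have main: "\<forall>\<^sub>F \<alpha> in at_top. \<exists>C>0. \<forall>s\<ge>s'. \<forall>i::nat. \<forall>t\<in>{real i * \<Delta>t ..< real (Suc i) * \<Delta>t}.
      W2 (\<rho> \<alpha> s t) (gaussian (\<mu> \<alpha>) v) \<le> ennreal (C * \<gamma> ^ i)"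
    if s': "s' > 0" and g: "exp (- s' * lam * \<Delta>t) < \<gamma>" "\<gamma> < 1" for s' \<gamma>
  proof -
    have xs0: "norm xs \<le> S" "norm (\<integral>x. x \<partial>\<rho>\<^sub>0) \<le> S" using S_balls by auto
    from ou_law_convergence[OF P4 v S_pos xs0 exp_ge_zero g]
    show ?thesis
      using fixed eventually_gt_at_top[of 0]
    proof eventually_elim
      case (elim \<alpha>)
      from elim(2) have fx: "\<mu> \<alpha> \<in> cball xs (2 * S)" "consensus_point f \<alpha> (gaussian (\<mu> \<alpha>) v) = \<mu> \<alpha>"
        by (simp_all add: consensus_map_def v_def)
      obtain C where C: "C > 0" "\<And>q m i p. 0 \<le> q \<Longrightarrow> q \<le> exp (- s' * lam * \<Delta>t) \<Longrightarrow>
          (\<And>i. m i = consensus_point f \<alpha> (ou_law \<rho>\<^sub>0 v (mean_seq m q (\<integral>x. x \<partial>\<rho>\<^sub>0) i) (q ^ i))) \<Longrightarrow> 0 \<le> p \<Longrightarrow> p \<le> 1 \<Longrightarrow>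
          W2 (ou_law \<rho>\<^sub>0 v (p *\<^sub>R mean_seq m q (\<integral>x. x \<partial>\<rho>\<^sub>0) i + (1 - p) *\<^sub>R m i) (p * q ^ i)) (gaussian (\<mu> \<alpha>) v)
            \<le> ennreal (C * \<gamma> ^ i)"
        using elim(1)[rule_format, OF fx] by blast
      show ?case
      proof (intro exI[of _ C] conjI C(1) allI impI ballI)
        fix s :: real and i :: nat and t :: real
        assume s: "s \<ge> s'" and t: "t \<in> {real i * \<Delta>t ..< real (Suc i) * \<Delta>t}"
        have s0: "s > 0" using s s' by simp
        have "0 \<le> real i * \<Delta>t" using params_pos(3) by simp
        with t have t0: "real i * \<Delta>t \<le> t" "t \<le> real (Suc i) * \<Delta>t" "t \<ge> 0"
          by (simp_all only: atLeastLessThan_iff) linarith+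
        define q where "q = exp (- (s * lam * \<Delta>t))"
        define m where "m i = consensus_point f \<alpha> (distr (M \<alpha> s) borel (X \<alpha> s (real i * \<Delta>t)))" for i :: nat
        note L = CF_law[OF sol[OF elim(3) s0] params_pos(1,2) s0 params_pos(3) P4(2),
          folded v_def q_def m_def]
        \<comment> \<open>A larger \<open>s\<close> contracts more strongly, so its factor
          \<open>q\<close> stays below the one that belongs to \<open>s'\<close>.\<close>
        have "s' * (lam * \<Delta>t) \<le> s * (lam * \<Delta>t)"
          using s params_pos by (intro mult_right_mono) auto
        then have q: "0 \<le> q" "q \<le> exp (- s' * lam * \<Delta>t)"
          by (auto simp: q_def mult.assoc)
        \<comment> \<open>The points \<open>m\<close> come from the actual laws, and
          \<open>CF_law\<close> identifies these laws with those generated by \<open>m\<close>; this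
          is the implicit relation that \<open>ou_law_convergence\<close> expects.\<close>
        have m: "m i = consensus_point f \<alpha> (ou_law \<rho>\<^sub>0 v (mean_seq m q (\<integral>x. x \<partial>\<rho>\<^sub>0) i) (q ^ i))" for i
          unfolding L(1)[of i, symmetric] by (simp add: m_def)
        obtain p where p: "0 \<le> p" "p \<le> 1"
          "distr (M \<alpha> s) borel (X \<alpha> s t)
            = ou_law \<rho>\<^sub>0 v (p *\<^sub>R mean_seq m q (\<integral>x. x \<partial>\<rho>\<^sub>0) i + (1 - p) *\<^sub>R m i) (p * q ^ i)"
          using L(2)[OF t0(1,2)] by auto
        show "W2 (\<rho> \<alpha> s t) (gaussian (\<mu> \<alpha>) v) \<le> ennreal (C * \<gamma> ^ i)"
          unfolding law[OF elim(3) s0 t0(3)] p(3) by (rule C(2)[OF q m p(1,2)])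
      qed
    qed
  qed
  show ?thesis
    unfolding rho
  proof (intro conjI allI impI)
    show "\<forall>\<^sub>F \<alpha> in at_top. \<forall>s>0. CF_invariant TYPE('w) f \<alpha> lam \<delta> s \<Delta>t (gaussian (\<mu> \<alpha>) v)"
      using fixed unfolding v_def by eventually_elim (use params_pos in \<open>auto intro: gaussian_invariant\<close>)
  next
    fix s \<gamma> :: real
    assume "s > 0" "exp (- s * lam * \<Delta>t) < \<gamma> \<and> \<gamma> < 1"
    \<comment> \<open>A fixed \<open>s\<close> is itself taken as the lower bound of the range over
      which the estimate is uniform.\<close>
    then have "\<forall>\<^sub>F \<alpha> in at_top. \<exists>C>0. \<forall>s'\<ge>s. \<forall>i::nat. \<forall>t\<in>{real i * \<Delta>t ..< real (Suc i) * \<Delta>t}.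
      W2 (\<rho> \<alpha> s' t) (gaussian (\<mu> \<alpha>) v) \<le> ennreal (C * \<gamma> ^ i)" by (intro main) auto
    then show "\<forall>\<^sub>F \<alpha> in at_top. \<exists>C>0. \<forall>i::nat. \<forall>t\<in>{real i * \<Delta>t ..< real (Suc i) * \<Delta>t}.
      W2 (\<rho> \<alpha> s t) (gaussian (\<mu> \<alpha>) v) \<le> ennreal (C * \<gamma> ^ i)"
      by eventually_elim blast
  next
    fix s' \<gamma> :: real
    assume "s' > 0" "exp (- s' * lam * \<Delta>t) < \<gamma> \<and> \<gamma> < 1"
    then show "\<forall>\<^sub>F \<alpha> in at_top. \<exists>C>0. \<forall>s\<ge>s'. \<forall>i::nat. \<forall>t\<in>{real i * \<Delta>t ..< real (Suc i) * \<Delta>t}.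
      W2 (\<rho> \<alpha> s t) (gaussian (\<mu> \<alpha>) v) \<le> ennreal (C * \<gamma> ^ i)" by (intro main) auto
  qed
qed

end
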